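(* There exists a numerical constant $C>0$ such that the following holds for every integer $d\ge1$ and every centered probability measure $\nu$ on the Borel sets of $\mathbb{R}^d$ admitting a Stein kernel $\tau_\nu$: for every $1$-Lipschitz function $u:\mathbb{R}^d\to\mathbb{R}$ with $\int_{\mathbb{R}^d}u\,d\nu=0$, and every $p\ge2$, $$ \bigg(\int_{\mathbb{R}^d}|u|^p\,d\nu\bigg)^{1/p}\,\le\,C\bigg[{\rm S}_p(\nu\,|\,\gamma)+\sqrt p\,\bigg(\int_{\mathbb{R}^d}\|\tau_\nu\|_{\rm op}^{p/2}\,d\nu\bigg)^{1/p}\bigg]. $$
   Context: A measurable matrix-valued map $\tau_\nu=(\tau_\nu^{ij})_{1\le i,j\le d}$ on $\mathbb{R}^d$ is a Stein kernel for $\nu$ if $\tau_\nu^{ij}\in L^1(\nu)$ for all $i,j$ and, for every smooth test function $\varphi:\mathbb{R}^d\to\mathbb{R}$ (the coordinate functions $x_i$ and the products $x_ix_j$ being admissible), $$\int_{\mathbb{R}^d} x\cdot\nabla\varphi\,d\nu=\int_{\mathbb{R}^d}\langle\tau_\nu,{\rm Hess}(\varphi)\rangle_{\rm HS}\,d\nu,$$ with $\langle\cdot,\cdot\rangle_{\rm HS}$, $\|\cdot\|_{\rm HS}$ the Hilbert-Schmidt scalar product and norm; without loss of generality $\tau_\nu$ is taken symmetric $\nu$-a.e. Centered means $\int x_j\,d\nu=0$ for all $j$. $\|\cdot\|_{\rm op}$ is the operator norm on $d\times d$ matrices. $\gamma$ is the standard Gaussian measure on $\mathbb{R}^d$ and,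 for $p\ge1$, ${\rm S}_p(\nu|\gamma)=\big(\int_{\mathbb{R}^d}\|\tau_\nu-{\rm Id}\|_{\rm HS}^p\,d\nu\big)^{1/p}$ (possibly infinite). Numerical constant means independent of $d$, $\nu$, $u$ and $p$. *)

theory Defs
  imports "HOL-Probability.Probability"
begin

text \<open>
  The constant in the theorem is uniform in the dimension, so the dimension has to be a bound
  variable of the statement and not a type. Therefore \<open>\<real>\<^sup>d\<close> is rendered as the space of the finite
  product measure \<open>Pi\<^sub>M {..<d} (\<lambda>_. borel)\<close>: real functions on \<open>{..<d}\<close>, extended by
  \<^term>\<open>undefined\<close>. Matrices are functions of two indices, of which only the entries with
  indices below \<open>d\<close> matter.

  On this carrier the topology of the function type is the usual topology of \<open>\<real>\<^sup>d\<close>, but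
  \<^const>\<open>dist\<close> on \<^typ>\<open>nat \<Rightarrow> real\<close> is not the Euclidean distance; hence the Euclidean
  norm is written with \<^const>\<open>L2_set\<close>.
\<close>

definition Rd :: "nat \<Rightarrow> (nat \<Rightarrow> real) set" where
  "Rd d = PiE {..<d} (\<lambda>_. UNIV)"

definition borel_Rd :: "nat \<Rightarrow> (nat \<Rightarrow> real) measure" where
  "borel_Rd d = Pi\<^sub>M {..<d} (\<lambda>_. borel)"

definition enorm :: "nat \<Rightarrow> (nat \<Rightarrow> real) \<Rightarrow> real" where
  "enorm d x = L2_set x {..<d}"

definition hs_inner :: "nat \<Rightarrow> (nat \<Rightarrow> nat \<Rightarrow> real) \<Rightarrow> (nat \<Rightarrow> nat \<Rightarrow> real) \<Rightarrow> real" where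
  "hs_inner d A B = (\<Sum>i<d. \<Sum>j<d. A i j * B i j)"

definition hs_norm :: "nat \<Rightarrow> (nat \<Rightarrow> nat \<Rightarrow> real) \<Rightarrow> real" where
  "hs_norm d A = sqrt (hs_inner d A A)"

definition op_norm :: "nat \<Rightarrow> (nat \<Rightarrow> nat \<Rightarrow> real) \<Rightarrow> real" where
  "op_norm d A = (SUP v\<in>{v \<in> Rd d. enorm d v \<le> 1}. enorm d (\<lambda>i. \<Sum>j<d. A i j * v j))"

definition id_mat :: "nat \<Rightarrow> nat \<Rightarrow> real" where
  "id_mat i j = (if i = j then 1 else 0)"

definition partial_deriv ::
    "nat \<Rightarrow> ((nat \<Rightarrow> real) \<Rightarrow> real) \<Rightarrow> (nat \<Rightarrow> real) \<Rightarrow> real" where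
  "partial_deriv i f x = deriv (\<lambda>t. f (x(i := t))) (x i)"

text \<open>A function is of class \<open>C\<^sup>k\<close> iff its iterated partial derivatives up to order \<open>k\<close> exist
  and are continuous.\<close>

primrec C_diff :: "nat \<Rightarrow> nat \<Rightarrow> ((nat \<Rightarrow> real) \<Rightarrow> real) \<Rightarrow> bool" where
  "C_diff d 0 f \<longleftrightarrow> continuous_on (Rd d) f"
| "C_diff d (Suc k) f \<longleftrightarrow> continuous_on (Rd d) f \<and>
     (\<forall>i<d. (\<forall>x\<in>Rd d. (\<lambda>t. f (x(i := t))) differentiable at (x i)) \<and>
            C_diff d k (partial_deriv i f))"

definition smooth :: "nat \<Rightarrow> ((nat \<Rightarrow> real) \<Rightarrow> real) \<Rightarrow> bool" where
  "smooth d f \<longleftrightarrow> (\<forall>k. C_diff d k f)"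

definition compactly_supported :: "nat \<Rightarrow> ((nat \<Rightarrow> real) \<Rightarrow> real) \<Rightarrow> bool" where
  "compactly_supported d f \<longleftrightarrow> (\<exists>r. \<forall>x\<in>Rd d. enorm d x > r \<longrightarrow> f x = 0)"

text \<open>The admissible test functions: \<open>C\<^sub>c\<^sup>\<infinity>\<close>, the coordinate functions and their products.\<close>

definition test_functions :: "nat \<Rightarrow> ((nat \<Rightarrow> real) \<Rightarrow> real) set" where
  "test_functions d =
     {f. smooth d f \<and> compactly_supported d f}
     \<union> {(\<lambda>x. x i) | i. i < d}
     \<union> {(\<lambda>x. x i * x j) | i j. i < d \<and> j < d}"

definition hessian ::
    "((nat \<Rightarrow> real) \<Rightarrow> real) \<Rightarrow> (nat \<Rightarrow> real) \<Rightarrow> nat \<Rightarrow> nat \<Rightarrow> real" where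
  "hessian f x i j = partial_deriv i (partial_deriv j f) x"

text \<open>Both integrals are required to exist, because the Bochner integral of a non-integrable
  function is \<open>0\<close> by convention. Symmetry of the kernel, which is only a normalisation, is not assumed.\<close>

definition stein_kernel ::
    "nat \<Rightarrow> (nat \<Rightarrow> real) measure \<Rightarrow> ((nat \<Rightarrow> real) \<Rightarrow> nat \<Rightarrow> nat \<Rightarrow> real) \<Rightarrow> bool" where
  "stein_kernel d \<nu> \<tau> \<longleftrightarrow>
     (\<forall>i<d. \<forall>j<d. integrable \<nu> (\<lambda>x. \<tau> x i j)) \<and>
     (\<forall>f\<in>test_functions d.
        integrable \<nu> (\<lambda>x. \<Sum>i<d. x i * partial_deriv i f x) \<and>
        integrable \<nu> (\<lambda>x. hs_inner d (\<tau> x) (hessian f x)) \<and>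
        (\<integral>x. (\<Sum>i<d. x i * partial_deriv i f x) \<partial>\<nu>)
          = (\<integral>x. hs_inner d (\<tau> x) (hessian f x) \<partial>\<nu>))"

definition centered :: "nat \<Rightarrow> (nat \<Rightarrow> real) measure \<Rightarrow> bool" where
  "centered d \<nu> \<longleftrightarrow> (\<forall>j<d. has_bochner_integral \<nu> (\<lambda>x. x j) 0)"

definition lipschitz1 :: "nat \<Rightarrow> ((nat \<Rightarrow> real) \<Rightarrow> real) \<Rightarrow> bool" where
  "lipschitz1 d u \<longleftrightarrow> (\<forall>x\<in>Rd d. \<forall>y\<in>Rd d. \<bar>u x - u y\<bar> \<le> enorm d (\<lambda>i. x i - y i))"

text \<open>Powers of extended nonnegative numbers, for exponents \<open>a > 0\<close>.\<close>

definition ennpowr :: "ennreal \<Rightarrow> real \<Rightarrow> ennreal" where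
  "ennpowr x a = (if x = \<infinity> then \<infinity> else ennreal (enn2real x powr a))"

text \<open>The discrepancy \<open>S\<^sub>p(\<nu> | \<gamma>)\<close>. The Gaussian \<open>\<gamma>\<close> enters only through its Stein kernel, the
  identity matrix.\<close>

definition stein_discrepancy ::
    "nat \<Rightarrow> real \<Rightarrow> (nat \<Rightarrow> real) measure \<Rightarrow> ((nat \<Rightarrow> real) \<Rightarrow> nat \<Rightarrow> nat \<Rightarrow> real) \<Rightarrow> ennreal" where
  "stein_discrepancy d p \<nu> \<tau> =
     ennpowr (\<integral>\<^sup>+x. ennreal (hs_norm d (\<lambda>i j. \<tau> x i j - id_mat i j) powr p) \<partial>\<nu>) (1 / p)"

end

theory Submission
  imports Defs
begin

text \<open>
  Let \<open>Z\<close> be a standard Gaussian vector. The function \<open>u\<close> is joined to its Gaussian mean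
  \<open>m = E u(Z)\<close> by \<open>f\<^sub>\<theta>(x) = E u(cos \<theta> x + sin \<theta> Z)\<close> for \<open>0 \<le> \<theta> \<le> \<pi>/2\<close>. This is the
  Ornstein-Uhlenbeck semigroup \<open>P\<^sub>t u\<close> with \<open>cos \<theta> = exp (- t)\<close>; in the angle \<open>\<theta>\<close> all quantities
  stay regular at both ends. Write \<open>P\<close> for the averaging operator at angle \<open>\<theta>\<close>, so that
  \<open>\<nabla>f\<^sub>\<theta> = cos \<theta> P\<nabla>u\<close>. The quantity to follow is \<open>\<Phi>(\<theta>) = \<integral>F(f\<^sub>\<theta>) d\<nu>\<close>, where \<open>F\<close> is a smooth
  version of \<open>\<bar>r - m\<bar>\<^sup>p\<close>.

  Gaussian integration by parts gives
  \<open>\<partial>\<^sub>\<theta>f\<^sub>\<theta> = - sin \<theta> \<langle>x, P\<nabla>u\<rangle> + sin \<theta> cos \<theta> P\<Delta>u\<close>. The drift term is removed by the Stein identity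
  for the test function \<open>F \<circ> f\<^sub>\<theta>\<close>, and what remains is
  \<open>\<Phi>'(\<theta>) = sin \<theta> cos \<theta> (\<integral>F'(f\<^sub>\<theta>) \<langle>Id - \<tau>, P Hess u\<rangle> d\<nu> - \<integral>F''(f\<^sub>\<theta>) \<langle>\<tau> P\<nabla>u, P\<nabla>u\<rangle> d\<nu>)\<close>.
  Two dimension-free facts bound the right-hand side when \<open>\<bar>\<nabla>u\<bar> \<le> 1\<close>: \<open>\<bar>P\<nabla>u\<bar> \<le> 1\<close>, and
  \<open>\<bar>sin \<theta> \<langle>A, P Hess u\<rangle>\<bar> \<le> \<parallel>A\<parallel>\<^sub>H\<^sub>S\<close>, because one more integration by parts turns the left-hand
  side into \<open>E \<langle>A\<^sup>T Z, \<nabla>u\<rangle>\<close>, while \<open>E \<bar>A\<^sup>T Z\<bar>\<^sup>2 = \<parallel>A\<parallel>\<^sub>H\<^sub>S\<^sup>2\<close>. Since \<open>\<bar>F'\<bar> \<le> p F\<^bsup>1-1/p\<^esup>\<close> and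
  \<open>\<bar>F''\<bar> \<le> p (p-1) F\<^bsup>1-2/p\<^esup>\<close>, Hoelder's inequality yields, for \<open>g = \<Phi>\<^bsup>2/p\<^esup>\<close>, \<open>S\<close> the discrepancy
  and \<open>T = (\<integral>\<parallel>\<tau>\<parallel>\<^bsup>p/2\<^esup> d\<nu>)\<^bsup>1/p\<^esup>\<close>,
  \<open>\<bar>g'\<bar> \<le> 2 S cos \<theta> \<surd>g + 2 (p-1) T\<^sup>2 sin \<theta> cos \<theta>\<close>.
  Integrating from a maximum point of \<open>g\<close> to \<open>\<pi>/2\<close>, where \<open>g\<close> is negligible, gives
  \<open>max g \<le> 2 S \<surd>(max g) + (p-1) T\<^sup>2\<close>, hence \<open>\<parallel>u - m\<parallel>\<^sub>p \<le> 2 S + \<surd>p T\<close>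
  (\<open>mehler_flow_derivative_bound\<close>, \<open>smooth_moment_bound\<close>). As \<open>\<integral>u d\<nu> = 0\<close>, the constant
  \<open>m\<close> is controlled by the same bound.

  Two approximations make this rigorous. The Stein identity is available for compactly supported
  smooth functions only; cutting off extends it to smooth functions that are bounded together with
  their first and second derivatives (\<open>stein_identity_bounded\<close>). And the computation needs
  \<open>u\<close> to be bounded with bounded derivatives of all orders; a Lipschitz function is clamped and
  convolved with a smooth bump (\<open>lipschitz1_mollify\<close>), and Fatou's lemma returns to \<open>u\<close>.
\<close>

section \<open>Differential calculus on Rd\<close>

text \<open>
  Points of \<open>Rd d\<close> are \<open>undefined\<close> outside \<open>{..<d}\<close>; the restriction keeps the vector
  \<open>a x + b z\<close> in this set. Averages over \<open>z\<close> of functions of such vectors express both the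
  Gaussian interpolation and convolution.
\<close>

definition lincomb :: "nat \<Rightarrow> real \<Rightarrow> (nat \<Rightarrow> real) \<Rightarrow> real \<Rightarrow> (nat \<Rightarrow> real) \<Rightarrow> nat \<Rightarrow> real" where
  "lincomb d a x b z = (\<lambda>i\<in>{..<d}. a * x i + b * z i)"

lemma fun_upd_in_Rd [simp]: "x \<in> Rd d \<Longrightarrow> i < d \<Longrightarrow> x(i := t) \<in> Rd d"
  by (auto simp: Rd_def PiE_def extensional_def)

lemma lincomb_in_Rd [simp]: "lincomb d a x b z \<in> Rd d"
  by (auto simp: Rd_def lincomb_def)

lemma lincomb_apply [simp]: "i < d \<Longrightarrow> lincomb d a x b z i = a * x i + b * z i"
  by (simp add: lincomb_def)

lemma Rd_eqI: "x \<in> Rd d \<Longrightarrow> y \<in> Rd d \<Longrightarrow> (\<And>i. i < d \<Longrightarrow> x i = y i) \<Longrightarrow> x = y"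
  unfolding Rd_def by (rule PiE_ext) auto

lemma lincomb_fun_upd: "i < d \<Longrightarrow> lincomb d a (x(i := t)) b z
    = (lincomb d a x b z)(i := a * t + b * z i)"
  by (auto simp: lincomb_def restrict_def)

lemma partial_deriv_eqI:
  assumes "((\<lambda>t. f (x(i := t))) has_real_derivative D) (at (x i))"
  shows "partial_deriv i f x = D"
  using assms by (simp add: partial_deriv_def DERIV_imp_deriv)

lemma partial_deriv_cong:
  assumes "\<And>y. y \<in> Rd d \<Longrightarrow> f y = g y" "i < d" "x \<in> Rd d"
  shows "partial_deriv i f x = partial_deriv i g x"
  using assms by (simp add: partial_deriv_def)

text \<open>
  Changing a coordinate below \<open>d\<close> does not leave \<open>Rd d\<close>, so partial derivatives at points of
  \<open>Rd d\<close>, and with them \<open>C_diff\<close>, depend only on the values on \<open>Rd d\<close>.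
\<close>

lemma C_diff_cong:
  assumes "\<And>y. y \<in> Rd d \<Longrightarrow> f y = g y" "C_diff d k f"
  shows "C_diff d k g"
  using assms
proof (induction k arbitrary: f g)
  case 0
  then show ?case using continuous_on_cong[of "Rd d" "Rd d" f g] by simp
next
  case (Suc k)
  have 1: "continuous_on (Rd d) g"
    using Suc.prems continuous_on_cong[of "Rd d" "Rd d" f g] by simp
  have 2: "C_diff d k (partial_deriv i g)" if "i < d" for i
    using Suc.IH[of "partial_deriv i f" "partial_deriv i g"] Suc.prems that
      partial_deriv_cong[of d f g i] by simp
  have 3: "(\<lambda>t. f (x(i := t))) = (\<lambda>t. g (x(i := t)))" if "i < d" "x \<in> Rd d" for i x
    by (intro ext Suc.prems(1) fun_upd_in_Rd that)
  have "(\<lambda>t. g (x(i := t))) differentiable at (x i)" if "i < d" "x \<in> Rd d" for i x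
    using Suc.prems(2) that unfolding 3[OF that, symmetric] by simp
  then show ?case using 1 2 by simp
qed

lemma C_diff_SucD: "C_diff d (Suc k) f \<Longrightarrow> C_diff d k f"
  by (induction k arbitrary: f) auto

lemma C_diff_continuous: "C_diff d k f \<Longrightarrow> continuous_on (Rd d) f"
  by (cases k) auto

text \<open>
  It suffices to exhibit the partial derivatives on \<open>Rd d\<close>; elsewhere \<open>partial_deriv\<close>
  may be anything.
\<close>

lemma C_diff_SucI:
  assumes "continuous_on (Rd d) f"
    and "\<And>i x. i < d \<Longrightarrow> x \<in> Rd d \<Longrightarrow>
          ((\<lambda>t. f (x(i := t))) has_real_derivative g i x) (at (x i))"
    and "\<And>i. i < d \<Longrightarrow> C_diff d k (g i)"
  shows "C_diff d (Suc k) f"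
proof -
  have "C_diff d k (partial_deriv i f)" if "i < d" for i
  proof (rule C_diff_cong[OF _ assms(3)[OF that]])
    fix x assume "x \<in> Rd d"
    then show "g i x = partial_deriv i f x"
      by (rule partial_deriv_eqI[OF assms(2)[OF that], symmetric])
  qed
  moreover have "(\<lambda>t. f (x(i := t))) differentiable at (x i)" if "i < d" "x \<in> Rd d" for i x
    using assms(2)[OF that] real_differentiable_def by blast
  ultimately show ?thesis
    using assms(1) by simp
qed

lemma C_diff_has_partial_deriv:
  assumes "C_diff d (Suc k) f" "i < d" "x \<in> Rd d"
  shows "((\<lambda>t. f (x(i := t))) has_real_derivative partial_deriv i f x) (at (x i))"
  using assms by (simp add: partial_deriv_def DERIV_deriv_iff_real_differentiable)

lemma C_diff_has_partial_deriv_upd: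
  assumes "C_diff d (Suc k) f" "i < d" "x \<in> Rd d"
  shows "((\<lambda>t. f (x(i := t))) has_real_derivative partial_deriv i f (x(i := s))) (at s)"
  using C_diff_has_partial_deriv[OF assms(1,2) fun_upd_in_Rd[OF assms(3,2), of s]] by simp

lemma C_diff_partial_deriv: "C_diff d (Suc k) f \<Longrightarrow> i < d \<Longrightarrow> C_diff d k (partial_deriv i f)"
  by simp

lemma C_diff_const: "C_diff d k (\<lambda>x. c)"
proof (induction k arbitrary: c)
  case (Suc k)
  show ?case by (rule C_diff_SucI[where g="\<lambda>_ _. 0"]) (auto simp: Suc)
qed auto

lemma continuous_on_coord: "continuous_on S (\<lambda>x::nat \<Rightarrow> real. x i)"
  by (rule continuous_on_subset[OF continuous_on_product_coordinates]) simp

lemma C_diff_coord: "C_diff d k (\<lambda>x. x i)"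
proof (cases k)
  case (Suc k)
  have "C_diff d (Suc k) (\<lambda>x. x i)"
  proof (rule C_diff_SucI[where f="\<lambda>x. x i" and g="\<lambda>j _. if i = j then 1 else 0"])
    show "continuous_on (Rd d) (\<lambda>x. x i)"
      by (rule continuous_on_coord)
    show "((\<lambda>t. (x(j := t)) i) has_real_derivative (if i = j then 1 else 0)) (at (x j))" for j x
      by (cases "i = j") auto
    show "C_diff d k (\<lambda>_. if i = j then 1 else 0)" for j
      by (rule C_diff_const)
  qed
  then show ?thesis by (simp add: Suc)
qed (simp add: continuous_on_coord)

lemma C_diff_add: "C_diff d k f \<Longrightarrow> C_diff d k g \<Longrightarrow> C_diff d k (\<lambda>x. f x + g x)"
proof (induction k arbitrary: f g)
  case 0 then show ?case by (auto intro: continuous_intros)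
next
  case (Suc k)
  show ?case
  proof (rule C_diff_SucI[where g="\<lambda>i x. partial_deriv i f x + partial_deriv i g x"])
    show "continuous_on (Rd d) (\<lambda>x. f x + g x)"
      using Suc.prems by (auto intro: continuous_intros)
  next
    fix i x assume "i < d" "x \<in> Rd d"
    then show "((\<lambda>t. f (x(i := t)) + g (x(i := t))) has_real_derivative
       partial_deriv i f x + partial_deriv i g x) (at (x i))"
      using Suc.prems by (intro DERIV_add C_diff_has_partial_deriv)
  next
    fix i assume "i < d"
    then show "C_diff d k (\<lambda>x. partial_deriv i f x + partial_deriv i g x)"
      using C_diff_partial_deriv[OF Suc.prems(1)] C_diff_partial_deriv[OF Suc.prems(2)]
      by (intro Suc.IH)
  qed
qed

lemma C_diff_mult: "C_diff d k f \<Longrightarrow> C_diff d k g \<Longrightarrow> C_diff d k (\<lambda>x. f x * g x)"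
proof (induction k arbitrary: f g)
  case 0 then show ?case by (auto intro: continuous_intros)
next
  case (Suc k)
  show ?case
  proof (rule C_diff_SucI[where g="\<lambda>i x. partial_deriv i f x * g x + partial_deriv i g x * f x"])
    show "continuous_on (Rd d) (\<lambda>x. f x * g x)"
      using Suc.prems by (auto intro: continuous_intros)
  next
    fix i x assume ix: "i < d" "x \<in> Rd d"
    show "((\<lambda>t. f (x(i := t)) * g (x(i := t))) has_real_derivative
       partial_deriv i f x * g x + partial_deriv i g x * f x) (at (x i))"
      using DERIV_mult[OF C_diff_has_partial_deriv[OF Suc.prems(1) ix]
          C_diff_has_partial_deriv[OF Suc.prems(2) ix]]
      unfolding fun_upd_triv .
  next
    fix i assume "i < d"
    then show "C_diff d k (\<lambda>x. partial_deriv i f x * g x + partial_deriv i g x * f x)"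
      using Suc.prems[THEN C_diff_SucD] Suc.prems[THEN C_diff_partial_deriv]
      by (intro C_diff_add Suc.IH)
  qed
qed

lemma C_diff_sum:
  "(\<And>i. i \<in> I \<Longrightarrow> C_diff d k (f i)) \<Longrightarrow> C_diff d k (\<lambda>x. \<Sum>i\<in>I. f i x)"
  by (induction I rule: infinite_finite_induct) (auto intro: C_diff_add C_diff_const)

text \<open>
  The outer function comes as the sequence \<open>D\<close> of its successive derivatives: differentiating
  \<open>D n \<circ> f\<close> produces \<open>D (Suc n) \<circ> f\<close>, so the induction has to treat all members of the
  sequence at once. The set \<open>U\<close> admits functions such as real powers, which are smooth only where
  their argument is positive.
\<close>

lemma C_diff_compose:
  assumes D: "\<And>n s. s \<in> U \<Longrightarrow> (D n has_real_derivative D (Suc n) s) (at s)"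
    and f: "C_diff d k f" "\<And>x. x \<in> Rd d \<Longrightarrow> f x \<in> U"
  shows "C_diff d k (\<lambda>x. D n (f x))"
  using f
proof (induction k arbitrary: n)
  case 0
  have "continuous_on U (D n)"
    using D by (meson DERIV_isCont continuous_at_imp_continuous_on)
  then show ?case
    using 0 continuous_on_compose2[of U "D n" "Rd d" f] by auto
next
  case (Suc k)
  have cont: "continuous_on U (D n)" for n
    using D by (meson DERIV_isCont continuous_at_imp_continuous_on)
  show ?case
  proof (rule C_diff_SucI[where g="\<lambda>i x. D (Suc n) (f x) * partial_deriv i f x"])
    show "continuous_on (Rd d) (\<lambda>x. D n (f x))"
      using Suc.prems continuous_on_compose2[OF cont, of "Rd d" f] C_diff_continuous by blast
  next
    fix i x assume ix: "i < d" "x \<in> Rd d"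
    show "((\<lambda>t. D n (f (x(i := t)))) has_real_derivative
        D (Suc n) (f x) * partial_deriv i f x) (at (x i))"
      by (rule DERIV_chain2[OF _ C_diff_has_partial_deriv[OF Suc.prems(1) ix]])
        (use D[OF Suc.prems(2)] ix in simp)
  next
    fix i assume "i < d"
    then show "C_diff d k (\<lambda>x. D (Suc n) (f x) * partial_deriv i f x)"
      using C_diff_SucD[OF Suc.prems(1)] C_diff_partial_deriv[OF Suc.prems(1)] Suc.prems(2)
      by (intro C_diff_mult Suc.IH)
  qed
qed

lemma continuous_lincomb: "continuous_on S (\<lambda>x. lincomb d a x b z)"
proof (rule continuous_on_coordinatewise_then_product)
  fix i show "continuous_on S (\<lambda>x. lincomb d a x b z i)"
    by (cases "i < d") (auto simp: lincomb_def intro!: continuous_intros continuous_on_coord)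
qed

lemma has_partial_deriv_lincomb:
  assumes "C_diff d (Suc k) f" "i < d"
  shows "((\<lambda>t. f (lincomb d a (x(i := t)) b z)) has_real_derivative
           a * partial_deriv i f (lincomb d a (x(i := s)) b z)) (at s)"
proof -
  have "((\<lambda>t. f ((lincomb d a x b z)(i := a * t + b * z i))) has_real_derivative
           partial_deriv i f ((lincomb d a x b z)(i := a * s + b * z i)) * a) (at s)"
    by (rule DERIV_chain2[where f="\<lambda>t. f ((lincomb d a x b z)(i := t))"])
       (auto intro!: C_diff_has_partial_deriv_upd[OF assms(1)] assms derivative_eq_intros)
  then show ?thesis using assms(2) by (simp add: lincomb_fun_upd mult.commute)
qed

lemma C_diff_lincomb: "C_diff d k f \<Longrightarrow> C_diff d k (\<lambda>x. f (lincomb d a x b z))"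
proof (induction k arbitrary: f)
  case 0
  then show ?case
    by (auto intro!: continuous_on_compose2[of "Rd d" f] continuous_lincomb)
next
  case (Suc k)
  show ?case
  proof (rule C_diff_SucI[where g="\<lambda>i x. a * partial_deriv i f (lincomb d a x b z)"])
    show "continuous_on (Rd d) (\<lambda>x. f (lincomb d a x b z))"
      using Suc.prems by (auto intro!: continuous_on_compose2[of "Rd d" f] continuous_lincomb)
  next
    fix i x assume "i < d" "x \<in> Rd d"
    then show "((\<lambda>t. f (lincomb d a (x(i := t)) b z)) has_real_derivative
        a * partial_deriv i f (lincomb d a x b z)) (at (x i))"
      using has_partial_deriv_lincomb[OF Suc.prems, of i a x b z "x i"] by simp
  next
    fix i assume "i < d"
    then show "C_diff d k (\<lambda>x. a * partial_deriv i f (lincomb d a x b z))"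
      using C_diff_partial_deriv[OF Suc.prems]
      by (intro C_diff_mult C_diff_const Suc.IH)
  qed
qed

section \<open>Chain rule, differentiation under the integral sign, measurability\<close>

lemma tendsto_function:
  assumes "\<And>i. ((\<lambda>n. X n i) \<longlongrightarrow> l i) F"
  shows "(X \<longlongrightarrow> (l :: 'a \<Rightarrow> 'b::topological_space)) F"
proof -
  have "limitin (product_topology (\<lambda>_. euclidean) UNIV) X l F"
    using assms by (simp add: limitin_componentwise)
  then show ?thesis by (simp add: euclidean_product_topology)
qed

text \<open>
  Only partial derivatives are available, so the increment of \<open>f\<close> along the curve is telescoped
  into \<open>d\<close> increments in one coordinate each. The mean value theorem expresses each of them by a
  partial derivative at an intermediate point, and continuity of the partial derivatives settles
  the limit.
\<close>

lemma C_diff_chain_rule: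
  assumes f: "C_diff d (Suc 0) f"
    and c: "\<And>s. c s \<in> Rd d"
    and c': "\<And>i. i < d \<Longrightarrow> ((\<lambda>s. c s i) has_real_derivative c' i) (at t)"
  shows "((\<lambda>s. f (c s)) has_real_derivative (\<Sum>i<d. partial_deriv i f (c t) * c' i)) (at t)"
proof -
  \<comment> \<open>The vector \<open>y m s\<close> has already moved to \<open>c s\<close> in the coordinates below \<open>m\<close>.\<close>
  define y where "y m s = (\<lambda>i. if i < m then c s i else c t i)" for m :: nat and s
  have y_Rd: "y m s \<in> Rd d" if "m \<le> d" for m s
    using c[of s] c[of t] that by (auto simp: y_def Rd_def PiE_def extensional_def)
  have y0: "y 0 s = c t" for s by (simp add: y_def)
  have yd: "y d s = c s" for s
    by (rule Rd_eqI[OF y_Rd c]) (simp_all add: y_def)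
  have ySuc: "y (Suc m) s = (y m s)(m := c s m)" for m s
    by (auto simp: y_def fun_eq_iff)
  have ym: "(y m s)(m := c t m) = y m s" for m s
    by (auto simp: y_def fun_eq_iff)
  have yt: "y m t = c t" for m by (simp add: y_def)
  have step: "((\<lambda>s. f (y (Suc m) s) - f (y m s)) has_real_derivative
                 partial_deriv m f (c t) * c' m) (at t)" if m: "m < d" for m
  proof -
    have "\<exists>\<xi>. \<bar>\<xi> - c t m\<bar> \<le> \<bar>c s m - c t m\<bar> \<and>
        f (y (Suc m) s) - f (y m s) = partial_deriv m f ((y m s)(m := \<xi>)) * (c s m - c t m)" for s
    proof -
      let ?g = "\<lambda>r. f ((y m s)(m := r))"
      let ?g' = "\<lambda>r. partial_deriv m f ((y m s)(m := r))"
      have D: "(?g has_real_derivative ?g' r) (at r)" for r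
        using C_diff_has_partial_deriv_upd[OF f m y_Rd, of m s r] m by simp
      have E: "f (y (Suc m) s) - f (y m s) = ?g (c s m) - ?g (c t m)"
        by (simp add: ySuc ym)
      consider "c t m < c s m" | "c s m < c t m" | "c s m = c t m" by linarith
      then show ?thesis
      proof cases
        case 1
        from MVT2[OF this, of ?g ?g'] D obtain z where
          "c t m < z" "z < c s m" "?g (c s m) - ?g (c t m) = (c s m - c t m) * ?g' z" by blast
        then show ?thesis unfolding E by (intro exI[of _ z]) (auto simp: mult.commute)
      next
        case 2
        from MVT2[OF this, of ?g ?g'] D obtain z where
          "c s m < z" "z < c t m" "?g (c t m) - ?g (c s m) = (c t m - c s m) * ?g' z" by blast
        then show ?thesis unfolding E by (intro exI[of _ z]) (auto simp: algebra_simps)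
      next
        case 3
        then show ?thesis unfolding E by auto
      qed
    qed
    then obtain \<xi> where \<xi>: "\<And>s. \<bar>\<xi> s - c t m\<bar> \<le> \<bar>c s m - c t m\<bar>"
      "\<And>s. f (y (Suc m) s) - f (y m s)
             = partial_deriv m f ((y m s)(m := \<xi> s)) * (c s m - c t m)"
      by metis
    obtain q where q: "\<And>s. c s m - c t m = q s * (s - t)" "isCont q t" "q t = c' m"
      using c'[OF m] unfolding CARAT_DERIV by blast
    have cont: "((\<lambda>s. c s i) \<longlongrightarrow> c t i) (at t)" for i
    proof (cases "i < d")
      case True then show ?thesis using DERIV_isCont[OF c'] by (simp add: isCont_def)
    next
      case False
      with c have eq: "(\<lambda>s. c s i) = (\<lambda>s. c t i)"
        by (auto simp: Rd_def PiE_def extensional_def)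
      show ?thesis unfolding eq by (rule tendsto_const)
    qed
    have "\<xi> \<midarrow>t\<rightarrow> c t m"
    proof (rule LIM_zero_cancel, rule Lim_null_comparison)
      show "\<forall>\<^sub>F s in at t. norm (\<xi> s - c t m) \<le> \<bar>c s m - c t m\<bar>"
        using \<xi>(1) by simp
      show "((\<lambda>s. \<bar>c s m - c t m\<bar>) \<longlongrightarrow> 0) (at t)"
        using tendsto_rabs[OF tendsto_diff[OF cont[of m] tendsto_const[of "c t m"]]] by simp
    qed
    then have "(\<lambda>s. (y m s)(m := \<xi> s)) \<midarrow>t\<rightarrow> c t"
    proof (intro tendsto_function)
      fix i show "((\<lambda>s. ((y m s)(m := \<xi> s)) i) \<longlongrightarrow> c t i) (at t)"
        using \<open>\<xi> \<midarrow>t\<rightarrow> c t m\<close> cont[of i]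
        by (cases "i = m"; cases "i < m") (auto simp: y_def)
    qed
    moreover have "continuous_on (Rd d) (partial_deriv m f)"
      using f m by simp
    ultimately have lim: "(\<lambda>s. partial_deriv m f ((y m s)(m := \<xi> s))) \<midarrow>t\<rightarrow> partial_deriv m f (c t)"
      using c y_Rd m by (intro continuous_on_tendsto_compose[of "Rd d" "partial_deriv m f"]) auto
    have \<xi>t: "\<xi> t = c t m" using \<xi>(1)[of t] by simp
    \<comment> \<open>In Caratheodory's form the derivative is the value at \<open>t\<close> of a slope function continuous there;
      the slope of the increment is the product of a partial derivative and the slope \<open>q\<close> of \<open>c\<close>.\<close>
    show ?thesis unfolding CARAT_DERIV
    proof (intro exI[of _ "\<lambda>s. partial_deriv m f ((y m s)(m := \<xi> s)) * q s"] conjI allI)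
      fix s show "f (y (Suc m) s) - f (y m s) - (f (y (Suc m) t) - f (y m t))
          = partial_deriv m f ((y m s)(m := \<xi> s)) * q s * (s - t)"
        using \<xi>(2)[of s] q(1)[of s] by (simp add: yt)
      have tt: "(y m t)(m := \<xi> t) = c t" by (auto simp: yt \<xi>t)
      show "isCont (\<lambda>s. partial_deriv m f ((y m s)(m := \<xi> s)) * q s) t"
        using lim q(2) unfolding isCont_def tt by (intro tendsto_mult)
      show "partial_deriv m f ((y m t)(m := \<xi> t)) * q t = partial_deriv m f (c t) * c' m"
        by (simp add: tt q(3))
    qed
  qed
  have "((\<lambda>s. f (c t) + (\<Sum>m<d. f (y (Suc m) s) - f (y m s))) has_real_derivative
         0 + (\<Sum>m<d. partial_deriv m f (c t) * c' m)) (at t)"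
    by (intro DERIV_add DERIV_const DERIV_sum step) auto
  moreover have "f (c t) + (\<Sum>m<d. f (y (Suc m) s) - f (y m s)) = f (c s)" for s
    using sum_lessThan_telescope[of "\<lambda>m. f (y m s)" d] by (simp add: y0 yd)
  ultimately show ?thesis by simp
qed

text \<open>By the mean value theorem the bound on the derivative dominates the difference quotients.\<close>

lemma has_real_derivative_integral:
  fixes f :: "real \<Rightarrow> 'w \<Rightarrow> real"
  assumes "0 < \<delta>"
    and int: "\<And>t. \<bar>t - t0\<bar> < \<delta> \<Longrightarrow> integrable M (f t)"
    and deriv: "\<And>t w. \<bar>t - t0\<bar> < \<delta> \<Longrightarrow> w \<in> space M \<Longrightarrow>
                  ((\<lambda>t. f t w) has_real_derivative f' t w) (at t)"
    and dom: "integrable M g" "\<And>t w. \<bar>t - t0\<bar> < \<delta> \<Longrightarrow> w \<in> space M \<Longrightarrow> \<bar>f' t w\<bar> \<le> g w"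
  shows "integrable M (f' t0)"
    and "((\<lambda>t. \<integral>w. f t w \<partial>M) has_real_derivative (\<integral>w. f' t0 w \<partial>M)) (at t0)"
proof -
  have quot_bound: "\<bar>(f (t0 + h) w - f t0 w) / h\<bar> \<le> g w"
    if "h \<noteq> 0" "\<bar>h\<bar> < \<delta>" "w \<in> space M" for h w
  proof -
    have *: "\<exists>z. \<bar>z - t0\<bar> < \<delta> \<and> f (t0 + h) w - f t0 w = h * f' z w"
    proof (cases "0 < h")
      case True
      have "\<exists>z. t0 < z \<and> z < t0 + h \<and> f (t0 + h) w - f t0 w = (t0 + h - t0) * f' z w"
        by (rule MVT2) (use True that in \<open>auto intro!: deriv\<close>)
      then show ?thesis using that by force
    next
      case False
      have "\<exists>z. t0 + h < z \<and> z < t0 \<and> f t0 w - f (t0 + h) w = (t0 - (t0 + h)) * f' z w"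
        by (rule MVT2) (use False that in \<open>auto intro!: deriv\<close>)
      then obtain z where z: "t0 + h < z" "z < t0" "f t0 w - f (t0 + h) w
          = (t0 - (t0 + h)) * f' z w"
        by blast
      then show ?thesis using that by (intro exI[of _ z]) auto
    qed
    then obtain z where "\<bar>z - t0\<bar> < \<delta>" "f (t0 + h) w - f t0 w = h * f' z w" by blast
    then show ?thesis using dom(2)[of z w] that by simp
  qed
  have lim_seq: "(\<lambda>n. \<integral>w. (f (t0 + X n) w - f t0 w) / X n \<partial>M)
      \<longlonglongrightarrow> (\<integral>w. f' t0 w \<partial>M) \<and> integrable M (f' t0)"
    if X: "\<And>n. X n \<noteq> 0" "\<And>n. \<bar>X n\<bar> < \<delta>" "X \<longlonglongrightarrow> 0" for X
  proof -
    have lim: "(\<lambda>n. (f (t0 + X n) w - f t0 w) / X n) \<longlonglongrightarrow> f' t0 w" if "w \<in> space M" for w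
    proof -
      have "((\<lambda>h. (f (t0 + h) w - f t0 w) / h) \<longlongrightarrow> f' t0 w) (at 0)"
        using deriv[of t0 w] that \<open>0 < \<delta>\<close> by (simp add: DERIV_def)
      then show ?thesis
        using X unfolding tendsto_at_iff_sequentially comp_def by auto
    qed
    have meas_f: "f (t0 + X n) \<in> borel_measurable M" "f t0 \<in> borel_measurable M" for n
      using int[of "t0 + X n"] int[of t0] X(2)[of n] \<open>0 < \<delta>\<close> by auto
    have meas: "(\<lambda>w. (f (t0 + X n) w - f t0 w) / X n) \<in> borel_measurable M" for n
      using meas_f by measurable
    have meas': "f' t0 \<in> borel_measurable M"
      using borel_measurable_LIMSEQ_real[OF lim meas] .
    have bd: "AE w in M. norm ((f (t0 + X n) w - f t0 w) / X n) \<le> g w" for n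
      using quot_bound[of "X n"] X by (intro AE_I2) auto
    show ?thesis
      using integral_dominated_convergence[OF meas' meas dom(1) AE_I2[OF lim] bd]
        integrable_dominated_convergence[OF meas' meas dom(1) AE_I2[OF lim] bd] by blast
  qed
  have "(\<lambda>n. \<delta> / 2 / (real (Suc n))) \<longlonglongrightarrow> 0"
    using LIMSEQ_Suc[OF lim_const_over_n[of "\<delta>/2"]] by simp
  moreover have "\<delta> / 2 / real (Suc n) < \<delta>" for n
    using \<open>0 < \<delta>\<close> by (simp add: field_simps) (smt (verit) mult_nonneg_nonneg of_nat_0_le_iff)
  ultimately show "integrable M (f' t0)"
    using lim_seq[of "\<lambda>n. \<delta> / 2 / (real (Suc n))"] \<open>0 < \<delta>\<close> by auto
  show "((\<lambda>t. \<integral>w. f t w \<partial>M) has_real_derivative (\<integral>w. f' t0 w \<partial>M)) (at t0)"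
    unfolding DERIV_def tendsto_at_iff_sequentially comp_def
  proof (intro allI impI)
    fix X :: "nat \<Rightarrow> real" assume X: "\<forall>i. X i \<in> UNIV - {0}" "X \<longlonglongrightarrow> 0"
    \<comment> \<open>Finitely many terms of the sequence may lie outside the interval where the bounds hold.\<close>
    define Y where "Y n = (if \<bar>X n\<bar> < \<delta> then X n else \<delta> / 2)" for n
    have ev: "\<forall>\<^sub>F n in sequentially. \<bar>X n\<bar> < \<delta>"
      using X(2) \<open>0 < \<delta>\<close> tendstoD[of X 0 sequentially \<delta>] by simp
    have evY: "\<forall>\<^sub>F n in sequentially. Y n = X n"
      using ev by eventually_elim (simp add: Y_def)
    have "Y \<longlonglongrightarrow> 0"
      using X(2) tendsto_cong[OF evY] by simp
    then have "(\<lambda>n. \<integral>w. (f (t0 + Y n) w - f t0 w) / Y n \<partial>M) \<longlonglongrightarrow> (\<integral>w. f' t0 w \<partial>M)"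
    proof (intro lim_seq[THEN conjunct1])
      show "Y n \<noteq> 0" "\<bar>Y n\<bar> < \<delta>" for n
        using X(1) \<open>0 < \<delta>\<close> by (auto simp: Y_def)
    qed
    moreover have "\<forall>\<^sub>F n in sequentially. (\<integral>w. (f (t0 + Y n) w - f t0 w) / Y n \<partial>M)
        = ((\<integral>w. f (t0 + X n) w \<partial>M) - (\<integral>w. f t0 w \<partial>M)) / X n"
      using ev evY
    proof eventually_elim
      case (elim n)
      then show ?case using int[of "t0 + X n"] int[of t0] \<open>0 < \<delta>\<close> by simp
    qed
    ultimately show "(\<lambda>n. ((\<integral>w. f (t0 + X n) w \<partial>M) - (\<integral>w. f t0 w \<partial>M)) / X n)
        \<longlonglongrightarrow> (\<integral>w. f' t0 w \<partial>M)"
      using tendsto_cong by fastforce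
  qed
qed

lemma integrable_bounded_mult:
  fixes f g :: "'w \<Rightarrow> real"
  assumes f: "integrable M f" and g: "g \<in> borel_measurable M" "\<And>x. x \<in> space M \<Longrightarrow> \<bar>g x\<bar> \<le> b"
  shows "integrable M (\<lambda>x. g x * f x)"
proof (rule Bochner_Integration.integrable_bound)
  show "integrable M (\<lambda>x. b * f x)" using f by simp
  show "(\<lambda>x. g x * f x) \<in> borel_measurable M" using f g(1) by (intro borel_measurable_times) auto
  show "AE x in M. norm (g x * f x) \<le> norm (b * f x)"
  proof (rule AE_I2)
    fix x assume "x \<in> space M"
    then have "\<bar>g x\<bar> \<le> \<bar>b\<bar>" using g(2)[of x] by simp
    then show "norm (g x * f x) \<le> norm (b * f x)" by (simp add: abs_mult mult_right_mono)
  qed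
qed

lemma id_measurable_Rd: "(\<lambda>x. x) \<in> borel_measurable (borel_Rd d)"
proof (rule measurable_coordinatewise_then_product)
  fix i show "(\<lambda>x. x i) \<in> borel_measurable (borel_Rd d)"
  proof (cases "i < d")
    case False
    have "(\<lambda>x. undefined) \<in> borel_measurable (borel_Rd d)" by simp
    moreover have "undefined = x i" if "x \<in> space (borel_Rd d)" for x
      using that False by (auto simp: borel_Rd_def space_PiM PiE_def extensional_def)
    ultimately show ?thesis by (subst (asm) measurable_cong)
  qed (simp add: borel_Rd_def)
qed

lemma space_borel_Rd: "space (borel_Rd d) = Rd d"
  by (simp add: borel_Rd_def Rd_def space_PiM)

text \<open>
  The Borel sets of \<^typ>\<open>nat \<Rightarrow> real\<close> are generated by all coordinates, those of \<open>Rd d\<close> by the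
  first \<open>d\<close>. The map \<open>x \<mapsto> lincomb d 1 x 0 x\<close>, a continuous retraction onto \<open>Rd d\<close>, mediates
  between the two.
\<close>

lemma continuous_on_Rd_measurable:
  assumes "continuous_on (Rd d) f" "sets M = sets (borel_Rd d)"
  shows "f \<in> borel_measurable M"
proof -
  have "(\<lambda>x. f (lincomb d 1 x 0 x)) \<in> borel_measurable borel"
  proof (intro borel_measurable_continuous_onI continuous_on_compose2[OF assms(1)])
    show "continuous_on UNIV (\<lambda>x. lincomb d 1 x 0 x)"
    proof (rule continuous_on_coordinatewise_then_product)
      fix i show "continuous_on UNIV (\<lambda>x. lincomb d 1 x 0 x i)"
        by (cases "i < d") (auto simp: lincomb_def continuous_on_coord)
    qed
  qed auto
  from measurable_compose[OF id_measurable_Rd this]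
  have "(\<lambda>x. f (lincomb d 1 x 0 x)) \<in> borel_measurable (borel_Rd d)" .
  moreover have "lincomb d 1 x 0 x = x" if "x \<in> Rd d" for x
    using that by (intro Rd_eqI[of _ d]) auto
  ultimately have "f \<in> borel_measurable (borel_Rd d)"
    by (subst (asm) measurable_cong[where g=f]) (auto simp: space_borel_Rd)
  then show ?thesis using assms(2) by (simp cong: measurable_cong_sets)
qed

section \<open>Averaging operators that preserve smoothness\<close>

declare C_diff.simps(2) [simp del]

lemma smooth_partial_deriv: "smooth d f \<Longrightarrow> i < d \<Longrightarrow> smooth d (partial_deriv i f)"
  unfolding smooth_def using C_diff_partial_deriv by blast

lemma smooth_continuous: "smooth d f \<Longrightarrow> continuous_on (Rd d) f"
  unfolding smooth_def using C_diff_continuous by blast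

text \<open>
  The functions all of whose iterated partial derivatives are smooth and bounded. A family closed
  under partial derivatives replaces the bookkeeping with multi-indices.
\<close>

definition C_b_infinity :: "nat \<Rightarrow> ((nat \<Rightarrow> real) \<Rightarrow> real) \<Rightarrow> bool" where
  "C_b_infinity d f \<longleftrightarrow> (\<exists>S. f \<in> S \<and>
     (\<forall>h\<in>S. smooth d h \<and> bounded (h ` Rd d) \<and> (\<forall>i<d. partial_deriv i h \<in> S)))"

lemma C_b_infinity_smooth: "C_b_infinity d f \<Longrightarrow> smooth d f"
  unfolding C_b_infinity_def by blast

lemma C_b_infinity_bounded: "C_b_infinity d f \<Longrightarrow> bounded (f ` Rd d)"
  unfolding C_b_infinity_def by blast

lemma C_b_infinity_partial_deriv: "C_b_infinity d f \<Longrightarrow> i < d \<Longrightarrow> C_b_infinity d (partial_deriv i f)"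
  unfolding C_b_infinity_def by blast

lemma C_b_infinity_bound:
  assumes "C_b_infinity d f"
  obtains B where "0 \<le> B" "\<And>x. x \<in> Rd d \<Longrightarrow> \<bar>f x\<bar> \<le> B"
proof -
  obtain B where B: "\<forall>x\<in>f ` Rd d. norm x \<le> B"
    using C_b_infinity_bounded[OF assms] unfolding bounded_iff by blast
  show ?thesis by (rule that[of "max B 0"]) (use B in auto)
qed

text \<open>
  Two operators are of this form: the Gaussian average \<open>x \<mapsto> E f(a x + b Z)\<close> (with weight \<open>1\<close>
  and \<open>M\<close> Gaussian) and the convolution of \<open>w\<close> with a kernel \<open>f\<close> (with \<open>a = -1\<close>, \<open>b = 1\<close>
  and \<open>M\<close> Lebesgue measure). In both, derivatives in \<open>x\<close> fall on \<open>f\<close>.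
\<close>

definition smear ::
    "nat \<Rightarrow> (nat \<Rightarrow> real) measure \<Rightarrow> ((nat \<Rightarrow> real) \<Rightarrow> real) \<Rightarrow> real \<Rightarrow> real \<Rightarrow>
      ((nat \<Rightarrow> real) \<Rightarrow> real) \<Rightarrow> (nat \<Rightarrow> real) \<Rightarrow> real" where
  "smear d M w a b f x = (\<integral>z. w z * f (lincomb d a x b z) \<partial>M)"

text \<open>
  A majorant of the integrand near each point, as dominated convergence requires. For a convolution
  with a compactly supported kernel the majorant has to move with the point.
\<close>

definition dominated ::
    "nat \<Rightarrow> (nat \<Rightarrow> real) measure \<Rightarrow> ((nat \<Rightarrow> real) \<Rightarrow> real) \<Rightarrow> real \<Rightarrow> real \<Rightarrow>
      ((nat \<Rightarrow> real) \<Rightarrow> real) \<Rightarrow> bool" where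
  "dominated d M w a b f \<longleftrightarrow> (\<forall>x0\<in>Rd d. \<exists>g. integrable M g \<and>
     (\<forall>x\<in>Rd d. (\<forall>i<d. \<bar>x i - x0 i\<bar> < 1) \<longrightarrow> (\<forall>z\<in>space M. \<bar>w z * f (lincomb d a x b z)\<bar> \<le> g z)))"

lemma lincomb_commute: "lincomb d a x b z = lincomb d b z a x"
  by (auto simp: lincomb_def)

lemma measurable_lincomb_compose:
  assumes "continuous_on (Rd d) f" "sets M = sets (borel_Rd d)"
  shows "(\<lambda>z. f (lincomb d a x b z)) \<in> borel_measurable M"
proof (rule continuous_on_Rd_measurable[OF _ assms(2)])
  show "continuous_on (Rd d) (\<lambda>z. f (lincomb d a x b z))"
    by (subst lincomb_commute) (rule continuous_on_compose2[OF assms(1) continuous_lincomb], auto)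
qed

context
  fixes d :: nat and M :: "(nat \<Rightarrow> real) measure" and w :: "(nat \<Rightarrow> real) \<Rightarrow> real" and a b :: real
  assumes setsM: "sets M = sets (borel_Rd d)" and w: "w \<in> borel_measurable M"
begin

lemma smear_integrable:
  assumes f: "continuous_on (Rd d) f" and dom: "dominated d M w a b f" and x: "x \<in> Rd d"
  shows "integrable M (\<lambda>z. w z * f (lincomb d a x b z))"
proof -
  obtain g where g1: "integrable M g" and g': "\<forall>y\<in>Rd d. (\<forall>i<d. \<bar>y i - x i\<bar> < 1) \<longrightarrow>
      (\<forall>z\<in>space M. \<bar>w z * f (lincomb d a y b z)\<bar> \<le> g z)"
    using bspec[OF dom[unfolded dominated_def] x] by blast
  have g2: "\<bar>w z * f (lincomb d a y b z)\<bar> \<le> g z"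
    if "y \<in> Rd d" "\<And>i. i < d \<Longrightarrow> \<bar>y i - x i\<bar> < 1" "z \<in> space M" for y z
    using g' that by simp
  have "AE z in M. norm (w z * f (lincomb d a x b z)) \<le> norm (g z)"
    by (intro AE_I2) (use g2[OF x] in fastforce)
  then show ?thesis
    using w measurable_lincomb_compose[OF f setsM, of a x b]
    by (intro Bochner_Integration.integrable_bound[OF g1]) auto
qed

lemma smear_continuous:
  assumes f: "continuous_on (Rd d) f" and dom: "dominated d M w a b f"
  shows "continuous_on (Rd d) (smear d M w a b f)"
  unfolding continuous_on_sequentially comp_def
proof (intro allI impI ballI)
  fix X x assume x: "x \<in> Rd d" and "(\<forall>n. X n \<in> Rd d) \<and> X \<longlonglongrightarrow> x"
  then have X: "\<And>n. X n \<in> Rd d" "X \<longlonglongrightarrow> x" by auto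
  obtain g where g1: "integrable M g" and g': "\<forall>y\<in>Rd d. (\<forall>i<d. \<bar>y i - x i\<bar> < 1) \<longrightarrow>
      (\<forall>z\<in>space M. \<bar>w z * f (lincomb d a y b z)\<bar> \<le> g z)"
    using bspec[OF dom[unfolded dominated_def] x] by blast
  have g2: "\<bar>w z * f (lincomb d a y b z)\<bar> \<le> g z"
    if "y \<in> Rd d" "\<And>i. i < d \<Longrightarrow> \<bar>y i - x i\<bar> < 1" "z \<in> space M" for y z
    using g' that by simp
  have ev: "\<forall>\<^sub>F n in sequentially. \<forall>i\<in>{..<d}. \<bar>X n i - x i\<bar> < 1"
  proof (intro eventually_ball_finite ballI)
    fix i
    have "(\<lambda>n. X n i) \<longlonglongrightarrow> x i"
      using continuous_on_tendsto_compose[OF continuous_on_coord[of UNIV i] X(2)] by simp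
    from tendstoD[OF this zero_less_one]
    show "\<forall>\<^sub>F n in sequentially. \<bar>X n i - x i\<bar> < 1" by (simp add: dist_real_def)
  qed simp
  then obtain N where N: "\<And>n i. n \<ge> N \<Longrightarrow> i < d \<Longrightarrow> \<bar>X n i - x i\<bar> < 1"
    unfolding eventually_sequentially by blast
  have "(\<lambda>n. smear d M w a b f (X (n + N))) \<longlonglongrightarrow> smear d M w a b f x"
    unfolding smear_def
  proof (rule integral_dominated_convergence[OF _ _ g1])
    show "(\<lambda>z. w z * f (lincomb d a x b z)) \<in> borel_measurable M"
      "\<And>n. (\<lambda>z. w z * f (lincomb d a (X (n + N)) b z)) \<in> borel_measurable M"
      using w measurable_lincomb_compose[OF f setsM] by auto
    show "AE z in M. (\<lambda>n. w z * f (lincomb d a (X (n + N)) b z)) \<longlonglongrightarrow> w z * f (lincomb d a x b z)"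
    proof (intro AE_I2 tendsto_mult tendsto_const)
      fix z
      have "(\<lambda>n. lincomb d a (X (n + N)) b z) \<longlonglongrightarrow> lincomb d a x b z"
        using LIMSEQ_ignore_initial_segment[OF X(2), of N]
          continuous_on_tendsto_compose[OF continuous_lincomb[of UNIV d a b z]] by simp
      then show "(\<lambda>n. f (lincomb d a (X (n + N)) b z)) \<longlonglongrightarrow> f (lincomb d a x b z)"
        by (rule continuous_on_tendsto_compose[OF f]) auto
    qed
    show "AE z in M. norm (w z * f (lincomb d a (X (n + N)) b z)) \<le> g z" for n
      using g2[OF X(1)] N by (intro AE_I2) auto
  qed
  then show "(\<lambda>n. smear d M w a b f (X n)) \<longlonglongrightarrow> smear d M w a b f x"
    by (rule LIMSEQ_offset)
qed

lemma smear_has_partial_deriv: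
  assumes f: "C_diff d (Suc 0) f" and i: "i < d" and x: "x \<in> Rd d"
    and dom: "dominated d M w a b f" "dominated d M w a b (partial_deriv i f)"
  shows "((\<lambda>t. smear d M w a b f (x(i := t))) has_real_derivative
           a * smear d M w a b (partial_deriv i f) x) (at (x i))"
proof -
  obtain g where g1: "integrable M g" and g': "\<forall>y\<in>Rd d. (\<forall>i<d. \<bar>y i - x i\<bar> < 1) \<longrightarrow>
      (\<forall>z\<in>space M. \<bar>w z * partial_deriv i f (lincomb d a y b z)\<bar> \<le> g z)"
    using bspec[OF dom(2)[unfolded dominated_def] x] by blast
  have g2: "\<bar>w z * partial_deriv i f (lincomb d a y b z)\<bar> \<le> g z"
    if "y \<in> Rd d" "\<And>i. i < d \<Longrightarrow> \<bar>y i - x i\<bar> < 1" "z \<in> space M" for y z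
    using g' that by simp
  have "((\<lambda>t. \<integral>z. w z * f (lincomb d a (x(i := t)) b z) \<partial>M) has_real_derivative
      (\<integral>z. w z * (a * partial_deriv i f (lincomb d a (x(i := x i)) b z)) \<partial>M)) (at (x i))"
  proof (rule has_real_derivative_integral(2))
    show "0 < (1::real)" by simp
    show "integrable M (\<lambda>z. w z * f (lincomb d a (x(i := t)) b z))" for t
      using smear_integrable[OF C_diff_continuous[OF f] dom(1)] x i by simp
    show "((\<lambda>t. w z * f (lincomb d a (x(i := t)) b z)) has_real_derivative
        w z * (a * partial_deriv i f (lincomb d a (x(i := t)) b z))) (at t)" for t z
      using DERIV_cmult[OF has_partial_deriv_lincomb[OF f i]] .
    show "integrable M (\<lambda>z. \<bar>a\<bar> * g z)" using g1 by simp
    show "\<bar>w z * (a * partial_deriv i f (lincomb d a (x(i := t)) b z))\<bar> \<le> \<bar>a\<bar> * g z"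
      if "\<bar>t - x i\<bar> < 1" "z \<in> space M" for t z
      using mult_left_mono[OF g2[of "x(i := t)" z], of "\<bar>a\<bar>"] that x i
      by (simp add: abs_mult mult_ac)
  qed
  moreover have "(\<integral>z. w z * (a * partial_deriv i f (lincomb d a (x(i := x i)) b z)) \<partial>M)
      = a * smear d M w a b (partial_deriv i f) x"
    unfolding smear_def fun_upd_triv
    by (subst integral_mult_right_zero[symmetric]) (simp add: mult_ac)
  ultimately show ?thesis by (simp add: smear_def)
qed

text \<open>
  The partial derivatives of \<open>smear f\<close> are multiples of \<open>smear h\<close> with \<open>h\<close> a partial derivative of
  \<open>f\<close>. So the multiples of the images of a closed family form again a closed family.
\<close>

lemma smear_C_b_infinity:
  assumes f: "f \<in> S"
    and S: "\<And>h. h \<in> S \<Longrightarrow> smooth d h" "\<And>h. h \<in> S \<Longrightarrow> dominated d M w a b h"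
      "\<And>h i. h \<in> S \<Longrightarrow> i < d \<Longrightarrow> partial_deriv i h \<in> S"
      "\<And>h. h \<in> S \<Longrightarrow> bounded (smear d M w a b h ` Rd d)"
  shows "C_b_infinity d (smear d M w a b f)"
    and "\<And>i x. i < d \<Longrightarrow> x \<in> Rd d \<Longrightarrow>
           partial_deriv i (smear d M w a b f) x = a * smear d M w a b (partial_deriv i f) x"
proof -
  let ?G = "smear d M w a b"
  have deriv: "((\<lambda>t. ?G h (x(i := t))) has_real_derivative a * ?G (partial_deriv i h) x) (at (x i))"
    if "h \<in> S" "i < d" "x \<in> Rd d" for h i x
    using smear_has_partial_deriv[OF _ that(2,3) S(2)[OF that(1)] S(2)[OF S(3)[OF that(1,2)]]]
      S(1)[OF that(1)] unfolding smooth_def by blast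
  have C: "C_diff d k (\<lambda>x. c * ?G h x)" if "h \<in> S" for k c h
    using that
  proof (induction k arbitrary: c h)
    case 0
    have "continuous_on (Rd d) (?G h)"
      using smear_continuous[of h] S 0 by (auto intro: smooth_continuous)
    then show ?case by (auto intro!: continuous_intros)
  next
    case (Suc k)
    show ?case
    proof (rule C_diff_SucI[where g="\<lambda>i x. (c * a) * ?G (partial_deriv i h) x"])
      show "continuous_on (Rd d) (\<lambda>x. c * ?G h x)"
        using Suc.IH[OF Suc.prems] by (rule C_diff_continuous)
      show "((\<lambda>t. c * ?G h (x(i := t))) has_real_derivative c * a * ?G (partial_deriv i h) x)
          (at (x i))" if "i < d" "x \<in> Rd d" for i x
        using DERIV_cmult[OF deriv[OF Suc.prems that], of c] by (simp add: mult_ac)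
      show "C_diff d k (\<lambda>x. c * a * ?G (partial_deriv i h) x)" if "i < d" for i
        using Suc.IH[OF S(3)[OF Suc.prems that]] .
    qed
  qed
  show pd: "partial_deriv i (?G f) x = a * ?G (partial_deriv i f) x"
    if "i < d" "x \<in> Rd d" for i x
    using deriv[OF f that] by (rule partial_deriv_eqI)
  let ?T = "{g. \<exists>h\<in>S. \<exists>c. \<forall>x\<in>Rd d. g x = c * ?G h x}"
  show "C_b_infinity d (?G f)"
    unfolding C_b_infinity_def
  proof (intro exI[of _ ?T] conjI ballI allI impI)
    show "?G f \<in> ?T" using f by (auto intro!: bexI[of _ f] exI[of _ 1])
    fix g assume "g \<in> ?T"
    then obtain h c where h: "h \<in> S" "\<And>x. x \<in> Rd d \<Longrightarrow> g x = c * ?G h x" by blast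
    show "smooth d g"
      unfolding smooth_def using C_diff_cong[OF _ C[OF h(1)]] h(2) by metis
    have "g ` Rd d = (\<lambda>y. c * y) ` ?G h ` Rd d"
      using h(2) by (auto simp: image_image)
    then show "bounded (g ` Rd d)"
      using bounded_scaling[OF S(4)[OF h(1)], of c] by simp
    fix i assume i: "i < d"
    have "partial_deriv i g x = (c * a) * ?G (partial_deriv i h) x" if "x \<in> Rd d" for x
    proof -
      have "((\<lambda>t. c * ?G h (x(i := t))) has_real_derivative (c * a) * ?G (partial_deriv i h) x)
          (at (x i))"
        using DERIV_cmult[OF deriv[OF h(1) i that], of c] by (simp add: mult_ac)
      from partial_deriv_eqI[OF this] show ?thesis
        using partial_deriv_cong[of d g "\<lambda>x. c * ?G h x" i x, OF h(2) i that] by simp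
    qed
    then show "partial_deriv i g \<in> ?T"
      using S(3)[OF h(1) i] by blast
  qed
qed

end

section \<open>Gaussian integration by parts\<close>

text \<open>
  The standard normal density \<open>n\<close> satisfies \<open>n'(y) = - y n(y)\<close>, so the difference of the two
  integrands is the derivative of \<open>f n\<close>, which vanishes at both infinities.
\<close>

lemma integral_std_normal_by_parts:
  fixes f f' :: "real \<Rightarrow> real"
  assumes f: "\<And>y. (f has_real_derivative f' y) (at y)" and f': "\<And>y. isCont f' y"
    and bd: "\<And>y. \<bar>f y\<bar> \<le> B" "\<And>y. \<bar>f' y\<bar> \<le> B"
  shows "(\<integral>y. y * f y \<partial>std_normal_distribution) = (\<integral>y. f' y \<partial>std_normal_distribution)"
proof -
  let ?n = std_normal_density
  have cf: "isCont f y" for y using f DERIV_isCont by blast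
  have [measurable]: "f \<in> borel_measurable borel" "f' \<in> borel_measurable borel"
    using cf f' by (auto intro!: borel_measurable_continuous_onI continuous_at_imp_continuous_on)
  have n: "(?n has_real_derivative - y * ?n y) (at y)" for y
  proof -
    have "((\<lambda>y. c * exp (- y\<^sup>2 / 2)) has_real_derivative - y * (c * exp (- y\<^sup>2 / 2))) (at y)"
      for c :: real
      by (auto intro!: derivative_eq_intros)
    then show ?thesis unfolding std_normal_density_def .
  qed
  have cn: "isCont ?n y" for y using n DERIV_isCont by blast
  have B0: "0 \<le> B" using bd(1)[of 0] by simp
  have i1: "integrable lborel (\<lambda>y. ?n y * (y * f y))"
  proof (rule Bochner_Integration.integrable_bound)
    show "integrable lborel (\<lambda>y. B * (?n y * \<bar>y\<bar> ^ 1))"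
      by (intro integrable_mult_right integrable_std_normal_moment_abs)
    show "AE y in lborel. norm (?n y * (y * f y)) \<le> norm (B * (?n y * \<bar>y\<bar> ^ 1))"
    proof (rule AE_I2)
      fix y
      have "\<bar>f y\<bar> * (?n y * \<bar>y\<bar>) \<le> B * (?n y * \<bar>y\<bar>)"
        by (intro mult_right_mono bd) simp
      then show "norm (?n y * (y * f y)) \<le> norm (B * (?n y * \<bar>y\<bar> ^ 1))"
        using B0 by (simp add: abs_mult mult_ac)
    qed
  qed simp
  have i2: "integrable lborel (\<lambda>y. ?n y * f' y)"
  proof (rule Bochner_Integration.integrable_bound)
    show "integrable lborel (\<lambda>y. B * (?n y * y ^ 0))"
      by (intro integrable_mult_right integrable_std_normal_moment)
    show "AE y in lborel. norm (?n y * f' y) \<le> norm (B * (?n y * y ^ 0))"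
    proof (rule AE_I2)
      fix y
      have "\<bar>f' y\<bar> * ?n y \<le> B * ?n y"
        by (intro mult_right_mono bd) simp
      then show "norm (?n y * f' y) \<le> norm (B * (?n y * y ^ 0))"
        using B0 by (simp add: abs_mult mult_ac)
    qed
  qed simp
  have sq: "filterlim (\<lambda>y::real. - y\<^sup>2 / 2) at_bot F" if "filterlim (\<lambda>y::real. y\<^sup>2) at_top F" for F
  proof -
    have "filterlim (\<lambda>y::real. (1/2) * y\<^sup>2) at_top F"
      by (intro filterlim_tendsto_pos_mult_at_top[OF tendsto_const _ that]) simp
    then show ?thesis by (simp add: filterlim_uminus_at_bot)
  qed
  have lim: "((\<lambda>y. f y * ?n y) \<longlongrightarrow> 0) F" if "filterlim (\<lambda>y::real. y\<^sup>2) at_top F" for F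
  proof (rule Lim_null_comparison)
    show "\<forall>\<^sub>F y in F. norm (f y * ?n y) \<le> B * ?n y"
      using bd(1) by (intro always_eventually)
        (auto simp: abs_mult normal_density_nonneg intro!: mult_right_mono)
    have "((\<lambda>y. exp (- y\<^sup>2 / 2)) \<longlongrightarrow> (0::real)) F"
      using filterlim_compose[OF exp_at_bot sq[OF that]] .
    from tendsto_mult_left[OF this, of "B * (1 / sqrt (2 * pi))"]
    show "((\<lambda>y. B * ?n y) \<longlongrightarrow> 0) F"
      by (simp add: std_normal_density_def mult_ac)
  qed
  have "(LBINT y=-\<infinity>..\<infinity>. ?n y * f' y - ?n y * (y * f y)) = 0 - 0"
  proof (rule interval_integral_FTC_integrable)
    show "((\<lambda>y. f y * ?n y) has_vector_derivative ?n y * f' y - ?n y * (y * f y)) (at y)" for y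
      using DERIV_mult[OF f n, of y] unfolding has_real_derivative_iff_has_vector_derivative
      by (simp add: algebra_simps)
    show "isCont (\<lambda>y. ?n y * f' y - ?n y * (y * f y)) y" for y
      by (intro continuous_intros cn cf f')
    show "set_integrable lborel (einterval (- \<infinity>) \<infinity>) (\<lambda>y. ?n y * f' y - ?n y * (y * f y))"
      using i1 i2 by (simp add: set_integrable_def)
    show "(((\<lambda>y. f y * ?n y) \<circ> real_of_ereal) \<longlongrightarrow> 0) (at_right (- \<infinity>))"
      "(((\<lambda>y. f y * ?n y) \<circ> real_of_ereal) \<longlongrightarrow> 0) (at_left \<infinity>)"
      unfolding ereal_tendsto_simps1
      by (intro lim filterlim_pow_at_bot_even filterlim_pow_at_top filterlim_ident; simp)+
  qed simp
  then have "(\<integral>y. ?n y * f' y - ?n y * (y * f y) \<partial>lborel) = 0"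
    by (simp add: interval_lebesgue_integral_def set_lebesgue_integral_def)
  then have "(\<integral>y. ?n y * f' y \<partial>lborel) = (\<integral>y. ?n y * (y * f y) \<partial>lborel)"
    using i1 i2 by simp
  then show ?thesis
    by (simp add: integral_density normal_density_nonneg)
qed

definition gauss :: "nat \<Rightarrow> (nat \<Rightarrow> real) measure" where
  "gauss d = Pi\<^sub>M {..<d} (\<lambda>_. std_normal_distribution)"

lemma sets_gauss: "sets (gauss d) = sets (borel_Rd d)"
  unfolding gauss_def borel_Rd_def by (intro sets_PiM_cong) auto

lemma space_gauss: "space (gauss d) = Rd d"
  using sets_eq_imp_space_eq[OF sets_gauss] by (simp add: space_borel_Rd)

lemma prob_space_std_normal: "prob_space std_normal_distribution"
  by (rule prob_space_normal_density) simp

lemma prob_space_gauss: "prob_space (gauss d)"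
  unfolding gauss_def by (intro prob_space_PiM prob_space_std_normal)

lemma product_sigma_finite_std_normal: "product_sigma_finite (\<lambda>_::nat. std_normal_distribution)"
  unfolding product_sigma_finite_def
  by (intro allI prob_space_imp_sigma_finite prob_space_std_normal)

text \<open>
  The product \<open>z i * z j\<close> is written as a product of functions of one coordinate each, so that the
  product formula for integrals covers the cases \<open>i = j\<close> and \<open>i \<noteq> j\<close> alike.
\<close>

lemma gauss_second_moments:
  assumes "i < d" "j < d"
  shows "integrable (gauss d) (\<lambda>z. z i * z j)"
    and "(\<integral>z. z i * z j \<partial>gauss d) = (if i = j then 1 else 0)"
proof -
  interpret product_sigma_finite "\<lambda>_::nat. std_normal_distribution"
    by (rule product_sigma_finite_std_normal)
  define f where "f l y = (if l = i then y else 1) * (if l = j then y else (1::real))" for l :: nat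
    and y
  have m: "integrable std_normal_distribution (\<lambda>y. y ^ k)" for k
    by (rule integrable_std_normal_distribution_moment)
  have f: "integrable std_normal_distribution (f l)" for l
  proof -
    have "f l = (\<lambda>y. y ^ (of_bool (l = i) + of_bool (l = j)))"
      by (auto simp: f_def fun_eq_iff power_add)
    then show ?thesis using m by simp
  qed
  have eq: "z i * z j = (\<Prod>l<d. f l (z l))" for z :: "nat \<Rightarrow> real"
    using assms by (simp add: f_def prod.distrib prod.delta)
  show "integrable (gauss d) (\<lambda>z. z i * z j)"
    unfolding eq gauss_def by (rule product_integrable_prod) (auto simp: f)
  have "(\<integral>z. z i * z j \<partial>gauss d) = (\<Prod>l<d. \<integral>y. f l y \<partial>std_normal_distribution)"
    unfolding eq gauss_def by (rule product_integral_prod) (auto simp: f)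
  also have "\<dots> = (if i = j then 1 else 0)"
  proof (cases "i = j")
    case True
    have 1: "(\<integral>y. y * y \<partial>std_normal_distribution) = 1"
      using std_normal_distribution_even_moments(1)[of 1] by (simp add: power2_eq_square)
    have "(\<integral>y. f l y \<partial>std_normal_distribution) = 1" for l
      using 1 prob_space.prob_space[OF prob_space_std_normal] True
        by (cases "l = j") (simp_all add: f_def)
    then show ?thesis using True by simp
  next
    case False
    have "(\<integral>y. f i y \<partial>std_normal_distribution) = 0"
      using integral_std_normal_distribution_moment_odd[of 1] False by (simp add: f_def)
    then have "(\<Prod>l<d. \<integral>y. f l y \<partial>std_normal_distribution) = 0"
      using assms by (intro prod_zero) auto
    then show ?thesis using False by simp
  qed
  finally show "(\<integral>z. z i * z j \<partial>gauss d) = (if i = j then 1 else 0)" .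
qed

lemma gauss_first_moment_integrable:
  assumes "i < d"
  shows "integrable (gauss d) (\<lambda>z. z i)"
proof -
  interpret prob_space "gauss d" by (rule prob_space_gauss)
  have "(\<lambda>z. z i) \<in> borel_measurable (gauss d)"
    using continuous_on_Rd_measurable[OF continuous_on_coord sets_gauss] .
  then show ?thesis
  proof (rule Bochner_Integration.integrable_bound[rotated])
    show "integrable (gauss d) (\<lambda>z. 1 + z i * z i)"
      using gauss_second_moments(1)[OF assms assms] by simp
    have "\<bar>y\<bar> \<le> 1 + y * y" for y :: real
      using sum_squares_bound[of 1 "\<bar>y\<bar>"] by (simp add: power2_eq_square)
    then show "AE z in gauss d. norm (z i) \<le> norm (1 + z i * z i)"
      by (intro AE_I2) (smt (verit) real_norm_def)
  qed
qed

lemma bounded_integrable: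
  assumes "finite_measure M" "f \<in> borel_measurable M" "\<And>z. z \<in> space M \<Longrightarrow> \<bar>f z\<bar> \<le> (B::real)"
  shows "integrable M f"
  using assms by (intro finite_measure.integrable_const_bound[of M f B]) (auto intro!: AE_I2)

text \<open>
  Fubini's theorem singles out the \<open>i\<close>-th coordinate, in which the one-dimensional formula applies.
\<close>

lemma gauss_by_parts:
  assumes h: "C_diff d (Suc 0) h" and i: "i < d"
    and bd: "\<And>z. z \<in> Rd d \<Longrightarrow> \<bar>h z\<bar> \<le> B" "\<And>z. z \<in> Rd d \<Longrightarrow> \<bar>partial_deriv i h z\<bar> \<le> B"
  shows "integrable (gauss d) (\<lambda>z. z i * h z)"
    and "(\<integral>z. z i * h z \<partial>gauss d) = (\<integral>z. partial_deriv i h z \<partial>gauss d)"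
proof -
  interpret product_sigma_finite "\<lambda>_::nat. std_normal_distribution"
    by (rule product_sigma_finite_std_normal)
  interpret g: prob_space "gauss d" by (rule prob_space_gauss)
  have ch: "continuous_on (Rd d) h" "continuous_on (Rd d) (partial_deriv i h)"
    using C_diff_continuous[OF h] C_diff_continuous[OF C_diff_partial_deriv[OF h i]] by auto
  note mh = ch[THEN continuous_on_Rd_measurable, OF sets_gauss]
  show i1: "integrable (gauss d) (\<lambda>z. z i * h z)"
    using integrable_bounded_mult[OF gauss_first_moment_integrable[OF i] mh(1), of B] bd(1)
    by (simp add: space_gauss mult.commute)
  have i2: "integrable (gauss d) (partial_deriv i h)"
    using bd(2) by (intro bounded_integrable[OF g.finite_measure_axioms mh(2), of B])
      (simp add: space_gauss)
  \<comment> \<open>Points of the product over \<open>I\<close> are \<open>undefined\<close> at \<open>i\<close>; they enter \<open>Rd d\<close> once \<open>i\<close> is assigned.\<close>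
  define I where "I = {..<d} - {i}"
  have I: "finite I" "i \<notin> I" "{..<d} = insert i I" using i by (auto simp: I_def)
  have inner: "(\<integral>y. (x(i := y)) i * h (x(i := y)) \<partial>std_normal_distribution) =
      (\<integral>y. partial_deriv i h (x(i := y)) \<partial>std_normal_distribution)"
    if x: "x \<in> space (Pi\<^sub>M I (\<lambda>_. std_normal_distribution))" for x
  proof -
    have xR: "x(i := y) \<in> Rd d" for y
      using x i by (auto simp: space_PiM Rd_def I_def PiE_def extensional_def)
    have "(\<integral>y. y * h (x(i := y)) \<partial>std_normal_distribution) =
      (\<integral>y. partial_deriv i h (x(i := y)) \<partial>std_normal_distribution)"
    proof (rule integral_std_normal_by_parts)
      show "((\<lambda>y. h (x(i := y))) has_real_derivative partial_deriv i h (x(i := y))) (at y)" for y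
        using C_diff_has_partial_deriv_upd[OF h i xR[of y], of y] by simp
      have "continuous_on UNIV (\<lambda>y. x(i := y))"
      proof (rule continuous_on_coordinatewise_then_product)
        show "continuous_on UNIV (\<lambda>y. (x(i := y)) j)" for j
          by (cases "j = i") (auto intro: continuous_intros)
      qed
      then have "continuous_on UNIV (\<lambda>y. partial_deriv i h (x(i := y)))"
        using continuous_on_compose2[OF ch(2)] xR by blast
      then show "isCont (\<lambda>y. partial_deriv i h (x(i := y))) y" for y
        by (simp add: continuous_on_eq_continuous_at)
      show "\<bar>h (x(i := y))\<bar> \<le> B" "\<bar>partial_deriv i h (x(i := y))\<bar> \<le> B" for y
        using bd xR by auto
    qed
    then show ?thesis by simp
  qed
  show "(\<integral>z. z i * h z \<partial>gauss d) = (\<integral>z. partial_deriv i h z \<partial>gauss d)"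
    using product_integral_insert[OF I(1,2) i1[unfolded gauss_def I(3)]]
      product_integral_insert[OF I(1,2) i2[unfolded gauss_def I(3)]]
      Bochner_Integration.integral_cong[OF refl inner]
    unfolding gauss_def I(3) by simp
qed

section \<open>Mehler interpolation between a function and its Gaussian mean\<close>

lemma integral_double_sum:
  fixes f :: "nat \<Rightarrow> nat \<Rightarrow> 'b \<Rightarrow> real" and c :: "nat \<Rightarrow> nat \<Rightarrow> real"
  assumes "\<And>i j. i < d \<Longrightarrow> j < d \<Longrightarrow> integrable M (f i j)"
  shows "integrable M (\<lambda>z. \<Sum>i<d. \<Sum>j<d. c i j * f i j z)"
    and "(\<integral>z. (\<Sum>i<d. \<Sum>j<d. c i j * f i j z) \<partial>M) = (\<Sum>i<d. \<Sum>j<d. c i j * (\<integral>z. f i j z \<partial>M))"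
proof -
  have 1: "integrable M (\<lambda>z. \<Sum>j<d. c i j * f i j z)" if "i < d" for i
    using assms that by (intro Bochner_Integration.integrable_sum integrable_mult_right) simp
  show "integrable M (\<lambda>z. \<Sum>i<d. \<Sum>j<d. c i j * f i j z)"
    by (rule Bochner_Integration.integrable_sum) (simp add: 1)
  have "(\<integral>z. (\<Sum>i<d. \<Sum>j<d. c i j * f i j z) \<partial>M) = (\<Sum>i<d. \<integral>z. (\<Sum>j<d. c i j * f i j z) \<partial>M)"
    using 1 by (intro Bochner_Integration.integral_sum) simp
  also have "\<dots> = (\<Sum>i<d. \<Sum>j<d. \<integral>z. c i j * f i j z \<partial>M)"
    using assms by (intro sum.cong refl Bochner_Integration.integral_sum integrable_mult_right) simp
  finally show "(\<integral>z. (\<Sum>i<d. \<Sum>j<d. c i j * f i j z) \<partial>M)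
      = (\<Sum>i<d. \<Sum>j<d. c i j * (\<integral>z. f i j z \<partial>M))" by simp
qed

lemma finite_uniform_bound:
  fixes Q :: "nat \<Rightarrow> real \<Rightarrow> bool"
  assumes "\<And>i. i < d \<Longrightarrow> \<exists>B. Q i B" "\<And>i B B'. Q i B \<Longrightarrow> B \<le> B' \<Longrightarrow> Q i B'"
  shows "\<exists>B. \<forall>i<d. Q i B"
proof -
  obtain B where B: "\<And>i. i < d \<Longrightarrow> Q i (B i)" using assms(1) by metis
  have "B i \<le> (\<Sum>i<d. \<bar>B i\<bar>)" if "i < d" for i
    using member_le_sum[of i "{..<d}" "\<lambda>i. \<bar>B i\<bar>"] that by simp
  then have "Q i (\<Sum>i<d. \<bar>B i\<bar>)" if "i < d" for i
    using assms(2)[OF B] that by blast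
  then show ?thesis by blast
qed

text \<open>
  Mehler's formula for the Ornstein-Uhlenbeck semigroup at time \<open>- ln (cos \<theta>)\<close>.
\<close>

definition mehler :: "nat \<Rightarrow> real \<Rightarrow> ((nat \<Rightarrow> real) \<Rightarrow> real) \<Rightarrow> (nat \<Rightarrow> real) \<Rightarrow> real" where
  "mehler d \<theta> = smear d (gauss d) (\<lambda>_. 1) (cos \<theta>) (sin \<theta>)"

lemma mehler_eq: "mehler d \<theta> f x = (\<integral>z. f (lincomb d (cos \<theta>) x (sin \<theta>) z) \<partial>gauss d)"
  by (simp add: mehler_def smear_def)

lemma mehler_integrable:
  fixes B :: real
  assumes "continuous_on (Rd d) f" "\<And>x. x \<in> Rd d \<Longrightarrow> \<bar>f x\<bar> \<le> B"
  shows "integrable (gauss d) (\<lambda>z. f (lincomb d a x b z))"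
  using assms measurable_lincomb_compose[OF assms(1) sets_gauss]
  by (intro bounded_integrable[where B=B])
    (auto simp: prob_space_gauss prob_space.finite_measure)

lemma C_b_infinity_mehler_integrable:
  assumes "C_b_infinity d f"
  shows "integrable (gauss d) (\<lambda>z. f (lincomb d a x b z))"
proof -
  obtain B where "\<And>x. x \<in> Rd d \<Longrightarrow> \<bar>f x\<bar> \<le> B" using C_b_infinity_bound[OF assms] by blast
  then show ?thesis
    by (intro mehler_integrable smooth_continuous C_b_infinity_smooth assms)
qed

lemma mehler_bound:
  assumes "continuous_on (Rd d) f" "\<And>x. x \<in> Rd d \<Longrightarrow> \<bar>f x\<bar> \<le> B"
  shows "\<bar>mehler d \<theta> f x\<bar> \<le> B"
proof -
  interpret prob_space "gauss d" by (rule prob_space_gauss)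
  have "\<bar>mehler d \<theta> f x\<bar> \<le> (\<integral>z. \<bar>f (lincomb d (cos \<theta>) x (sin \<theta>) z)\<bar> \<partial>gauss d)"
    unfolding mehler_eq by (rule integral_abs_bound)
  also have "\<dots> \<le> (\<integral>z. B \<partial>gauss d)"
    using assms by (intro integral_mono integrable_abs mehler_integrable) auto
  finally show ?thesis by (simp add: prob_space)
qed

lemma
  assumes f: "C_b_infinity d f"
  shows C_b_infinity_mehler: "C_b_infinity d (mehler d \<theta> f)"
    and partial_deriv_mehler: "\<And>i x. i < d \<Longrightarrow> x \<in> Rd d \<Longrightarrow>
          partial_deriv i (mehler d \<theta> f) x = cos \<theta> * mehler d \<theta> (partial_deriv i f) x"
proof -
  interpret prob_space "gauss d" by (rule prob_space_gauss)
  have 1: "dominated d (gauss d) (\<lambda>_. 1) (cos \<theta>) (sin \<theta>) h" if h: "C_b_infinity d h" for h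
  proof -
    obtain B where B: "\<And>x. x \<in> Rd d \<Longrightarrow> \<bar>h x\<bar> \<le> B" using C_b_infinity_bound[OF h] by blast
    show ?thesis unfolding dominated_def
      by (intro ballI exI[of _ "\<lambda>_. B"]) (auto intro: B)
  qed
  have 2: "bounded (smear d (gauss d) (\<lambda>_. 1) (cos \<theta>) (sin \<theta>) h ` Rd d)"
    if h: "C_b_infinity d h" for h
  proof -
    obtain B where B: "\<And>x. x \<in> Rd d \<Longrightarrow> \<bar>h x\<bar> \<le> B" using C_b_infinity_bound[OF h] by blast
    have "\<bar>mehler d \<theta> h x\<bar> \<le> B" for x
      by (rule mehler_bound[OF smooth_continuous[OF C_b_infinity_smooth[OF h]] B])
    then show ?thesis unfolding bounded_iff mehler_def by auto
  qed
  have *: "f \<in> {h. C_b_infinity d h}" using f by simp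
  note C = smear_C_b_infinity[OF sets_gauss _ *, where w="\<lambda>_. 1" and a="cos \<theta>" and b="sin \<theta>"]
  show "C_b_infinity d (mehler d \<theta> f)"
    unfolding mehler_def
    by (rule C(1)) (auto simp: C_b_infinity_smooth C_b_infinity_partial_deriv 1 2)
  show "partial_deriv i (mehler d \<theta> f) x = cos \<theta> * mehler d \<theta> (partial_deriv i f) x"
    if "i < d" "x \<in> Rd d" for i x
    unfolding mehler_def
    by (rule C(2)) (auto simp: C_b_infinity_smooth C_b_infinity_partial_deriv 1 2 that)
qed

lemma hessian_mehler:
  assumes f: "C_b_infinity d f" and "i < d" "j < d" "x \<in> Rd d"
  shows "hessian (mehler d \<theta> f) x i j = (cos \<theta>)\<^sup>2 * mehler d \<theta> (\<lambda>y. hessian f y i j) x"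
proof -
  have "partial_deriv i (partial_deriv j (mehler d \<theta> f)) x
      = partial_deriv i (\<lambda>y. cos \<theta> * mehler d \<theta> (partial_deriv j f) y) x"
    using partial_deriv_mehler[OF f \<open>j < d\<close>] assms by (intro partial_deriv_cong[of d]) auto
  also have "\<dots> = cos \<theta> * partial_deriv i (mehler d \<theta> (partial_deriv j f)) x"
  proof (rule partial_deriv_eqI, rule DERIV_cmult, rule C_diff_has_partial_deriv)
    show "C_diff d (Suc 0) (mehler d \<theta> (partial_deriv j f))"
      using C_b_infinity_smooth[OF C_b_infinity_mehler[OF C_b_infinity_partial_deriv[OF f \<open>j < d\<close>]]]
      unfolding smooth_def by blast
  qed fact+
  also have "\<dots> = cos \<theta> * (cos \<theta> * mehler d \<theta> (partial_deriv i (partial_deriv j f)) x)"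
    using partial_deriv_mehler[OF C_b_infinity_partial_deriv[OF f \<open>j < d\<close>]] assms by simp
  finally show ?thesis by (simp add: hessian_def power2_eq_square)
qed

text \<open>
  The weight \<open>z i\<close> costs one derivative of \<open>f\<close>. From left to right this produces the Laplacian in
  \<open>\<partial>\<^sub>\<theta>f\<^sub>\<theta>\<close>; from right to left it bounds second derivatives by first ones, at the price of the
  factor \<open>sin \<theta>\<close>.
\<close>

lemma mehler_by_parts:
  assumes f: "C_b_infinity d f" and i: "i < d"
  shows "integrable (gauss d) (\<lambda>z. z i * f (lincomb d (cos \<theta>) x (sin \<theta>) z))"
    and "(\<integral>z. z i * f (lincomb d (cos \<theta>) x (sin \<theta>) z) \<partial>gauss d)
          = sin \<theta> * mehler d \<theta> (partial_deriv i f) x"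
proof -
  let ?h = "\<lambda>z. f (lincomb d (sin \<theta>) z (cos \<theta>) x)"
  have sf: "C_diff d (Suc 0) f" using C_b_infinity_smooth[OF f] by (simp add: smooth_def)
  have h: "C_diff d (Suc 0) ?h" by (rule C_diff_lincomb[OF sf])
  have pd: "partial_deriv i ?h z = sin \<theta> * partial_deriv i f (lincomb d (sin \<theta>) z (cos \<theta>) x)" for z
    using has_partial_deriv_lincomb[OF sf i, of "sin \<theta>" z "cos \<theta>" x "z i"]
    by (intro partial_deriv_eqI) simp
  obtain B where B: "0 \<le> B" "\<And>x. x \<in> Rd d \<Longrightarrow> \<bar>f x\<bar> \<le> B" using C_b_infinity_bound[OF f] by blast
  obtain B' where B': "0 \<le> B'" "\<And>x. x \<in> Rd d \<Longrightarrow> \<bar>partial_deriv i f x\<bar> \<le> B'"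
    using C_b_infinity_bound[OF C_b_infinity_partial_deriv[OF f i]] by blast
  have bd1: "\<bar>?h z\<bar> \<le> max B B'" for z using B(2)[of "lincomb d (sin \<theta>) z (cos \<theta>) x"] by simp
  have bd2: "\<bar>partial_deriv i ?h z\<bar> \<le> max B B'" for z
  proof -
    have "\<bar>partial_deriv i ?h z\<bar> \<le> 1 * B'"
      unfolding pd abs_mult using B' by (intro mult_mono) auto
    then show ?thesis by simp
  qed
  note G = gauss_by_parts[OF h i bd1 bd2]
  show "integrable (gauss d) (\<lambda>z. z i * f (lincomb d (cos \<theta>) x (sin \<theta>) z))"
    using G(1) by (simp add: lincomb_commute[of d "sin \<theta>"])
  show "(\<integral>z. z i * f (lincomb d (cos \<theta>) x (sin \<theta>) z) \<partial>gauss d)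
          = sin \<theta> * mehler d \<theta> (partial_deriv i f) x"
    using G(2) unfolding pd mehler_eq by (simp add: lincomb_commute[of d "sin \<theta>"])
qed

lemma DERIV_bound_at:
  assumes "(g has_real_derivative D) (at (0::real))" "\<And>s. \<bar>g s - g 0\<bar> \<le> L * \<bar>s\<bar>"
  shows "\<bar>D\<bar> \<le> L"
proof -
  have "((\<lambda>h. (g h - g 0) / h) \<longlongrightarrow> D) (at 0)"
    using assms(1) by (simp add: DERIV_def)
  from tendsto_rabs[OF this] show ?thesis
  proof (rule tendsto_upperbound)
    show "\<forall>\<^sub>F h in at 0. \<bar>(g h - g 0) / h\<bar> \<le> L"
      using assms(2) by (auto simp: eventually_at_filter field_simps intro!: always_eventually)
  qed simp
qed

text \<open>
  Along the direction \<open>v = \<nabla>u(x)\<close> the derivative of \<open>u\<close> is \<open>\<bar>v\<bar>\<^sup>2\<close>, and the Lipschitz condition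
  bounds it by \<open>\<bar>v\<bar>\<close>.
\<close>

lemma lipschitz1_gradient_bound:
  assumes u: "lipschitz1 d u" "C_diff d (Suc 0) u" and x: "x \<in> Rd d"
  shows "(\<Sum>i<d. (partial_deriv i u x)\<^sup>2) \<le> 1"
proof -
  define v where "v i = partial_deriv i u x" for i
  have x0: "lincomb d 1 x 0 v = x" by (rule Rd_eqI[of _ d]) (use x in auto)
  have "((\<lambda>s. u (lincomb d 1 x s v)) has_real_derivative
      (\<Sum>i<d. partial_deriv i u (lincomb d 1 x 0 v) * v i)) (at 0)"
    by (rule C_diff_chain_rule[OF u(2)]) (auto intro!: derivative_eq_intros)
  moreover have "\<bar>u (lincomb d 1 x s v) - u (lincomb d 1 x 0 v)\<bar> \<le> enorm d v * \<bar>s\<bar>" for s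
  proof -
    have "\<bar>u (lincomb d 1 x s v) - u (lincomb d 1 x 0 v)\<bar>
        \<le> enorm d (\<lambda>i. lincomb d 1 x s v i - lincomb d 1 x 0 v i)"
      using u(1) unfolding lipschitz1_def by simp
    also have "\<dots> = enorm d (\<lambda>i. s * v i)"
      unfolding enorm_def by (rule L2_set_cong) auto
    also have "\<dots> = enorm d v * \<bar>s\<bar>"
      unfolding enorm_def L2_set_def
      by (simp add: power_mult_distrib sum_distrib_left[symmetric] real_sqrt_mult)
    finally show ?thesis .
  qed
  ultimately have "\<bar>\<Sum>i<d. partial_deriv i u (lincomb d 1 x 0 v) * v i\<bar> \<le> enorm d v"
    by (rule DERIV_bound_at)
  then have "\<bar>\<Sum>i<d. v i * v i\<bar> \<le> enorm d v"
    unfolding x0 v_def .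
  then have *: "(\<Sum>i<d. (v i)\<^sup>2) \<le> sqrt (\<Sum>i<d. (v i)\<^sup>2)"
    by (simp add: enorm_def L2_set_def power2_eq_square sum_nonneg)
  have "s \<le> 1" if "s \<le> sqrt s" "0 \<le> s" for s :: real
  proof (rule ccontr)
    assume "\<not> s \<le> 1"
    then have "sqrt s * 1 < sqrt s * sqrt s" by (intro mult_strict_left_mono) auto
    then show False using that by simp
  qed
  from this[OF * sum_nonneg] show ?thesis by (simp add: v_def)
qed

text \<open>
  Jensen's inequality for the Euclidean norm, by duality: for the averaged vector \<open>v\<close>,
  \<open>\<bar>v\<bar>\<^sup>2\<close> is the average of \<open>\<langle>v, f\<rangle> \<le> (\<bar>v\<bar>\<^sup>2 + 1) / 2\<close>.
\<close>

lemma mehler_gradient_bound: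
  assumes f: "\<And>i. i < d \<Longrightarrow> continuous_on (Rd d) (f i)"
    and bd: "\<And>x. x \<in> Rd d \<Longrightarrow> (\<Sum>i<d. (f i x)\<^sup>2) \<le> 1"
  shows "(\<Sum>i<d. (mehler d \<theta> (f i) x)\<^sup>2) \<le> 1"
proof -
  interpret prob_space "gauss d" by (rule prob_space_gauss)
  define v where "v i = mehler d \<theta> (f i) x" for i
  define y where "y z = lincomb d (cos \<theta>) x (sin \<theta>) z" for z
  have fb: "\<bar>f i x\<bar> \<le> 1" if "i < d" "x \<in> Rd d" for i x
  proof -
    have "(f i x)\<^sup>2 \<le> (\<Sum>i<d. (f i x)\<^sup>2)" using that by (intro member_le_sum) auto
    then show ?thesis using bd[OF that(2)] abs_square_le_1 by (metis order_trans)
  qed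
  have int: "integrable (gauss d) (\<lambda>z. f i (y z))" if "i < d" for i
    unfolding y_def using f[OF that] fb[OF that] by (rule mehler_integrable)
  have "(\<Sum>i<d. (v i)\<^sup>2) = (\<integral>z. (\<Sum>i<d. v i * f i (y z)) \<partial>gauss d)"
    using int by (simp add: v_def mehler_eq y_def power2_eq_square)
  also have "\<dots> \<le> (\<integral>z. ((\<Sum>i<d. (v i)\<^sup>2) + 1) / 2 \<partial>gauss d)"
  proof (intro integral_mono)
    fix z
    have "(\<Sum>i<d. v i * f i (y z)) \<le> (\<Sum>i<d. ((v i)\<^sup>2 + (f i (y z))\<^sup>2) / 2)"
    proof (rule sum_mono)
      fix i
      show "v i * f i (y z) \<le> ((v i)\<^sup>2 + (f i (y z))\<^sup>2) / 2"
        using sum_squares_bound[of "v i" "f i (y z)"] by simp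
    qed
    also have "\<dots> \<le> ((\<Sum>i<d. (v i)\<^sup>2) + 1) / 2"
      using bd[of "y z"] by (simp add: sum_divide_distrib[symmetric] sum.distrib y_def)
    finally show "(\<Sum>i<d. v i * f i (y z)) \<le> ((\<Sum>i<d. (v i)\<^sup>2) + 1) / 2" .
  qed (use int in auto)
  finally show ?thesis by (simp add: prob_space v_def)
qed

text \<open>
  The source of the Hilbert-Schmidt norm in the theorem. Integration by parts turns the left-hand
  side into \<open>E \<langle>A\<^sup>T Z, \<nabla>u\<rangle>\<close> at the point \<open>cos \<theta> x + sin \<theta> Z\<close>. Here \<open>\<bar>\<nabla>u\<bar> \<le> 1\<close> and
  \<open>E \<bar>A\<^sup>T Z\<bar>\<^sup>2 = \<parallel>A\<parallel>\<^sub>H\<^sub>S\<^sup>2\<close>, since the coordinates of \<open>Z\<close> are uncorrelated with variance \<open>1\<close>.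
\<close>

lemma mehler_hessian_bound:
  assumes u: "C_b_infinity d u"
    and bd: "\<And>x. x \<in> Rd d \<Longrightarrow> (\<Sum>i<d. (partial_deriv i u x)\<^sup>2) \<le> 1"
  shows "\<bar>sin \<theta> * (\<Sum>i<d. \<Sum>j<d. A i j * mehler d \<theta> (\<lambda>y. hessian u y i j) x)\<bar> \<le> hs_norm d A"
proof -
  interpret prob_space "gauss d" by (rule prob_space_gauss)
  define g where "g j z = partial_deriv j u (lincomb d (cos \<theta>) x (sin \<theta>) z)" for j z
  define w where "w j z = (\<Sum>i<d. A i j * z i)" for j z
  have g: "(\<Sum>j<d. (g j z)\<^sup>2) \<le> 1" for z unfolding g_def by (rule bd) simp
  have intg: "integrable (gauss d) (\<lambda>z. z i * g j z)" if "i < d" "j < d" for i j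
    unfolding g_def using mehler_by_parts(1)[OF C_b_infinity_partial_deriv[OF u that(2)] that(1)] .
  have A2: "(\<Sum>i<d. \<Sum>j<d. (A i j)\<^sup>2) = (hs_norm d A)\<^sup>2"
    unfolding hs_norm_def hs_inner_def by (simp add: power2_eq_square sum_nonneg)
  have eq: "sin \<theta> * (\<Sum>i<d. \<Sum>j<d. A i j * mehler d \<theta> (\<lambda>y. hessian u y i j) x)
      = (\<integral>z. (\<Sum>j<d. w j z * g j z) \<partial>gauss d)"
  proof -
    have "sin \<theta> * (\<Sum>i<d. \<Sum>j<d. A i j * mehler d \<theta> (\<lambda>y. hessian u y i j) x)
      = (\<Sum>i<d. \<Sum>j<d. A i j * (\<integral>z. z i * g j z \<partial>gauss d))"
      unfolding sum_distrib_left
    proof (intro sum.cong refl)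
      fix i j assume "i \<in> {..<d}" "j \<in> {..<d}"
      then show "sin \<theta> * (A i j * mehler d \<theta> (\<lambda>y. hessian u y i j) x)
          = A i j * (\<integral>z. z i * g j z \<partial>gauss d)"
        using mehler_by_parts(2)[OF C_b_infinity_partial_deriv[OF u, of j], of i \<theta> x]
        unfolding g_def hessian_def by simp
    qed
    also have "\<dots> = (\<integral>z. (\<Sum>i<d. \<Sum>j<d. A i j * (z i * g j z)) \<partial>gauss d)"
      by (rule integral_double_sum(2)[symmetric, OF intg])
    also have "\<dots> = (\<integral>z. (\<Sum>j<d. w j z * g j z) \<partial>gauss d)"
      unfolding w_def sum_distrib_right
      by (subst sum.swap) (simp add: mult_ac)
    finally show ?thesis .
  qed
  have w_sq: "(w j z)\<^sup>2 = (\<Sum>i<d. \<Sum>k<d. (A i j * A k j) * (z i * z k))" for j z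
    unfolding w_def power2_eq_square sum_product by (simp add: mult_ac)
  have intz: "integrable (gauss d) (\<lambda>z. (w j z)\<^sup>2)" for j
    unfolding w_sq by (intro integral_double_sum gauss_second_moments)
  have w2: "(\<integral>z. (\<Sum>j<d. (w j z)\<^sup>2) \<partial>gauss d) = (hs_norm d A)\<^sup>2"
  proof -
    have "(\<integral>z. (w j z)\<^sup>2 \<partial>gauss d) = (\<Sum>i<d. (A i j)\<^sup>2)" for j
    proof -
      have "(\<integral>z. (w j z)\<^sup>2 \<partial>gauss d) = (\<integral>z. (\<Sum>i<d. \<Sum>k<d. (A i j * A k j) * (z i * z k)) \<partial>gauss d)"
        unfolding w_sq ..
      also have "\<dots> = (\<Sum>i<d. \<Sum>k<d. (A i j * A k j) * (if i = k then 1 else 0))"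
        using gauss_second_moments[of _ d] by (simp add: integral_double_sum(2))
      also have "\<dots> = (\<Sum>i<d. (A i j)\<^sup>2)"
        by (simp add: power2_eq_square if_distrib[of "\<lambda>y. _ * y"] cong: if_cong)
      finally show ?thesis .
    qed
    then show ?thesis using intz A2 sum.swap[of "\<lambda>i j. (A i j)\<^sup>2" "{..<d}" "{..<d}"] by simp
  qed
  have intwg: "integrable (gauss d) (\<lambda>z. \<Sum>j<d. w j z * g j z)"
    unfolding w_def sum_distrib_right mult.assoc
    by (intro integral_double_sum intg)
  define L where "L = hs_norm d A"
  have L: "0 \<le> L" unfolding L_def hs_norm_def hs_inner_def by (simp add: sum_nonneg)
  \<comment> \<open>The Cauchy-Schwarz inequality with a free parameter; the optimal choice is \<open>l = L\<close>, and small
    \<open>l\<close> settles \<open>L = 0\<close>.\<close>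
  have key: "\<bar>\<integral>z. (\<Sum>j<d. w j z * g j z) \<partial>gauss d\<bar> \<le> (L\<^sup>2 / l + l) / 2" if l: "l > 0" for l
  proof -
    have "\<bar>\<integral>z. (\<Sum>j<d. w j z * g j z) \<partial>gauss d\<bar> \<le> (\<integral>z. \<bar>\<Sum>j<d. w j z * g j z\<bar> \<partial>gauss d)"
      by (rule integral_abs_bound)
    also have "\<dots> \<le> (\<integral>z. ((\<Sum>j<d. (w j z)\<^sup>2) / l + l) / 2 \<partial>gauss d)"
    proof (intro integral_mono)
      fix z
      have "\<bar>w j z * g j z\<bar> \<le> ((w j z)\<^sup>2 / l + l * (g j z)\<^sup>2) / 2" for j
      proof -
        have "2 * (\<bar>w j z\<bar> / sqrt l) * (sqrt l * \<bar>g j z\<bar>)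
            \<le> (\<bar>w j z\<bar> / sqrt l)\<^sup>2 + (sqrt l * \<bar>g j z\<bar>)\<^sup>2"
          by (rule sum_squares_bound)
        then show ?thesis using l by (simp add: power_mult_distrib power_divide abs_mult)
      qed
      then have "\<bar>\<Sum>j<d. w j z * g j z\<bar> \<le> (\<Sum>j<d. ((w j z)\<^sup>2 / l + l * (g j z)\<^sup>2) / 2)"
        by (intro order.trans[OF sum_abs] sum_mono)
      also have "\<dots> = ((\<Sum>j<d. (w j z)\<^sup>2) / l + l * (\<Sum>j<d. (g j z)\<^sup>2)) / 2"
        by (simp add: sum_divide_distrib[symmetric] sum.distrib sum_distrib_left)
      also have "\<dots> \<le> ((\<Sum>j<d. (w j z)\<^sup>2) / l + l * 1) / 2"
        using g[of z] l by (intro divide_right_mono add_left_mono mult_left_mono) auto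
      finally show "\<bar>\<Sum>j<d. w j z * g j z\<bar> \<le> ((\<Sum>j<d. (w j z)\<^sup>2) / l + l) / 2" by simp
    qed (use intwg intz in auto)
    also have "\<dots> = (L\<^sup>2 / l + l) / 2"
      using intz w2 by (simp add: prob_space L_def)
    finally show ?thesis .
  qed
  have "\<bar>\<integral>z. (\<Sum>j<d. w j z * g j z) \<partial>gauss d\<bar> \<le> L"
  proof (cases "L = 0")
    case True
    show ?thesis
    proof (rule field_le_epsilon)
      fix e :: real assume "0 < e"
      then show "\<bar>\<integral>z. (\<Sum>j<d. w j z * g j z) \<partial>gauss d\<bar> \<le> L + e"
        using key[of e] True by simp
    qed
  next
    case False
    then show ?thesis using key[of L] L by (simp add: power2_eq_square)
  qed
  then show ?thesis by (simp add: eq L_def)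
qed

text \<open>
  The \<open>\<theta>\<close>-derivative of \<open>mehler d \<theta> u x\<close>, as the next lemma shows.
\<close>

definition mehler_velocity ::
    "nat \<Rightarrow> real \<Rightarrow> ((nat \<Rightarrow> real) \<Rightarrow> real) \<Rightarrow> (nat \<Rightarrow> real) \<Rightarrow> real" where
  "mehler_velocity d \<theta> u x = - sin \<theta> * (\<Sum>i<d. x i * mehler d \<theta> (partial_deriv i u) x)
     + sin \<theta> * cos \<theta> * (\<Sum>i<d. mehler d \<theta> (\<lambda>y. hessian u y i i) x)"

text \<open>
  Differentiating \<open>u(cos \<theta> x + sin \<theta> z)\<close> gives \<open>\<langle>\<nabla>u, - sin \<theta> x + cos \<theta> z\<rangle>\<close>, and
  integration by parts converts the factors \<open>z i\<close> into the Laplacian. The bound, linear in \<open>x\<close>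
  and uniform in \<open>\<theta>\<close>, is what allows differentiation under an integral over a measure with first
  moments.
\<close>

lemma mehler_theta_derivative:
  assumes u: "C_b_infinity d u" and x: "x \<in> Rd d"
  shows "((\<lambda>\<theta>. mehler d \<theta> u x) has_real_derivative mehler_velocity d \<theta> u x) (at \<theta>)"
    and "\<exists>C. \<forall>\<theta>. \<forall>x\<in>Rd d.
      \<bar>mehler_velocity d \<theta> u x\<bar> \<le> C * (1 + (\<Sum>i<d. \<bar>x i\<bar>))"
proof -
  let ?y = "\<lambda>\<theta> z. lincomb d (cos \<theta>) x (sin \<theta>) z"
  have su: "C_diff d (Suc 0) u" using C_b_infinity_smooth[OF u] by (simp add: smooth_def)
  have "\<exists>B. \<forall>i<d. \<forall>x\<in>Rd d. \<bar>partial_deriv i u x\<bar> \<le> B \<and> \<bar>hessian u x i i\<bar> \<le> B"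
  proof (rule finite_uniform_bound)
    fix i assume i: "i < d"
    note p = C_b_infinity_partial_deriv[OF u i]
    obtain B1 where B1: "\<And>x. x \<in> Rd d \<Longrightarrow> \<bar>partial_deriv i u x\<bar> \<le> B1"
      using C_b_infinity_bound[OF p] by blast
    obtain B2 where B2: "\<And>x. x \<in> Rd d \<Longrightarrow> \<bar>hessian u x i i\<bar> \<le> B2"
      using C_b_infinity_bound[OF C_b_infinity_partial_deriv[OF p i]] unfolding hessian_def by blast
    show "\<exists>B. \<forall>x\<in>Rd d. \<bar>partial_deriv i u x\<bar> \<le> B \<and> \<bar>hessian u x i i\<bar> \<le> B"
      by (intro exI[of _ "max B1 B2"]) (auto simp: le_max_iff_disj B1 B2)
  qed force
  then obtain B where B: "\<And>i x. i < d \<Longrightarrow> x \<in> Rd d \<Longrightarrow> \<bar>partial_deriv i u x\<bar> \<le> B"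
    "\<And>i x. i < d \<Longrightarrow> x \<in> Rd d \<Longrightarrow> \<bar>hessian u x i i\<bar> \<le> B" by blast
  have cu: "continuous_on (Rd d) (partial_deriv i u)" "continuous_on (Rd d) (\<lambda>y. hessian u y i i)"
    if "i < d" for i
    using C_b_infinity_partial_deriv[OF u that]
      C_b_infinity_partial_deriv[OF C_b_infinity_partial_deriv[OF u that] that]
    unfolding hessian_def by (auto intro: smooth_continuous C_b_infinity_smooth)
  define D where "D \<theta> z = (\<Sum>i<d. partial_deriv i u (?y \<theta> z) * (- sin \<theta> * x i + cos \<theta> * z i))"
    for \<theta> z
  have int1: "integrable (gauss d) (\<lambda>z. partial_deriv i u (?y \<theta> z))" if "i < d" for i \<theta>
    using C_b_infinity_mehler_integrable[OF C_b_infinity_partial_deriv[OF u that]] .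
  note int2 = mehler_by_parts[OF C_b_infinity_partial_deriv[OF u]]
  have "((\<lambda>\<theta>. \<integral>z. u (?y \<theta> z) \<partial>gauss d) has_real_derivative (\<integral>z. D \<theta> z \<partial>gauss d)) (at \<theta>)"
  proof (rule has_real_derivative_integral(2)[OF zero_less_one])
    show "integrable (gauss d) (\<lambda>z. u (?y t z))" for t
      by (rule C_b_infinity_mehler_integrable[OF u])
    show "((\<lambda>t. u (?y t z)) has_real_derivative D t z) (at t)" for t z
      unfolding D_def
      by (rule C_diff_chain_rule[OF su]) (auto intro!: derivative_eq_intros)
    show "integrable (gauss d) (\<lambda>z. \<Sum>i<d. B * (\<bar>x i\<bar> + \<bar>z i\<bar>))"
      using gauss_first_moment_integrable[of _ d]
        finite_measure.integrable_const[OF prob_space.finite_measure[OF prob_space_gauss]]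
      by (intro Bochner_Integration.integrable_sum integrable_mult_right
          Bochner_Integration.integrable_add integrable_abs) auto
    show "\<bar>D t z\<bar> \<le> (\<Sum>i<d. B * (\<bar>x i\<bar> + \<bar>z i\<bar>))" for t z
      unfolding D_def
    proof (intro order.trans[OF sum_abs] sum_mono)
      fix i assume "i \<in> {..<d}"
      then have b: "\<bar>partial_deriv i u (?y t z)\<bar> \<le> B" using B(1) by simp
      have "\<bar>- sin t * x i\<bar> \<le> 1 * \<bar>x i\<bar>" unfolding abs_mult by (intro mult_right_mono) auto
      moreover have "\<bar>cos t * z i\<bar> \<le> 1 * \<bar>z i\<bar>" unfolding abs_mult by (intro mult_right_mono) auto
      ultimately have "\<bar>- sin t * x i + cos t * z i\<bar> \<le> \<bar>x i\<bar> + \<bar>z i\<bar>" by linarith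
      then show "\<bar>partial_deriv i u (?y t z) * (- sin t * x i + cos t * z i)\<bar> \<le> B * (\<bar>x i\<bar> + \<bar>z i\<bar>)"
        unfolding abs_mult using b by (intro mult_mono) auto
    qed
  qed
  moreover have "(\<integral>z. D \<theta> z \<partial>gauss d) = mehler_velocity d \<theta> u x"
  proof -
    have "(\<integral>z. D \<theta> z \<partial>gauss d) = (\<integral>z. (\<Sum>i<d. (- sin \<theta> * x i) * partial_deriv i u (?y \<theta> z)
        + cos \<theta> * (z i * partial_deriv i u (?y \<theta> z))) \<partial>gauss d)"
      unfolding D_def by (simp add: algebra_simps)
    also have "\<dots> = (\<Sum>i<d. (- sin \<theta> * x i) * (\<integral>z. partial_deriv i u (?y \<theta> z) \<partial>gauss d)
        + cos \<theta> * (\<integral>z. z i * partial_deriv i u (?y \<theta> z) \<partial>gauss d))"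
      using int1 int2(1) by simp
    also have "\<dots> = (\<Sum>i<d. - sin \<theta> * (x i * mehler d \<theta> (partial_deriv i u) x)
        + sin \<theta> * cos \<theta> * mehler d \<theta> (\<lambda>y. hessian u y i i) x)"
      using int2(2) by (intro sum.cong refl) (simp add: mehler_eq[of d \<theta> "partial_deriv _
          u"] hessian_def)
    finally show ?thesis by (simp only: mehler_velocity_def sum.distrib sum_distrib_left)
  qed
  ultimately show "((\<lambda>\<theta>. mehler d \<theta> u x) has_real_derivative
     mehler_velocity d \<theta> u x) (at \<theta>)"
    by (simp add: mehler_eq[of d _ u])
  show "\<exists>C. \<forall>\<theta>. \<forall>x\<in>Rd d.
      \<bar>mehler_velocity d \<theta> u x\<bar> \<le> C * (1 + (\<Sum>i<d. \<bar>x i\<bar>))"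
  proof (intro exI[of _ "\<bar>B\<bar> * (1 + real d)"] allI ballI)
    fix \<theta> and x :: "nat \<Rightarrow> real"
    have 1: "\<bar>\<Sum>i<d. x i * mehler d \<theta> (partial_deriv i u) x\<bar> \<le> (\<Sum>i<d. \<bar>x i\<bar> * \<bar>B\<bar>)"
    proof (intro order.trans[OF sum_abs] sum_mono)
      fix i assume "i \<in> {..<d}"
      then have "\<bar>mehler d \<theta> (partial_deriv i u) x\<bar> \<le> B" by (intro mehler_bound cu B) auto
      then show "\<bar>x i * mehler d \<theta> (partial_deriv i u) x\<bar> \<le> \<bar>x i\<bar> * \<bar>B\<bar>"
        unfolding abs_mult by (intro mult_left_mono) auto
    qed
    have 2: "\<bar>\<Sum>i<d. mehler d \<theta> (\<lambda>y. hessian u y i i) x\<bar> \<le> (\<Sum>i<d. \<bar>B\<bar>)"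
    proof (intro order.trans[OF sum_abs] sum_mono)
      fix i assume "i \<in> {..<d}"
      then have "\<bar>mehler d \<theta> (\<lambda>y. hessian u y i i) x\<bar> \<le> B" by (intro mehler_bound cu B) auto
      then show "\<bar>mehler d \<theta> (\<lambda>y. hessian u y i i) x\<bar> \<le> \<bar>B\<bar>" by simp
    qed
    have "\<bar>- sin \<theta> * (\<Sum>i<d. x i * mehler d \<theta> (partial_deriv i u) x)\<bar> \<le> 1 * (\<Sum>i<d. \<bar>x i\<bar> * \<bar>B\<bar>)"
      unfolding abs_mult using 1 by (intro mult_mono) auto
    moreover have "\<bar>sin \<theta> * cos \<theta> * (\<Sum>i<d. mehler d \<theta> (\<lambda>y. hessian u y i i) x)\<bar>
        \<le> 1 * 1 * (\<Sum>i<d. \<bar>B\<bar>)"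
      unfolding abs_mult using 2 by (intro mult_mono) auto
    moreover have "(\<Sum>i<d. \<bar>x i\<bar> * \<bar>B\<bar>) + (\<Sum>i<d. \<bar>B\<bar>) \<le> \<bar>B\<bar> * (1 + real d) * (1 + (\<Sum>i<d. \<bar>x i\<bar>))"
      unfolding sum_distrib_right[symmetric]
      by (simp add: algebra_simps sum_nonneg)
    ultimately show "\<bar>mehler_velocity d \<theta> u x\<bar>
      \<le> \<bar>B\<bar> * (1 + real d) * (1 + (\<Sum>i<d. \<bar>x i\<bar>))"
      unfolding mehler_velocity_def by linarith
  qed
qed

section \<open>Smooth bump functions\<close>

text \<open>
  If \<open>q(s) = p(1/s) exp (- 1/s)\<close> then \<open>q'(s) = y\<^sup>2 (p(y) - p'(y)) exp (- y)\<close> at \<open>y = 1/s\<close>. Hence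
  \<open>flat n\<close> below is the \<open>n\<close>-th derivative of the function that is \<open>exp (- 1/s)\<close> for \<open>s > 0\<close> and
  \<open>0\<close> for \<open>s \<le> 0\<close>.
\<close>

primrec flat_poly :: "nat \<Rightarrow> real poly" where
  "flat_poly 0 = 1"
| "flat_poly (Suc n) = [:0, 0, 1:] * (flat_poly n - pderiv (flat_poly n))"

definition flat :: "nat \<Rightarrow> real \<Rightarrow> real" where
  "flat n s = (if s > 0 then poly (flat_poly n) (1 / s) * exp (- (1 / s)) else 0)"

lemma poly_times_exp_minus_tendsto_0:
  "((\<lambda>y::real. poly p y * exp (- y)) \<longlongrightarrow> 0) at_top"
proof -
  have "((\<lambda>y::real. \<Sum>i\<le>degree p. coeff p i * (y ^ i / exp y)) \<longlongrightarrow> (\<Sum>i\<le>degree p. coeff p i * 0))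
      at_top"
    by (intro tendsto_sum tendsto_mult tendsto_const tendsto_power_div_exp_0)
  then show ?thesis
    by (simp add: poly_altdef sum_distrib_left exp_minus divide_inverse mult_ac)
qed

text \<open>
  The only delicate point is \<open>s = 0\<close>, where the difference quotient from the right is again a
  polynomial in \<open>1/s\<close> times \<open>exp (- 1/s)\<close> and so tends to \<open>0\<close>.
\<close>

lemma flat_has_derivative: "(flat n has_real_derivative flat (Suc n) s) (at s)"
proof -
  consider "s > 0" | "s < 0" | "s = 0" by linarith
  then show ?thesis
  proof cases
    case 1
    have "((\<lambda>s. poly (flat_poly n) (1 / s) * exp (- (1 / s))) has_real_derivative flat (Suc n) s)
        (at s)"
      using 1
      by (auto intro!: derivative_eq_intros DERIV_chain2[OF poly_DERIV]
          simp: flat_def field_simps power2_eq_square)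
    then show ?thesis
      by (rule DERIV_cong_ev[THEN iffD1, rotated -1])
        (use 1 eventually_nhds_in_open[of "{0<..}" s] in \<open>auto simp: flat_def elim!:
          eventually_mono\<close>)
  next
    case 2
    have "((\<lambda>s. 0) has_real_derivative flat (Suc n) s) (at s)"
      using 2 by (simp add: flat_def)
    then show ?thesis
      by (rule DERIV_cong_ev[THEN iffD1, rotated -1])
        (use 2 eventually_nhds_in_open[of "{..<0}" s] in \<open>auto simp: flat_def elim!:
          eventually_mono\<close>)
  next
    case 3
    have "((\<lambda>h. (flat n h - flat n 0) / h) \<longlongrightarrow> 0) (at_left 0)"
      by (rule tendsto_eventually) (auto simp: flat_def eventually_at_filter)
    moreover have "((\<lambda>h. (flat n h - flat n 0) / h) \<longlongrightarrow> 0) (at_right 0)"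
    proof -
      have "((\<lambda>h. poly ([:0, 1:] * flat_poly n) (inverse h) * exp (- inverse h)) \<longlongrightarrow> 0) (at_right 0)"
        by (rule filterlim_compose[OF poly_times_exp_minus_tendsto_0
          filterlim_inverse_at_top_right])
      then show ?thesis
        by (rule Lim_transform_eventually)
          (auto simp: flat_def eventually_at_filter field_simps)
    qed
    ultimately have "((\<lambda>h. (flat n h - flat n 0) / h) \<longlongrightarrow> 0) (at 0)"
      by (rule filterlim_split_at)
    then show ?thesis using 3 by (simp add: DERIV_def flat_def)
  qed
qed

definition bump :: "nat \<Rightarrow> real \<Rightarrow> (nat \<Rightarrow> real) \<Rightarrow> real" where
  "bump d a x = flat 0 (a - (\<Sum>i<d. (x i)\<^sup>2))"

lemma smooth_bump: "smooth d (bump d a)"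
proof -
  have "C_diff d k (\<lambda>x. flat 0 (a + (\<Sum>i<d. - 1 * (x i * x i))))" for k
    by (rule C_diff_compose[where D=flat and n=0 and U=UNIV])
      (intro flat_has_derivative C_diff_add C_diff_sum C_diff_mult C_diff_const C_diff_coord
        UNIV_I)+
  then show ?thesis
    unfolding smooth_def bump_def[abs_def] by (simp add: power2_eq_square sum_negf)
qed

text \<open>
  Supports are confined to boxes and not to balls, because the measure and the compactness of a box
  follow from those of intervals.
\<close>

definition box_supported :: "nat \<Rightarrow> real \<Rightarrow> ((nat \<Rightarrow> real) \<Rightarrow> real) \<Rightarrow> bool" where
  "box_supported d r f \<longleftrightarrow> (\<forall>x\<in>Rd d. (\<exists>i<d. \<bar>x i\<bar> > r) \<longrightarrow> f x = 0)"

lemma box_supported_bump: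
  assumes "0 \<le> r"
  shows "box_supported d r (bump d (r\<^sup>2))"
  unfolding box_supported_def
proof (intro ballI impI)
  fix x assume "\<exists>i<d. \<bar>x i\<bar> > r"
  then obtain i where i: "i < d" "\<bar>x i\<bar> > r" by blast
  have "r\<^sup>2 < (x i)\<^sup>2" using i assms by
    (metis abs_of_nonneg power2_abs power_strict_mono zero_less_numeral)
  also have "(x i)\<^sup>2 \<le> (\<Sum>i<d. (x i)\<^sup>2)" using i by (intro member_le_sum) auto
  finally show "bump d (r\<^sup>2) x = 0" by (simp add: bump_def flat_def)
qed

lemma box_supported_partial_deriv:
  assumes f: "box_supported d r f" and i: "i < d"
  shows "box_supported d r (partial_deriv i f)"
  unfolding box_supported_def
proof (intro ballI impI)
  fix x assume x: "x \<in> Rd d" and "\<exists>j<d. \<bar>x j\<bar> > r"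
  then obtain j where j: "j < d" "\<bar>x j\<bar> > r" by blast
  have ev: "\<forall>\<^sub>F t in nhds (x i). \<bar>(x(i := t)) j\<bar> > r"
  proof (cases "i = j")
    case True
    have "open {t::real. r < \<bar>t\<bar>}" by (intro open_Collect_less continuous_intros)
    from eventually_nhds_in_open[OF this, of "x i"] show ?thesis using True j by simp
  qed (use j in auto)
  have "\<forall>\<^sub>F t in nhds (x i). f (x(i := t)) = 0"
    using ev
  proof eventually_elim
    case (elim t)
    then show ?case
      using f j(1) fun_upd_in_Rd[OF x i] unfolding box_supported_def by blast
  qed
  then have "((\<lambda>t. f (x(i := t))) has_real_derivative 0) (at (x i))"
    by (subst DERIV_cong_ev[OF refl _ refl]) auto
  then show "partial_deriv i f x = 0" by (rule partial_deriv_eqI)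
qed

lemma compact_Rd_box: "compact (PiE {..<d::nat} (\<lambda>_. {- r..r::real}))"
proof -
  have eq: "PiE {..<d} (\<lambda>_. {- r..r})
      = PiE (UNIV :: nat set) (\<lambda>i. if i < d then {- r..r} else {undefined})"
    by (auto simp: PiE_def extensional_def Pi_def split: if_splits)
  have "compactin (product_topology (\<lambda>_. euclidean) UNIV)
      (PiE UNIV (\<lambda>i::nat. if i < d then {- r..r::real} else {undefined}))"
    unfolding compactin_PiE by auto
  then show ?thesis unfolding eq by (simp add: euclidean_product_topology)
qed

text \<open>
  The box is compact by Tychonoff's theorem, for the topology of \<open>Rd d\<close> is the product topology.
\<close>

lemma box_supported_bounded:
  assumes f: "continuous_on (Rd d) f" "box_supported d r f"
  obtains B where "0 \<le> B" "\<And>x. x \<in> Rd d \<Longrightarrow> \<bar>f x\<bar> \<le> B"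
proof -
  let ?K = "PiE {..<d} (\<lambda>_. {- r..r::real})"
  have "?K \<subseteq> Rd d" by (auto simp: Rd_def PiE_def)
  then have "compact (f ` ?K)"
    using compact_continuous_image[OF continuous_on_subset[OF f(1)] compact_Rd_box] by blast
  then obtain B where B: "\<And>x. x \<in> ?K \<Longrightarrow> norm (f x) \<le> B"
    using compact_imp_bounded bounded_iff by (metis imageI)
  show ?thesis
  proof (rule that[of "max B 0"])
    fix x assume x: "x \<in> Rd d"
    show "\<bar>f x\<bar> \<le> max B 0"
    proof (cases "x \<in> ?K")
      case True then show ?thesis using B[of x] by simp
    next
      case False
      then obtain i where "i < d" "\<bar>x i\<bar> > r"
        using x by (auto simp: Rd_def PiE_def Pi_def abs_le_iff not_le)
      then have "f x = 0" using f(2) x unfolding box_supported_def by blast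
      then show ?thesis by simp
    qed
  qed simp
qed

section \<open>The Stein identity for bounded test functions\<close>

lemma hessian_mult:
  assumes f: "smooth d f" and g: "smooth d g" and ij: "i < d" "j < d" and x: "x \<in> Rd d"
  shows "partial_deriv i (\<lambda>x. f x * g x) x = partial_deriv i f x * g x + f x * partial_deriv i g x"
    and "hessian (\<lambda>x. f x * g x) x i j = hessian f x i j * g x + partial_deriv j f x
        * partial_deriv i g x
      + partial_deriv i f x * partial_deriv j g x + f x * hessian g x i j"
proof -
  have D: "((\<lambda>t. f (x(i := t)) * g (x(i := t))) has_real_derivative
      partial_deriv i f x * g x + f x * partial_deriv i g x) (at (x i))"
    if "smooth d f" "smooth d g" "i < d" "x \<in> Rd d" for f g i x
  proof -
    have *: "C_diff d (Suc 0) f" "C_diff d (Suc 0) g" using that unfolding smooth_def by blast+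
    show ?thesis
      using DERIV_mult[OF C_diff_has_partial_deriv[OF *(1) that(3,4)]
          C_diff_has_partial_deriv[OF *(2) that(3,4)]]
      unfolding fun_upd_triv by (simp add: mult.commute)
  qed
  note P = partial_deriv_eqI[OF D]
  show "partial_deriv i (\<lambda>x. f x * g x) x = partial_deriv i f x * g x + f x * partial_deriv i g x"
    by (rule P[OF f g ij(1) x])
  have "partial_deriv i (partial_deriv j (\<lambda>x. f x * g x)) x
      = partial_deriv i (\<lambda>x. partial_deriv j f x * g x + f x * partial_deriv j g x) x"
    by (rule partial_deriv_cong[OF P[OF f g ij(2)] ij(1) x])
  also have "\<dots> = (partial_deriv i (partial_deriv j f) x * g x + partial_deriv j f x
      * partial_deriv i g x)
      + (partial_deriv i f x * partial_deriv j g x + f x * partial_deriv i (partial_deriv j g) x)"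
    by (rule partial_deriv_eqI, rule DERIV_add; rule D)
      (use f g ij x in \<open>auto intro: smooth_partial_deriv\<close>)
  finally show "hessian (\<lambda>x. f x * g x) x i j
      = hessian f x i j * g x + partial_deriv j f x * partial_deriv i g x
      + partial_deriv i f x * partial_deriv j g x + f x * hessian g x i j"
    by (simp add: hessian_def)
qed

lemma smooth_mult: "smooth d f \<Longrightarrow> smooth d g \<Longrightarrow> smooth d (\<lambda>x. f x * g x)"
  unfolding smooth_def by (auto intro: C_diff_mult)

lemma hessian_lincomb:
  assumes f: "smooth d f" and ij: "i < d" "j < d" and x: "x \<in> Rd d"
  shows "partial_deriv i (\<lambda>x. f (lincomb d a x b z)) x = a * partial_deriv i f (lincomb d a x b z)"
    and "hessian (\<lambda>x. f (lincomb d a x b z)) x i j = a\<^sup>2 * hessian f (lincomb d a x b z) i j"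
proof -
  have D: "((\<lambda>t. f (lincomb d a (x(i := t)) b z)) has_real_derivative
           a * partial_deriv i f (lincomb d a x b z)) (at (x i))"
    if "smooth d f" "i < d" for f i and x :: "nat \<Rightarrow> real"
    using has_partial_deriv_lincomb[of d 0 f i a x b z "x i"] that
    unfolding smooth_def fun_upd_triv by blast
  note P = partial_deriv_eqI[OF D]
  show "partial_deriv i (\<lambda>x. f (lincomb d a x b z)) x = a * partial_deriv i f (lincomb d a x b z)"
    by (rule P[OF f ij(1)])
  have "partial_deriv i (partial_deriv j (\<lambda>x. f (lincomb d a x b z))) x
      = partial_deriv i (\<lambda>x. a * partial_deriv j f (lincomb d a x b z)) x"
    by (rule partial_deriv_cong[OF P[OF f ij(2)] ij(1) x])
  also have "\<dots> = a * (a * partial_deriv i (partial_deriv j f) (lincomb d a x b z))"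
    by (rule partial_deriv_eqI, rule DERIV_cmult, rule D)
      (use f ij in \<open>auto intro: smooth_partial_deriv\<close>)
  finally show "hessian (\<lambda>x. f (lincomb d a x b z)) x i j = a\<^sup>2 * hessian f (lincomb d a x b z) i j"
    by (simp add: hessian_def power2_eq_square)
qed

lemma smooth_lincomb: "smooth d f \<Longrightarrow> smooth d (\<lambda>x. f (lincomb d a x b z))"
  unfolding smooth_def by (auto intro: C_diff_lincomb)

lemma smooth_hessian_continuous:
  "smooth d f \<Longrightarrow> i < d \<Longrightarrow> j < d \<Longrightarrow> continuous_on (Rd d) (\<lambda>x. hessian f x i j)"
  unfolding hessian_def by (intro smooth_continuous smooth_partial_deriv)

definition bounded_to_second_order :: "nat \<Rightarrow> ((nat \<Rightarrow> real) \<Rightarrow> real) \<Rightarrow> real \<Rightarrow> bool" where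
  "bounded_to_second_order d f K \<longleftrightarrow> (\<forall>x\<in>Rd d. \<bar>f x\<bar> \<le> K \<and>
     (\<forall>i<d. \<bar>partial_deriv i f x\<bar> \<le> K) \<and> (\<forall>i<d. \<forall>j<d. \<bar>hessian f x i j\<bar> \<le> K))"

lemma bounded_to_second_orderI:
  assumes "\<exists>B. \<forall>x\<in>Rd d. \<bar>f x\<bar> \<le> B"
    and "\<And>i. i < d \<Longrightarrow> \<exists>B. \<forall>x\<in>Rd d. \<bar>partial_deriv i f x\<bar> \<le> B"
    and "\<And>i j. i < d \<Longrightarrow> j < d \<Longrightarrow> \<exists>B. \<forall>x\<in>Rd d. \<bar>hessian f x i j\<bar> \<le> B"
  shows "\<exists>K\<ge>0. bounded_to_second_order d f K"
proof -
  obtain B0 where B0: "\<forall>x\<in>Rd d. \<bar>f x\<bar> \<le> B0" using assms(1) by blast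
  have "\<exists>B. \<forall>i<d. \<forall>x\<in>Rd d. \<bar>partial_deriv i f x\<bar> \<le> B"
    by (rule finite_uniform_bound) (blast intro: assms(2) order_trans)+
  then obtain B1 where B1: "\<forall>i<d. \<forall>x\<in>Rd d. \<bar>partial_deriv i f x\<bar> \<le> B1" by blast
  have hb: "\<exists>B. \<forall>j<d. \<forall>x\<in>Rd d. \<bar>hessian f x i j\<bar> \<le> B" if "i < d" for i
    by (rule finite_uniform_bound) (blast intro: assms(3)[OF that] order_trans)+
  have "\<exists>B. \<forall>i<d. \<forall>j<d. \<forall>x\<in>Rd d. \<bar>hessian f x i j\<bar> \<le> B"
  proof (rule finite_uniform_bound)
    fix i B B' assume B: "\<forall>j<d. \<forall>x\<in>Rd d. \<bar>hessian f x i j\<bar> \<le> B" "B \<le> B'"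
    show "\<forall>j<d. \<forall>x\<in>Rd d. \<bar>hessian f x i j\<bar> \<le> B'"
    proof (intro allI impI ballI)
      fix j x assume "j < d" "x \<in> Rd d"
      with B(1) have "\<bar>hessian f x i j\<bar> \<le> B" by simp
      then show "\<bar>hessian f x i j\<bar> \<le> B'" using B(2) by simp
    qed
  qed (rule hb)
  then obtain B2 where B2: "\<forall>i<d. \<forall>j<d. \<forall>x\<in>Rd d. \<bar>hessian f x i j\<bar> \<le> B2" by blast
  show ?thesis
    unfolding bounded_to_second_order_def
    by (intro exI[of _ "max 0 (max B0 (max B1 B2))"]) (use B0 B1 B2 in \<open>auto simp: le_max_iff_disj\<close>)
qed

text \<open>
  Multiply \<open>f\<close> by the cutoff \<open>\<chi>(x/n)\<close> and let \<open>n\<close> tend to infinity. The Hessian of the product is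
  bounded uniformly in \<open>n\<close>, and the entries of \<open>\<tau>\<close> are integrable. On the other side the critical
  term is \<open>x i\<close> times the derivative of the cutoff: with \<open>y = x/n\<close> it equals \<open>y i\<close> times the
  derivative of \<open>\<chi>\<close> at \<open>y\<close>, which is bounded because \<open>\<chi>\<close> has bounded support. So first moments of
  \<open>\<nu>\<close> suffice for dominated convergence.
\<close>

lemma stein_identity_bounded:
  assumes \<nu>: "prob_space \<nu>" "sets \<nu> = sets (borel_Rd d)" "centered d \<nu>" "stein_kernel d \<nu> \<tau>"
    and f: "smooth d f" "bounded_to_second_order d f K"
  shows "(\<integral>x. (\<Sum>i<d. x i * partial_deriv i f x) \<partial>\<nu>) = (\<integral>x. hs_inner d (\<tau> x) (hessian f x) \<partial>\<nu>)"
proof -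
  interpret prob_space \<nu> by fact
  have sp: "space \<nu> = Rd d" using sets_eq_imp_space_eq[OF \<nu>(2)] by (simp add: space_borel_Rd)
  have \<tau>: "integrable \<nu> (\<lambda>x. \<tau> x i j)" if "i < d" "j < d" for i j
    using \<nu>(4) that unfolding stein_kernel_def by blast
  have xi: "integrable \<nu> (\<lambda>x. x i)" if "i < d" for i
    using \<nu>(3) that unfolding centered_def by (auto simp: has_bochner_integral_iff)
  have K: "\<bar>f x\<bar> \<le> K" "\<bar>partial_deriv i f x\<bar> \<le> K" "\<bar>hessian f x i j\<bar> \<le> K"
    if "x \<in> Rd d" "i < d" "j < d" for x i j
    using f(2) that unfolding bounded_to_second_order_def by auto
  \<comment> \<open>The factor \<open>exp 1\<close> normalises the cutoff to \<open>1\<close> at the origin.\<close>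
  define cut where "cut x = exp 1 * bump d 1 x" for x
  have s_cut: "smooth d cut"
    using smooth_bump[of d 1] C_diff_mult[OF C_diff_const] unfolding smooth_def cut_def[abs_def]
      by blast
  have b_cut: "box_supported d 1 cut"
    using box_supported_bump[of 1 d] unfolding box_supported_def cut_def by auto
  have cut0: "cut (lincomb d 0 x 0 x) = 1" for x
    by (simp add: cut_def bump_def flat_def exp_minus)
  have "\<exists>K\<ge>0. bounded_to_second_order d cut K"
  proof (rule bounded_to_second_orderI)
    show "\<exists>B. \<forall>x\<in>Rd d. \<bar>cut x\<bar> \<le> B"
      using box_supported_bounded[OF smooth_continuous[OF s_cut] b_cut] by metis
    show "\<exists>B. \<forall>x\<in>Rd d. \<bar>partial_deriv i cut x\<bar> \<le> B" if "i < d" for i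
      using box_supported_bounded[OF smooth_continuous[OF smooth_partial_deriv[OF s_cut that]]
          box_supported_partial_deriv[OF b_cut that]] by metis
    show "\<exists>B. \<forall>x\<in>Rd d. \<bar>hessian cut x i j\<bar> \<le> B" if "i < d" "j < d" for i j
      unfolding hessian_def
      using box_supported_bounded[OF smooth_continuous[OF smooth_partial_deriv[OF
              smooth_partial_deriv[OF s_cut that(2)] that(1)]]
          box_supported_partial_deriv[OF box_supported_partial_deriv[OF b_cut that(2)] that(1)]]
            by metis
  qed
  then obtain L where L0: "0 \<le> L" and "bounded_to_second_order d cut L" by blast
  then have L: "\<bar>cut x\<bar> \<le> L" "\<bar>partial_deriv i cut x\<bar> \<le> L" "\<bar>hessian cut x i j\<bar> \<le> L"
    if "x \<in> Rd d" "i < d" "j < d" for x i j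
    using that unfolding bounded_to_second_order_def by auto
  have L2: "\<bar>partial_deriv i cut x\<bar> \<le> L" if "x \<in> Rd d" "i < d" for x i
    using L(2)[OF that that(2)] .
  define c where "c n = 1 / real (Suc n)" for n
  have c: "0 < c n" "c n \<le> 1" for n by (auto simp: c_def)
  have c0: "c \<longlonglongrightarrow> 0" unfolding c_def using LIMSEQ_Suc[OF lim_1_over_n] by simp
  define y where "y n x = lincomb d (c n) x 0 x" for n x
  have lincomb_y: "lincomb d (c n) x 0 (\<lambda>_. 0) = y n x" for n x by (auto simp: y_def lincomb_def)
  have yR: "y n x \<in> Rd d" for n x by (simp add: y_def)
  define cutn where "cutn n x = cut (lincomb d (c n) x 0 (\<lambda>_. 0))" for n x
  have s_cutn: "smooth d (cutn n)" for n unfolding cutn_def[abs_def]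
    by (rule smooth_lincomb[OF s_cut])
  define g where "g n x = f x * cutn n x" for n x
  have sg: "smooth d (g n)" for n unfolding g_def[abs_def] by (rule smooth_mult[OF f(1) s_cutn])
  have test: "g n \<in> test_functions d" for n
  proof -
    have "g n x = 0" if x: "x \<in> Rd d" "enorm d x > real d * real (Suc n)" for x
    proof -
      have "\<exists>i<d. \<bar>x i\<bar> > real (Suc n)"
      proof (rule ccontr)
        assume "\<not> ?thesis"
        then have "(\<Sum>i<d. \<bar>x i\<bar>) \<le> (\<Sum>i<d. real (Suc n))"
          by (intro sum_mono) (meson lessThan_iff not_le)
        then show False using L2_set_le_sum_abs[of x "{..<d}"] x(2) by (simp add: enorm_def)
      qed
      then obtain i where i: "i < d" "\<bar>x i\<bar> > real (Suc n)" by blast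
      have "\<bar>y n x i\<bar> > 1" using i c(1)[of n] by (simp add: y_def abs_mult c_def field_simps)
      then have "cut (y n x) = 0" using b_cut yR i(1) unfolding box_supported_def by blast
      then show ?thesis by (simp add: g_def cutn_def lincomb_y)
    qed
    then have "compactly_supported d (g n)" unfolding compactly_supported_def by blast
    then show ?thesis using sg unfolding test_functions_def by blast
  qed
  have pg: "partial_deriv i (g n) x = partial_deriv i f x * cut (y n x) + f x
      * (c n * partial_deriv i cut (y n x))"
    if "i < d" "x \<in> Rd d" for i n x
    unfolding g_def[abs_def] using hessian_mult(1)[OF f(1) s_cutn that(1,1,2)]
      hessian_lincomb(1)[OF s_cut that(1,1,2), of "c n" 0 "\<lambda>_. 0"]
    by (simp add: cutn_def[abs_def] lincomb_y)
  have hg: "hessian (g n) x i j = hessian f x i j * cut (y n x) + partial_deriv j f x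
      * (c n * partial_deriv i cut (y n x))
      + partial_deriv i f x * (c n * partial_deriv j cut (y n x)) + f x
        * ((c n)\<^sup>2 * hessian cut (y n x) i j)"
    if "i < d" "j < d" "x \<in> Rd d" for i j n x
    unfolding g_def[abs_def] using hessian_mult(2)[OF f(1) s_cutn that]
      hessian_lincomb[OF s_cut that, of "c n" 0 "\<lambda>_. 0"]
      hessian_lincomb(1)[OF s_cut that(2,1,3), of "c n" 0 "\<lambda>_. 0"]
    by (simp add: cutn_def[abs_def] lincomb_y)
  have ylim: "(\<lambda>n. cut (y n x)) \<longlonglongrightarrow> 1" for x
  proof -
    have "(\<lambda>n. y n x) \<longlonglongrightarrow> lincomb d 0 x 0 x"
    proof (rule tendsto_function)
      fix i show "(\<lambda>n. y n x i) \<longlonglongrightarrow> lincomb d 0 x 0 x i"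
        using tendsto_mult_right[OF c0, of "x i"] by (cases "i < d") (auto simp: y_def lincomb_def)
    qed
    from continuous_on_tendsto_compose[OF smooth_continuous[OF s_cut] this]
    show ?thesis using yR by (simp add: cut0)
  qed
  have small: "(\<lambda>n. a * (c n * b n)) \<longlonglongrightarrow> 0" if "\<And>n. \<bar>b n\<bar> \<le> L" for a :: real and b
  proof (rule Lim_null_comparison)
    show "\<forall>\<^sub>F n in sequentially. norm (a * (c n * b n)) \<le> \<bar>a\<bar> * L * c n"
    proof (intro always_eventually allI)
      fix n
      have "\<bar>b n\<bar> * (\<bar>a\<bar> * c n) \<le> L * (\<bar>a\<bar> * c n)"
        by (rule mult_right_mono[OF that]) (use c(1)[of n] in simp)
      then show "norm (a * (c n * b n)) \<le> \<bar>a\<bar> * L * c n"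
        using c(1)[of n] by (simp add: abs_mult mult_ac)
    qed
    show "(\<lambda>n. \<bar>a\<bar> * L * c n) \<longlonglongrightarrow> 0" using tendsto_mult_left[OF c0, of "\<bar>a\<bar> * L"] by simp
  qed
  have eq: "(\<integral>x. (\<Sum>i<d. x i * partial_deriv i (g n) x) \<partial>\<nu>)
      = (\<integral>x. hs_inner d (\<tau> x) (hessian (g n) x) \<partial>\<nu>)"
    "integrable \<nu> (\<lambda>x. \<Sum>i<d. x i * partial_deriv i (g n) x)"
    "integrable \<nu> (\<lambda>x. hs_inner d (\<tau> x) (hessian (g n) x))" for n
    using \<nu>(4) test[of n] unfolding stein_kernel_def by auto
  have meas: "f' \<in> borel_measurable \<nu>" if "continuous_on (Rd d) f'" for f' :: "(nat \<Rightarrow> real) \<Rightarrow> real"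
    using continuous_on_Rd_measurable[OF that \<nu>(2)] .
  note [measurable] = meas[OF continuous_on_coord]
  have [measurable]: "partial_deriv i f \<in> borel_measurable \<nu>" if "i < d" for i
    by (intro meas smooth_continuous smooth_partial_deriv f that)
  have [measurable]: "(\<lambda>x. hessian f x i j) \<in> borel_measurable \<nu>" if "i < d" "j < d" for i j
    by (intro meas smooth_hessian_continuous f that)
  have [measurable]: "(\<lambda>x. \<tau> x i j) \<in> borel_measurable \<nu>" if "i < d" "j < d" for i j
    using \<tau>[OF that] by auto
  have "(\<lambda>n. \<integral>x. (\<Sum>i<d. x i * partial_deriv i (g n) x) \<partial>\<nu>)
      \<longlonglongrightarrow> (\<integral>x. (\<Sum>i<d. x i * partial_deriv i f x) \<partial>\<nu>)"
  proof (rule integral_dominated_convergence)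
    show "integrable \<nu> (\<lambda>x. \<Sum>i<d. \<bar>x i\<bar> * (K * L) + K * L)"
      using xi by (intro Bochner_Integration.integrable_sum Bochner_Integration.integrable_add
          integrable_mult_left integrable_abs) auto
    show "AE x in \<nu>. (\<lambda>n. \<Sum>i<d. x i * partial_deriv i (g n) x) \<longlonglongrightarrow> (\<Sum>i<d. x i * partial_deriv i f x)"
    proof (intro AE_I2 tendsto_sum)
      fix x i assume "x \<in> space \<nu>" "i \<in> {..<d}"
      then have xi: "x \<in> Rd d" "i < d" by (auto simp: sp)
      have "(\<lambda>n. x i * (partial_deriv i f x * cut (y n x) + f x
          * (c n * partial_deriv i cut (y n x))))
          \<longlonglongrightarrow> x i * (partial_deriv i f x * 1 + 0)"
        by (intro tendsto_intros ylim small L2 yR xi)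
      then show "(\<lambda>n. x i * partial_deriv i (g n) x) \<longlonglongrightarrow> x i * partial_deriv i f x"
        using xi by (simp add: pg)
    qed
    show "AE x in \<nu>. norm (\<Sum>i<d. x i * partial_deriv i (g n) x) \<le> (\<Sum>i<d. \<bar>x i\<bar> * (K * L) + K * L)"
      for n
    proof (rule AE_I2)
      fix x assume "x \<in> space \<nu>"
      then have x: "x \<in> Rd d" by (simp add: sp)
      have "\<bar>x i * partial_deriv i (g n) x\<bar> \<le> \<bar>x i\<bar> * (K * L) + K * L" if i: "i < d" for i
      proof -
        have K0: "0 \<le> K" using K(1)[OF x i i] by linarith
        have 1: "\<bar>x i * (partial_deriv i f x * cut (y n x))\<bar> \<le> \<bar>x i\<bar> * (K * L)"
          unfolding abs_mult using K[OF x i i] L[OF yR i i] K0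
            by (intro mult_left_mono mult_mono) auto
        have "\<bar>y n x i * partial_deriv i cut (y n x)\<bar> \<le> 1 * L"
        proof (cases "\<bar>y n x i\<bar> > 1")
          case True
          then have "partial_deriv i cut (y n x) = 0"
            using box_supported_partial_deriv[OF b_cut i] yR i unfolding box_supported_def by blast
          then show ?thesis using L0 by simp
        next
          case False
          then show ?thesis unfolding abs_mult using L[OF yR i i] by (intro mult_mono) auto
        qed
        then have "\<bar>f x\<bar> * \<bar>y n x i * partial_deriv i cut (y n x)\<bar> \<le> K * L"
          using K(1)[OF x i i] K0 by (intro mult_mono) auto
        moreover have "x i * (f x * (c n * partial_deriv i cut (y n x)))
            = f x * (y n x i * partial_deriv i cut (y n x))"
          using i by (simp add: y_def)
        ultimately have 2: "\<bar>x i * (f x * (c n * partial_deriv i cut (y n x)))\<bar> \<le> K * L"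
          by (simp only: abs_mult)
        show ?thesis unfolding pg[OF i x] distrib_left using 1 2 by linarith
      qed
      then show "norm (\<Sum>i<d. x i * partial_deriv i (g n) x) \<le> (\<Sum>i<d. \<bar>x i\<bar> * (K * L) + K * L)"
        unfolding real_norm_def by (intro order.trans[OF sum_abs] sum_mono) auto
    qed
    show "(\<lambda>x. \<Sum>i<d. x i * partial_deriv i f x) \<in> borel_measurable \<nu>"
      by (intro borel_measurable_sum) simp
    show "(\<lambda>x. \<Sum>i<d. x i * partial_deriv i (g n) x) \<in> borel_measurable \<nu>" for n
      using eq(2) by auto
  qed
  moreover have "(\<lambda>n. \<integral>x. hs_inner d (\<tau> x) (hessian (g n) x) \<partial>\<nu>)
      \<longlonglongrightarrow> (\<integral>x. hs_inner d (\<tau> x) (hessian f x) \<partial>\<nu>)"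
    unfolding hs_inner_def
  proof (rule integral_dominated_convergence)
    show "integrable \<nu> (\<lambda>x. \<Sum>i<d. \<Sum>j<d. (4 * K * L) * \<bar>\<tau> x i j\<bar>)"
      using \<tau> by (intro integral_double_sum(1) integrable_abs) auto
    show "AE x in \<nu>. (\<lambda>n. \<Sum>i<d. \<Sum>j<d. \<tau> x i j * hessian (g n) x i j)
        \<longlonglongrightarrow> (\<Sum>i<d. \<Sum>j<d. \<tau> x i j * hessian f x i j)"
    proof (intro AE_I2 tendsto_sum)
      fix x i j assume "x \<in> space \<nu>" "i \<in> {..<d}" "j \<in> {..<d}"
      then have xi: "x \<in> Rd d" "i < d" "j < d" by (auto simp: sp)
      have cc: "\<bar>c n * hessian cut (y n x) i j\<bar> \<le> L" for n
      proof -
        have "\<bar>c n * hessian cut (y n x) i j\<bar> \<le> 1 * L"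
          unfolding abs_mult using c[of n] L[OF yR xi(2,3)] by (intro mult_mono) auto
        then show ?thesis by simp
      qed
      have "(\<lambda>n. \<tau> x i j * (hessian f x i j * cut (y n x) + partial_deriv j f x
          * (c n * partial_deriv i cut (y n x))
      + partial_deriv i f x * (c n * partial_deriv j cut (y n x)) + f x
        * (c n * (c n * hessian cut (y n x) i j))))
          \<longlonglongrightarrow> \<tau> x i j * (hessian f x i j * 1 + 0 + 0 + 0)"
        by (intro tendsto_mult tendsto_add tendsto_const ylim small L2 yR xi cc)
      then show "(\<lambda>n. \<tau> x i j * hessian (g n) x i j) \<longlonglongrightarrow> \<tau> x i j * hessian f x i j"
        using xi by (simp add: hg power2_eq_square mult.assoc)
    qed
    show "AE x in \<nu>. norm (\<Sum>i<d. \<Sum>j<d. \<tau> x i j * hessian (g n) x i j)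
        \<le> (\<Sum>i<d. \<Sum>j<d. (4 * K * L) * \<bar>\<tau> x i j\<bar>)" for n
    proof (rule AE_I2)
      fix x assume "x \<in> space \<nu>"
      then have x: "x \<in> Rd d" by (simp add: sp)
      have "\<bar>\<tau> x i j * hessian (g n) x i j\<bar> \<le> (4 * K * L) * \<bar>\<tau> x i j\<bar>" if ij: "i < d" "j < d"
        for i j
      proof -
        note K' = K[OF x ij] K(2)[OF x ij(2,2)]
          and L' = L[OF yR[of n x] ij] L(2)[OF yR[of n x] ij(2,2)]
        have K0: "0 \<le> K" using K' by linarith
        have m: "\<bar>a * (e * b)\<bar> \<le> K * L" if "\<bar>a\<bar> \<le> K" "\<bar>b\<bar> \<le> L" "0 \<le> e" "e \<le> 1" for a b e
        proof -
          have "\<bar>a * (e * b)\<bar> \<le> K * (1 * L)"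
            unfolding abs_mult using that K0 by (intro mult_mono) auto
          then show ?thesis by simp
        qed
        have c2: "0 \<le> (c n)\<^sup>2" "(c n)\<^sup>2 \<le> 1" using c[of n] by (auto simp: power_le_one)
        have "\<bar>hessian (g n) x i j\<bar> \<le> 4 * K * L"
          unfolding hg[OF ij x]
          using m[OF K'(3) L'(1), of 1] m[OF K'(4) L'(2), of "c n"] m[OF K'(2) L'(4), of "c n"]
            m[OF K'(1) L'(3) c2] c[of n] by simp
        from mult_left_mono[OF this, of "\<bar>\<tau> x i j\<bar>"]
        show ?thesis by (simp add: abs_mult mult_ac)
      qed
      then show "norm (\<Sum>i<d. \<Sum>j<d. \<tau> x i j * hessian (g n) x i j)
        \<le> (\<Sum>i<d. \<Sum>j<d. (4 * K * L) * \<bar>\<tau> x i j\<bar>)"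
        unfolding real_norm_def by (intro order.trans[OF sum_abs] sum_mono) auto
    qed
    show "(\<lambda>x. \<Sum>i<d. \<Sum>j<d. \<tau> x i j * hessian f x i j) \<in> borel_measurable \<nu>"
      by (intro borel_measurable_sum borel_measurable_times) simp_all
    show "(\<lambda>x. \<Sum>i<d. \<Sum>j<d. \<tau> x i j * hessian (g n) x i j) \<in> borel_measurable \<nu>" for n
      using eq(3)[of n] unfolding hs_inner_def by auto
  qed
  ultimately show ?thesis
    unfolding eq(1) by (rule LIMSEQ_unique)
qed

section \<open>Derivative of an integral along the interpolation\<close>

lemma hs_norm_nonneg: "0 \<le> hs_norm d A"
  by (simp add: hs_norm_def hs_inner_def sum_nonneg)

lemma hs_norm_le_sum: "hs_norm d A \<le> (\<Sum>i<d. \<Sum>j<d. \<bar>A i j\<bar>)"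
proof -
  have "hs_norm d A = L2_set (\<lambda>(i, j). A i j) ({..<d} \<times> {..<d})"
    by (simp add: hs_norm_def hs_inner_def L2_set_def sum.cartesian_product power2_eq_square
      split_def)
  also have "\<dots> \<le> (\<Sum>(i, j)\<in>{..<d} \<times> {..<d}. \<bar>A i j\<bar>)"
    using L2_set_le_sum_abs[of "\<lambda>(i, j). A i j" "{..<d} \<times> {..<d}"] by (simp add: split_def)
  finally show ?thesis by (simp add: sum.cartesian_product)
qed

lemma continuous_bounded_on_cball:
  fixes F :: "real \<Rightarrow> real"
  assumes "continuous_on UNIV F"
  obtains C where "0 \<le> C" "\<And>r. \<bar>r\<bar> \<le> B \<Longrightarrow> \<bar>F r\<bar> \<le> C"
proof -
  have "compact (F ` {-B..B})"
    using assms by (intro compact_continuous_image) (auto intro: continuous_on_subset)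
  then obtain C where C: "\<And>r. r \<in> {-B..B} \<Longrightarrow> norm (F r) \<le> C"
    using compact_imp_bounded bounded_iff by (metis imageI)
  show ?thesis
  proof (rule that[of "max C 0"])
    fix r :: real assume "\<bar>r\<bar> \<le> B"
    then have "r \<in> {-B..B}" by auto
    from C[OF this] show "\<bar>F r\<bar> \<le> max C 0" by simp
  qed simp
qed

lemma hessian_compose:
  assumes F: "\<And>r. (F has_real_derivative F' r) (at r)" "\<And>r. (F' has_real_derivative F'' r) (at r)"
    and f: "smooth d f" and ij: "i < d" "j < d" and x: "x \<in> Rd d"
  shows "partial_deriv i (\<lambda>x. F (f x)) x = F' (f x) * partial_deriv i f x"
    and "hessian (\<lambda>x. F (f x)) x i j =
           F'' (f x) * (partial_deriv i f x * partial_deriv j f x) + F' (f x) * hessian f x i j"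
proof -
  have cf: "C_diff d (Suc 0) f" using f by (simp add: smooth_def)
  have cj: "C_diff d (Suc 0) (partial_deriv j f)"
    using smooth_partial_deriv[OF f ij(2)] by (simp add: smooth_def)
  have D: "((\<lambda>t. G (f (x(i := t)))) has_real_derivative G' (f x) * partial_deriv i f x) (at (x i))"
    if G: "\<And>r. (G has_real_derivative G' r) (at r)" and "i < d" "x \<in> Rd d" for G G' i x
    by (rule DERIV_chain2[OF _ C_diff_has_partial_deriv[OF cf that(2,3)]]) (simp add: G)
  note P = partial_deriv_eqI[OF D[OF F(1)]]
  show "partial_deriv i (\<lambda>x. F (f x)) x = F' (f x) * partial_deriv i f x"
    by (rule P[OF ij(1) x])
  have "partial_deriv i (partial_deriv j (\<lambda>x. F (f x))) x
      = partial_deriv i (\<lambda>x. F' (f x) * partial_deriv j f x) x"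
    by (rule partial_deriv_cong[OF P[OF ij(2)] ij(1) x])
  also have "\<dots> = F'' (f x) * partial_deriv i f x * partial_deriv j f x
      + partial_deriv i (partial_deriv j f) x * F' (f x)"
    using DERIV_mult[OF D[OF F(2) ij(1) x] C_diff_has_partial_deriv[OF cj ij(1) x]]
    by (intro partial_deriv_eqI) simp
  finally show "hessian (\<lambda>x. F (f x)) x i j =
           F'' (f x) * (partial_deriv i f x * partial_deriv j f x) + F' (f x) * hessian f x i j"
    by (simp add: hessian_def mult_ac)
qed

definition quadratic_form :: "nat \<Rightarrow> (nat \<Rightarrow> nat \<Rightarrow> real) \<Rightarrow> (nat \<Rightarrow> real) \<Rightarrow> real" where
  "quadratic_form d A w = (\<Sum>i<d. \<Sum>j<d. A i j * (w i * w j))"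

text \<open>
  Boundedness of the image has to be checked, as the supremum of an unbounded set of reals is
  unspecified.
\<close>

lemma quadratic_form_le_op_norm:
  assumes w: "(\<Sum>i<d. (w i)\<^sup>2) \<le> 1"
  shows "\<bar>quadratic_form d A w\<bar> \<le> op_norm d A"
proof -
  let ?v = "lincomb d 1 w 0 w"
  let ?N = "\<lambda>v. enorm d (\<lambda>i. \<Sum>j<d. A i j * v j)"
  have nw: "enorm d ?v = sqrt (\<Sum>i<d. (w i)\<^sup>2)" "enorm d w = sqrt (\<Sum>i<d. (w i)\<^sup>2)"
    by (simp_all add: enorm_def L2_set_def)
  have v: "?v \<in> {v \<in> Rd d. enorm d v \<le> 1}" using w nw by simp
  have bdd: "bdd_above (?N ` {v \<in> Rd d. enorm d v \<le> 1})"
  proof (rule bdd_aboveI2)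
    fix v assume "v \<in> {v \<in> Rd d. enorm d v \<le> 1}"
    then have "(\<Sum>j<d. (v j)\<^sup>2) \<le> 1" by (simp add: enorm_def L2_set_def)
    then have v1: "\<bar>v j\<bar> \<le> 1" if "j < d" for j
      using member_le_sum[of j "{..<d}" "\<lambda>j. (v j)\<^sup>2"] that
        by (simp add: abs_square_le_1[symmetric])
    have "?N v \<le> (\<Sum>i<d. \<bar>\<Sum>j<d. A i j * v j\<bar>)" unfolding enorm_def by (rule L2_set_le_sum_abs)
    also have "\<dots> \<le> (\<Sum>i<d. \<Sum>j<d. \<bar>A i j\<bar> * 1)"
    proof (intro sum_mono order.trans[OF sum_abs])
      fix i j assume "j \<in> {..<d}"
      then show "\<bar>A i j * v j\<bar> \<le> \<bar>A i j\<bar> * 1"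
        unfolding abs_mult using v1 by (intro mult_left_mono) auto
    qed
    finally show "?N v \<le> (\<Sum>i<d. \<Sum>j<d. \<bar>A i j\<bar> * 1)" .
  qed
  have "\<bar>quadratic_form d A w\<bar> = \<bar>\<Sum>i<d. w i * (\<Sum>j<d. A i j * w j)\<bar>"
    by (simp add: quadratic_form_def sum_distrib_left mult_ac)
  also have "\<dots> \<le> (\<Sum>i<d. \<bar>w i\<bar> * \<bar>\<Sum>j<d. A i j * w j\<bar>)"
    by (rule order.trans[OF sum_abs]) (simp add: abs_mult)
  also have "\<dots> \<le> enorm d w * ?N w" unfolding enorm_def by (rule L2_set_mult_ineq)
  also have "\<dots> \<le> 1 * ?N w"
    using w nw by (intro mult_right_mono) (auto simp: enorm_def)
  also have "?N w = ?N ?v" by simp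
  also have "1 * ?N ?v \<le> op_norm d A" unfolding op_norm_def mult_1_left
    by (rule cSUP_upper[OF v bdd])
  finally show ?thesis .
qed

text \<open>
  The formula for \<open>\<Phi>'\<close> announced at the beginning, in the form of an estimate. With
  \<open>w = P\<nabla>u\<close> and \<open>H = P Hess u\<close>, the Stein identity for \<open>F \<circ> f\<^sub>\<theta>\<close>, divided by \<open>cos \<theta>\<close>, reads
  \<open>\<integral>F'(f) \<langle>x, w\<rangle> d\<nu> = cos \<theta> \<integral>(F''(f) \<langle>\<tau> w, w\<rangle> + F'(f) \<langle>\<tau>, H\<rangle>) d\<nu>\<close>; it replaces the drift term
  in \<open>\<Phi>'\<close>, and the trace of \<open>H\<close> combines with \<open>\<langle>\<tau>, H\<rangle>\<close> to \<open>\<langle>\<tau> - Id, H\<rangle>\<close>.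
\<close>

lemma mehler_flow_derivative_bound:
  assumes \<nu>: "prob_space \<nu>" "sets \<nu> = sets (borel_Rd d)" "centered d \<nu>" "stein_kernel d \<nu> \<tau>"
    and u: "C_b_infinity d u" and grad: "\<And>x. x \<in> Rd d \<Longrightarrow> (\<Sum>i<d. (partial_deriv i u x)\<^sup>2) \<le> 1"
    and F: "\<And>r. (F has_real_derivative F' r) (at r)" "\<And>r. (F' has_real_derivative F'' r) (at r)"
      "continuous_on UNIV F''" "\<And>f. smooth d f \<Longrightarrow> smooth d (\<lambda>x. F (f x))"
  shows "(\<lambda>\<theta>. \<integral>x. F (mehler d \<theta> u x) \<partial>\<nu>) differentiable at \<theta>"
    and "0 < sin \<theta> \<Longrightarrow> 0 < cos \<theta> \<Longrightarrow>
      \<bar>deriv (\<lambda>\<theta>. \<integral>x. F (mehler d \<theta> u x) \<partial>\<nu>) \<theta>\<bar> \<le>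
        cos \<theta> * (\<integral>x. \<bar>F' (mehler d \<theta> u x)\<bar> * hs_norm d (\<lambda>i j. \<tau> x i j - id_mat i j) \<partial>\<nu>)
      + sin \<theta> * cos \<theta> * (\<integral>x. \<bar>F'' (mehler d \<theta> u x)\<bar> *
           \<bar>quadratic_form d (\<tau> x) (\<lambda>i. mehler d \<theta> (partial_deriv i u) x)\<bar> \<partial>\<nu>)"
proof -
  interpret prob_space \<nu> by fact
  have sp: "space \<nu> = Rd d" using sets_eq_imp_space_eq[OF \<nu>(2)] by (simp add: space_borel_Rd)
  have \<tau>: "integrable \<nu> (\<lambda>x. \<tau> x i j)" if "i < d" "j < d" for i j
    using \<nu>(4) that unfolding stein_kernel_def by blast
  have xi: "integrable \<nu> (\<lambda>x. x i)" if "i < d" for i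
    using \<nu>(3) that unfolding centered_def by (auto simp: has_bochner_integral_iff)
  have meas: "f' \<in> borel_measurable \<nu>" if "continuous_on (Rd d) f'" for f' :: "(nat \<Rightarrow> real) \<Rightarrow> real"
    using continuous_on_Rd_measurable[OF that \<nu>(2)] .
  have cF: "continuous_on UNIV F" "continuous_on UNIV F'"
    using F(1,2) by (auto intro!: DERIV_isCont continuous_at_imp_continuous_on)
  obtain B where B: "0 \<le> B" "\<And>x. x \<in> Rd d \<Longrightarrow> \<bar>u x\<bar> \<le> B" using C_b_infinity_bound[OF u] by blast
  have cu: "continuous_on (Rd d) u" by (intro smooth_continuous C_b_infinity_smooth u)
  have fB: "\<bar>mehler d \<theta> u x\<bar> \<le> B" for \<theta> x using mehler_bound[OF cu B(2)] .
  obtain C0 where C0: "0 \<le> C0" "\<And>r. \<bar>r\<bar> \<le> B \<Longrightarrow> \<bar>F r\<bar> \<le> C0"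
    using continuous_bounded_on_cball[OF cF(1)] by blast
  obtain C1 where C1: "0 \<le> C1" "\<And>r. \<bar>r\<bar> \<le> B \<Longrightarrow> \<bar>F' r\<bar> \<le> C1"
    using continuous_bounded_on_cball[OF cF(2)] by blast
  obtain C2 where C2: "0 \<le> C2" "\<And>r. \<bar>r\<bar> \<le> B \<Longrightarrow> \<bar>F'' r\<bar> \<le> C2"
    using continuous_bounded_on_cball[OF F(3)] by blast
  define D where "D \<theta> x = mehler_velocity d \<theta> u x" for \<theta> x
  obtain E where "\<forall>\<theta>. \<forall>x\<in>Rd d. \<bar>D \<theta> x\<bar> \<le> E * (1 + (\<Sum>i<d. \<bar>x i\<bar>))"
    using mehler_theta_derivative(2)[OF u] unfolding D_def by blast
  then have E: "\<bar>D \<theta> x\<bar> \<le> E * (1 + (\<Sum>i<d. \<bar>x i\<bar>))" if "x \<in> Rd d" for \<theta> x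
    using that by blast
  have sou: "smooth d (mehler d \<theta> u)" for \<theta> by (intro C_b_infinity_smooth C_b_infinity_mehler u)
  have cou: "continuous_on (Rd d) (mehler d \<theta> u)" for \<theta> by (intro smooth_continuous sou)
  have mG: "(\<lambda>x. G (mehler d \<theta> u x)) \<in> borel_measurable \<nu>" if "continuous_on UNIV G"
    for G :: "real \<Rightarrow> real" and \<theta>
    by (intro meas continuous_on_compose2[OF that cou]) simp
  have xs: "integrable \<nu> (\<lambda>x. 1 + (\<Sum>i<d. \<bar>x i\<bar>))"
    using xi by (intro Bochner_Integration.integrable_add Bochner_Integration.integrable_sum
      integrable_abs) auto
  have deriv: "((\<lambda>\<theta>. \<integral>x. F (mehler d \<theta> u x) \<partial>\<nu>)
      has_real_derivative (\<integral>x. F' (mehler d \<theta> u x) * D \<theta> x \<partial>\<nu>)) (at \<theta>)"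
    and int_D: "integrable \<nu> (\<lambda>x. F' (mehler d \<theta> u x) * D \<theta> x)" for \<theta>
  proof -
    note L = has_real_derivative_integral[OF zero_less_one, of \<theta> \<nu> "\<lambda>t x. F (mehler d t u x)"
        "\<lambda>t x. F' (mehler d t u x) * D t x" "\<lambda>x. C1 * (E * (1 + (\<Sum>i<d. \<bar>x i\<bar>)))"]
    have 1: "integrable \<nu> (\<lambda>x. F (mehler d t u x))" for t
      by (rule bounded_integrable[OF finite_measure_axioms mG[OF cF(1)] C0(2)[OF fB]])
    have 2: "((\<lambda>t. F (mehler d t u x)) has_real_derivative F' (mehler d t u x) * D t x) (at t)"
      if "x \<in> space \<nu>" for t x
      using DERIV_chain2[OF F(1) mehler_theta_derivative(1)[OF u], of x t] that
        by (simp add: sp D_def)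
    have 3: "integrable \<nu> (\<lambda>x. C1 * (E * (1 + (\<Sum>i<d. \<bar>x i\<bar>))))" using xs by simp
    have 4: "\<bar>F' (mehler d t u x) * D t x\<bar> \<le> C1 * (E * (1 + (\<Sum>i<d. \<bar>x i\<bar>)))" if "x \<in> space \<nu>"
      for t x
      unfolding abs_mult using C1(1) C1(2)[OF fB[of t x]] E[of x t] that
        by (intro mult_mono) (auto simp: sp)
    show "((\<lambda>\<theta>. \<integral>x. F (mehler d \<theta> u x) \<partial>\<nu>) has_real_derivative (\<integral>x. F' (mehler d \<theta> u x) * D \<theta> x \<partial>\<nu>))
        (at \<theta>)"
      by (rule L(2), rule 1, rule 2, assumption, rule 3, rule 4, assumption)
    show "integrable \<nu> (\<lambda>x. F' (mehler d \<theta> u x) * D \<theta> x)"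
      by (rule L(1), rule 1, rule 2, assumption, rule 3, rule 4, assumption)
  qed
  show "(\<lambda>\<theta>. \<integral>x. F (mehler d \<theta> u x) \<partial>\<nu>) differentiable at \<theta>"
    using deriv real_differentiable_def by blast
  assume pos: "0 < sin \<theta>" "0 < cos \<theta>"
  define w where "w x i = mehler d \<theta> (partial_deriv i u) x" for x i
  define H where "H x i j = mehler d \<theta> (\<lambda>y. hessian u y i j) x" for x i j
  have pdu: "C_b_infinity d (partial_deriv i u)" if "i < d" for i
    by (rule C_b_infinity_partial_deriv[OF u that])
  have hu: "C_b_infinity d (\<lambda>y. hessian u y i j)" if "i < d" "j < d" for i j
    unfolding hessian_def using C_b_infinity_partial_deriv[OF pdu[OF that(2)] that(1)] .
  have wB: "\<exists>b. \<forall>x\<in>Rd d. \<bar>w x i\<bar> \<le> b" and mw: "(\<lambda>x. w x i) \<in> borel_measurable \<nu>" if "i < d" for i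
    using C_b_infinity_bound[OF C_b_infinity_mehler[OF pdu[OF that]]]
      smooth_continuous[OF C_b_infinity_smooth[OF C_b_infinity_mehler[OF pdu[OF that]]]]
    unfolding w_def by (metis, auto intro: meas)
  have HB: "\<exists>b. \<forall>x\<in>Rd d. \<bar>H x i j\<bar> \<le> b" and mH: "(\<lambda>x. H x i j) \<in> borel_measurable \<nu>"
    if "i < d" "j < d" for i j
    using C_b_infinity_bound[OF C_b_infinity_mehler[OF hu[OF that]]]
      smooth_continuous[OF C_b_infinity_smooth[OF C_b_infinity_mehler[OF hu[OF that]]]]
    unfolding H_def by (metis, auto intro: meas)
  have w1: "(\<Sum>i<d. (w x i)\<^sup>2) \<le> 1" if "x \<in> Rd d" for x
    unfolding w_def
    by (rule mehler_gradient_bound) (auto intro: smooth_continuous C_b_infinity_smooth pdu grad)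
  have pd: "partial_deriv i (mehler d \<theta> u) x = cos \<theta> * w x i" if "i < d" "x \<in> Rd d" for i x
    unfolding w_def by (rule partial_deriv_mehler[OF u that])
  have hs: "hessian (mehler d \<theta> u) x i j = (cos \<theta>)\<^sup>2 * H x i j" if "i < d" "j < d" "x \<in> Rd d"
    for i j x
    unfolding H_def by (rule hessian_mehler[OF u that])
  define f where "f x = mehler d \<theta> u x" for x
  let ?\<phi> = "\<lambda>x. F (f x)"
  note HC = hessian_compose[OF F(1,2) sou[of \<theta>], folded f_def]
  have p\<phi>: "partial_deriv i ?\<phi> x = F' (f x) * (cos \<theta> * w x i)" if "i < d" "x \<in> Rd d" for i x
    using HC(1)[OF that(1,1,2)] pd[OF that] by (simp add: f_def[abs_def])
  have h\<phi>: "hessian ?\<phi> x i j = (cos \<theta>)\<^sup>2 * (F'' (f x) * (w x i * w x j) + F' (f x) * H x i j)"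
    if "i < d" "j < d" "x \<in> Rd d" for i j x
    using HC(2)[OF that] pd that hs[OF that]
    by (simp add: f_def[abs_def] power2_eq_square algebra_simps)
  have bounded_mult: "\<exists>b. \<forall>x\<in>Rd d. \<bar>G x * G' x\<bar> \<le> b"
    if "\<exists>b. \<forall>x\<in>Rd d. \<bar>G x\<bar> \<le> b" "\<exists>b. \<forall>x\<in>Rd d. \<bar>G' x\<bar> \<le> b" for G G' :: "(nat \<Rightarrow> real) \<Rightarrow> real"
  proof -
    from that obtain b b' where b: "\<forall>x\<in>Rd d. \<bar>G x\<bar> \<le> b" "\<forall>x\<in>Rd d. \<bar>G' x\<bar> \<le> b'" by blast
    have "\<bar>G x * G' x\<bar> \<le> b * b'" if "x \<in> Rd d" for x
      unfolding abs_mult using b that by (intro mult_mono) (auto intro: order_trans[OF abs_ge_zero])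
    then show ?thesis by blast
  qed
  have bounded_add: "\<exists>b. \<forall>x\<in>Rd d. \<bar>G x + G' x\<bar> \<le> b"
    if "\<exists>b. \<forall>x\<in>Rd d. \<bar>G x\<bar> \<le> b" "\<exists>b. \<forall>x\<in>Rd d. \<bar>G' x\<bar> \<le> b" for G G' :: "(nat \<Rightarrow> real) \<Rightarrow> real"
  proof -
    from that obtain b b' where b: "\<forall>x\<in>Rd d. \<bar>G x\<bar> \<le> b" "\<forall>x\<in>Rd d. \<bar>G' x\<bar> \<le> b'" by blast
    have "\<bar>G x + G' x\<bar> \<le> b + b'" if "x \<in> Rd d" for x
      using b that abs_triangle_ineq[of "G x" "G' x"] by force
    then show ?thesis by blast
  qed
  have bF: "\<exists>b. \<forall>x\<in>Rd d. \<bar>F (f x)\<bar> \<le> b" "\<exists>b. \<forall>x\<in>Rd d. \<bar>F' (f x)\<bar> \<le> b" "\<exists>b. \<forall>x\<in>Rd d. \<bar>F'' (f x)\<bar> \<le> b"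
    using C0(2)[OF fB] C1(2)[OF fB] C2(2)[OF fB] unfolding f_def by blast+
  have "\<exists>K\<ge>0. bounded_to_second_order d ?\<phi> K"
  proof (rule bounded_to_second_orderI)
    show "\<exists>B. \<forall>x\<in>Rd d. \<bar>F (f x)\<bar> \<le> B" by (rule bF)
    have "\<exists>B. \<forall>x\<in>Rd d. \<bar>F' (f x) * (cos \<theta> * w x i)\<bar> \<le> B" if "i < d" for i
      by (intro bounded_mult bF wB that) blast
    then show "\<exists>B. \<forall>x\<in>Rd d. \<bar>partial_deriv i ?\<phi> x\<bar> \<le> B" if "i < d" for i
      using that by (simp add: p\<phi> cong: ball_cong)
    have "\<exists>B. \<forall>x\<in>Rd d. \<bar>(cos \<theta>)\<^sup>2 * (F'' (f x) * (w x i * w x j) + F' (f x) * H x i j)\<bar> \<le> B"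
      if "i < d" "j < d" for i j
      by (intro bounded_mult bounded_add bF wB HB that) blast
    then show "\<exists>B. \<forall>x\<in>Rd d. \<bar>hessian ?\<phi> x i j\<bar> \<le> B" if "i < d" "j < d" for i j
      using that by (simp add: h\<phi> cong: ball_cong)
  qed
  then obtain K where K: "bounded_to_second_order d ?\<phi> K" by blast
  have s\<phi>: "smooth d ?\<phi>" unfolding f_def by (rule F(4)[OF sou])
  have int_mult: "integrable \<nu> (\<lambda>x. G x * h x)"
    if "integrable \<nu> h" "G \<in> borel_measurable \<nu>" "\<exists>b. \<forall>x\<in>Rd d. \<bar>G x\<bar> \<le> b"
      for G h :: "(nat \<Rightarrow> real) \<Rightarrow> real"
  proof -
    from that(3) obtain b where "\<forall>x\<in>Rd d. \<bar>G x\<bar> \<le> b" by blast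
    then show ?thesis
      by (intro integrable_bounded_mult[OF that(1,2), of b]) (simp add: sp)
  qed
  have mF: "(\<lambda>x. F' (f x)) \<in> borel_measurable \<nu>" "(\<lambda>x. F'' (f x)) \<in> borel_measurable \<nu>"
    unfolding f_def using mG[OF cF(2)] mG[OF F(3)] by auto
  \<comment> \<open>Every integrand below is a bounded function times an entry of \<open>\<tau>\<close> or a coordinate of \<open>x\<close>.\<close>
  have i_quad: "integrable \<nu> (\<lambda>x. quadratic_form d (\<tau> x) (w x))"
  proof -
    have "integrable \<nu> (\<lambda>x. (w x i * w x j) * \<tau> x i j)" if "i < d" "j < d" for i j
      by (intro int_mult \<tau> that bounded_mult wB borel_measurable_times mw)
    then show ?thesis unfolding quadratic_form_def
      by (intro Bochner_Integration.integrable_sum) (simp add: mult.commute)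
  qed
  have i_H: "integrable \<nu> (\<lambda>x. hs_inner d (A x) (H x))"
    if "\<And>i j. i < d \<Longrightarrow> j < d \<Longrightarrow> integrable \<nu> (\<lambda>x. A x i j)" for A :: "(nat \<Rightarrow> real) \<Rightarrow> nat \<Rightarrow> nat \<Rightarrow> real"
  proof -
    have "integrable \<nu> (\<lambda>x. H x i j * A x i j)" if "i < d" "j < d" for i j
      by (intro int_mult \<open>\<And>i j. i < d \<Longrightarrow> j < d \<Longrightarrow> integrable \<nu> (\<lambda>x. A x i j)\<close> that HB mH)
    then show ?thesis unfolding hs_inner_def
      by (intro Bochner_Integration.integrable_sum) (simp add: mult.commute)
  qed
  have i_x: "integrable \<nu> (\<lambda>x. \<Sum>i<d. x i * w x i)"
  proof -
    have "integrable \<nu> (\<lambda>x. w x i * x i)" if "i < d" for i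
      by (intro int_mult xi that wB mw)
    then show ?thesis
      by (intro Bochner_Integration.integrable_sum) (simp add: mult.commute)
  qed
  have stein: "(\<integral>x. F' (f x) * (\<Sum>i<d. x i * w x i) \<partial>\<nu>)
      = cos \<theta> * (\<integral>x. F'' (f x) * quadratic_form d (\<tau> x) (w x) + F' (f x)
        * hs_inner d (\<tau> x) (H x) \<partial>\<nu>)"
  proof -
    have "cos \<theta> * (\<integral>x. F' (f x) * (\<Sum>i<d. x i * w x i) \<partial>\<nu>)
        = (\<integral>x. (\<Sum>i<d. x i * partial_deriv i ?\<phi> x) \<partial>\<nu>)"
      unfolding integral_mult_right_zero[symmetric]
      by (intro Bochner_Integration.integral_cong refl)
        (simp add: sp p\<phi> sum_distrib_left mult_ac)
    also have "\<dots> = (\<integral>x. hs_inner d (\<tau> x) (hessian ?\<phi> x) \<partial>\<nu>)"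
      by (rule stein_identity_bounded[OF \<nu> s\<phi> K])
    also have "\<dots> = (cos \<theta>)\<^sup>2 * (\<integral>x. F'' (f x) * quadratic_form d (\<tau> x) (w x) + F' (f x)
        * hs_inner d (\<tau> x) (H x) \<partial>\<nu>)"
      unfolding integral_mult_right_zero[symmetric]
    proof (intro Bochner_Integration.integral_cong refl)
      fix x assume x: "x \<in> space \<nu>"
      have "hs_inner d (\<tau> x) (hessian ?\<phi> x)
          = (\<Sum>i<d. \<Sum>j<d. (cos \<theta>)\<^sup>2 * (F'' (f x) * (\<tau> x i j * (w x i * w x j)) + F' (f x)
            * (\<tau> x i j * H x i j)))"
        unfolding hs_inner_def using x by (intro sum.cong refl) (simp add: sp h\<phi> algebra_simps)
      then show "hs_inner d (\<tau> x) (hessian ?\<phi> x) = (cos \<theta>)\<^sup>2 *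
          (F'' (f x) * quadratic_form d (\<tau> x) (w x) + F' (f x) * hs_inner d (\<tau> x) (H x))"
        by (simp add: quadratic_form_def hs_inner_def[of d "\<tau> x" "H
            x"] sum_distrib_left[symmetric] sum.distrib)
    qed
    finally show ?thesis using pos by (simp add: power2_eq_square)
  qed
  define A where "A x i j = \<tau> x i j - id_mat i j" for x i j
  have iA: "integrable \<nu> (\<lambda>x. A x i j)" if "i < d" "j < d" for i j
    unfolding A_def using \<tau>[OF that] by simp
  have trH: "hs_inner d (A x) (H x) = hs_inner d (\<tau> x) (H x) - (\<Sum>i<d. H x i i)" for x
    by (simp add: hs_inner_def A_def left_diff_distrib sum_subtractf id_mat_def if_distrib[of "\<lambda>y. y
        * _"] cong: if_cong)
  have i_quad': "integrable \<nu> (\<lambda>x. F'' (f x) * quadratic_form d (\<tau> x) (w x))"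
    by (intro int_mult i_quad mF bF)
  have i_tau': "integrable \<nu> (\<lambda>x. F' (f x) * hs_inner d (\<tau> x) (H x))"
    by (intro int_mult i_H \<tau> mF bF)
  have i_A': "integrable \<nu> (\<lambda>x. F' (f x) * hs_inner d (A x) (H x))"
    by (intro int_mult i_H iA mF bF)
  have i_x': "integrable \<nu> (\<lambda>x. F' (f x) * (\<Sum>i<d. x i * w x i))"
    by (intro int_mult i_x mF bF)
  have i_tr': "integrable \<nu> (\<lambda>x. F' (f x) * (\<Sum>i<d. H x i i))"
    using Bochner_Integration.integrable_diff[OF i_tau' i_A'] unfolding trH
      by (simp add: algebra_simps)
  define I_A where "I_A = (\<integral>x. F' (f x) * hs_inner d (A x) (H x) \<partial>\<nu>)"
  define I_\<tau> where "I_\<tau> = (\<integral>x. F' (f x) * hs_inner d (\<tau> x) (H x) \<partial>\<nu>)"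
  define I_tr where "I_tr = (\<integral>x. F' (f x) * (\<Sum>i<d. H x i i) \<partial>\<nu>)"
  define I_quad where "I_quad = (\<integral>x. F'' (f x) * quadratic_form d (\<tau> x) (w x) \<partial>\<nu>)"
  have "I_A = I_\<tau> - I_tr"
    unfolding I_A_def I_\<tau>_def I_tr_def trH right_diff_distrib using i_tau' i_tr' by simp
  have "deriv (\<lambda>\<theta>. \<integral>x. F (mehler d \<theta> u x) \<partial>\<nu>) \<theta> = (\<integral>x. F' (f x) * D \<theta> x \<partial>\<nu>)"
    unfolding f_def by (rule DERIV_imp_deriv[OF deriv])
  also have "\<dots> = (\<integral>x. - sin \<theta> * (F' (f x) * (\<Sum>i<d. x i * w x i))
      + sin \<theta> * cos \<theta> * (F' (f x) * (\<Sum>i<d. H x i i)) \<partial>\<nu>)"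
    unfolding D_def mehler_velocity_def w_def H_def
    by (intro Bochner_Integration.integral_cong refl) (simp add: algebra_simps)
  also have "\<dots> = - sin \<theta> * (\<integral>x. F' (f x) * (\<Sum>i<d. x i * w x i) \<partial>\<nu>) + sin \<theta> * cos \<theta> * I_tr"
    using i_x' i_tr' by (simp add: I_tr_def)
  also have "(\<integral>x. F' (f x) * (\<Sum>i<d. x i * w x i) \<partial>\<nu>) = cos \<theta> * (I_quad + I_\<tau>)"
    unfolding stein I_quad_def I_\<tau>_def using i_quad' i_tau' by simp
  finally have d_eq: "deriv (\<lambda>\<theta>. \<integral>x. F (mehler d \<theta> u x) \<partial>\<nu>) \<theta> =
      - (cos \<theta> * (sin \<theta> * I_A)) - sin \<theta> * cos \<theta> * I_quad"
    unfolding \<open>I_A = I_\<tau> - I_tr\<close> by (simp add: algebra_simps)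
  have i_hs: "integrable \<nu> (\<lambda>x. hs_norm d (A x))"
  proof (rule Bochner_Integration.integrable_bound)
    show "integrable \<nu> (\<lambda>x. \<Sum>i<d. \<Sum>j<d. \<bar>A x i j\<bar>)"
      using iA by (intro Bochner_Integration.integrable_sum integrable_abs) auto
    have "(\<lambda>x. A x i j) \<in> borel_measurable \<nu>" if "i < d" "j < d" for i j
      using iA[OF that] by auto
    then have "(\<lambda>x. hs_inner d (A x) (A x)) \<in> borel_measurable \<nu>"
      unfolding hs_inner_def by (intro borel_measurable_sum borel_measurable_times) auto
    then show "(\<lambda>x. hs_norm d (A x)) \<in> borel_measurable \<nu>"
      unfolding hs_norm_def by measurable
    show "AE x in \<nu>. norm (hs_norm d (A x)) \<le> norm (\<Sum>i<d. \<Sum>j<d. \<bar>A x i j\<bar>)"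
      using hs_norm_le_sum[of d] hs_norm_nonneg[of d] by (intro AE_I2) (simp add: sum_nonneg)
  qed
  have 1: "\<bar>sin \<theta> * I_A\<bar> \<le> (\<integral>x. \<bar>F' (f x)\<bar> * hs_norm d (A x) \<partial>\<nu>)"
  proof -
    have "sin \<theta> * I_A = (\<integral>x. F' (f x) * (sin \<theta> * hs_inner d (A x) (H x)) \<partial>\<nu>)"
      unfolding I_A_def integral_mult_right_zero[symmetric] by (simp add: mult_ac)
    also have "\<bar>\<dots>\<bar> \<le> (\<integral>x. \<bar>F' (f x) * (sin \<theta> * hs_inner d (A x) (H x))\<bar> \<partial>\<nu>)"
      by (rule integral_abs_bound)
    also have "\<dots> \<le> (\<integral>x. \<bar>F' (f x)\<bar> * hs_norm d (A x) \<partial>\<nu>)"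
    proof (rule integral_mono)
      show "integrable \<nu> (\<lambda>x. \<bar>F' (f x) * (sin \<theta> * hs_inner d (A x) (H x))\<bar>)"
        using integrable_mult_right[OF i_A', of "sin \<theta>"] by (simp add: mult_ac)
      show "integrable \<nu> (\<lambda>x. \<bar>F' (f x)\<bar> * hs_norm d (A x))"
        using bF(2) mF by (intro int_mult i_hs) auto
      show "\<bar>F' (f x) * (sin \<theta> * hs_inner d (A x) (H x))\<bar> \<le> \<bar>F' (f x)\<bar> * hs_norm d (A x)" for x
        unfolding abs_mult[of "F' (f x)"] H_def hs_inner_def
        by (intro mult_left_mono mehler_hessian_bound[OF u grad]) auto
    qed
    finally show ?thesis .
  qed
  have 2: "\<bar>I_quad\<bar> \<le> (\<integral>x. \<bar>F'' (f x)\<bar> * \<bar>quadratic_form d (\<tau> x) (w x)\<bar> \<partial>\<nu>)"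
    unfolding I_quad_def abs_mult[symmetric] by (rule integral_abs_bound)
  have "\<bar>deriv (\<lambda>\<theta>. \<integral>x. F (mehler d \<theta> u x) \<partial>\<nu>) \<theta>\<bar>
      \<le> \<bar>cos \<theta> * (sin \<theta> * I_A)\<bar> + \<bar>sin \<theta> * cos \<theta> * I_quad\<bar>"
    unfolding d_eq by linarith
  also have "\<dots> = cos \<theta> * \<bar>sin \<theta> * I_A\<bar> + sin \<theta> * cos \<theta> * \<bar>I_quad\<bar>"
    using pos by (simp add: abs_mult)
  also have "\<dots> \<le> cos \<theta> * (\<integral>x. \<bar>F' (f x)\<bar> * hs_norm d (A x) \<partial>\<nu>)
      + sin \<theta> * cos \<theta> * (\<integral>x. \<bar>F'' (f x)\<bar> * \<bar>quadratic_form d (\<tau> x) (w x)\<bar> \<partial>\<nu>)"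
    using pos by (intro add_mono mult_left_mono 1 2) auto
  finally show "\<bar>deriv (\<lambda>\<theta>. \<integral>x. F (mehler d \<theta> u x) \<partial>\<nu>) \<theta>\<bar> \<le>
        cos \<theta> * (\<integral>x. \<bar>F' (mehler d \<theta> u x)\<bar> * hs_norm d (\<lambda>i j. \<tau> x i j - id_mat i j) \<partial>\<nu>)
      + sin \<theta> * cos \<theta> * (\<integral>x. \<bar>F'' (mehler d \<theta> u x)\<bar> *
           \<bar>quadratic_form d (\<tau> x) (\<lambda>i. mehler d \<theta> (partial_deriv i u) x)\<bar> \<partial>\<nu>)"
    unfolding f_def A_def[abs_def] w_def[abs_def] .
qed

section \<open>The moment bound for smooth functions\<close>

text \<open>
  Hoelder's inequality with exponents \<open>1 / (1 - s)\<close> and \<open>1 / s\<close>. In this form it includes the limiting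
  case \<open>s = 1\<close>, which occurs for \<open>p = 2\<close>. It follows from the weighted inequality between the
  arithmetic and the geometric mean, applied to \<open>a\<close> and \<open>b\<close> normalised to integral \<open>1\<close>.
\<close>

lemma hoelder_interpolation:
  fixes a b :: "'w \<Rightarrow> real"
  assumes s: "0 < s" "s \<le> 1" and a: "integrable M a" "\<And>x. x \<in> space M \<Longrightarrow> 0 < a x" "0 < (\<integral>x. a x \<partial>M)"
    and b: "integrable M b" "\<And>x. 0 \<le> b x" "(\<integral>x. b x \<partial>M) \<le> B"
  shows "integrable M (\<lambda>x. a x powr (1 - s) * b x powr s)"
    and "(\<integral>x. a x powr (1 - s) * b x powr s \<partial>M) \<le> (\<integral>x. a x \<partial>M) powr (1 - s) * B powr s"
proof -
  define A where "A = (\<integral>x. a x \<partial>M)"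
  have A: "0 < A" using a(3) by (simp add: A_def)
  have B: "0 \<le> B" using b Bochner_Integration.integral_nonneg[of M b] order_trans by blast
  have young: "a x powr (1 - s) * b x powr s
      \<le> A powr (1 - s) * l powr s * ((1 - s) * (a x / A) + s * (b x / l))"
    if "0 < l" "x \<in> space M" for x l
  proof (cases "b x = 0")
    case True
    then show ?thesis using a(2)[OF that(2)] s that A by simp
  next
    case False
    then have bx: "0 < b x" using b(2)[of x] by simp
    have "(a x / A) powr (1 - s) * (b x / l) powr s \<le> (1 - s) * (a x / A) + s * (b x / l)"
      using s A a(2)[OF that(2)] that bx by (intro Youngs_inequality_0) auto
    moreover have "(a x / A) powr (1 - s) * (b x / l) powr s
        = (a x powr (1 - s) * b x powr s) / (A powr (1 - s) * l powr s)"
      using A a(2)[OF that(2)] bx that by (simp add: powr_divide)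
    ultimately show ?thesis using A that by (simp add: divide_le_eq mult_ac)
  qed
  have [measurable]: "a \<in> borel_measurable M" "b \<in> borel_measurable M" using a b by auto
  have int_rhs: "integrable M (\<lambda>x. A powr (1 - s) * l powr s
      * ((1 - s) * (a x / A) + s * (b x / l)))" for l
    using a b by simp
  show int: "integrable M (\<lambda>x. a x powr (1 - s) * b x powr s)"
    by (rule Bochner_Integration.integrable_bound[OF int_rhs[of 1]])
      (use young[of 1] in \<open>auto intro!: AE_I2 order_trans[OF _ abs_ge_self]\<close>)
  have bound: "(\<integral>x. a x powr (1 - s) * b x powr s \<partial>M) \<le> A powr (1 - s) * l powr s"
    if l: "0 < l" "B \<le> l" for l
  proof -
    have "(\<integral>x. a x powr (1 - s) * b x powr s \<partial>M)
        \<le> (\<integral>x. A powr (1 - s) * l powr s * ((1 - s) * (a x / A) + s * (b x / l)) \<partial>M)"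
      by (intro integral_mono int int_rhs young l)
    also have "\<dots> = A powr (1 - s) * l powr s * ((1 - s) * (A / A) + s * ((\<integral>x. b x \<partial>M) / l))"
      using a b by (simp add: A_def)
    also have "\<dots> \<le> A powr (1 - s) * l powr s * ((1 - s) * 1 + s * 1)"
      using A l s b(3) by (intro mult_left_mono add_mono) auto
    finally show ?thesis by simp
  qed
  \<comment> \<open>For \<open>B = 0\<close> no normalisation is possible, but then \<open>b\<close> vanishes almost everywhere.\<close>
  show "(\<integral>x. a x powr (1 - s) * b x powr s \<partial>M) \<le> (\<integral>x. a x \<partial>M) powr (1 - s) * B powr s"
  proof (cases "B = 0")
    case False
    then show ?thesis using bound[of B] B by (simp add: A_def)
  next
    case True
    then have "(\<integral>x. b x \<partial>M) = 0" using b Bochner_Integration.integral_nonneg[of M b]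
      by (intro antisym) auto
    then have "AE x in M. b x = 0"
      using integral_nonneg_eq_0_iff_AE[OF b(1)] b(2) by simp
    then have "AE x in M. a x powr (1 - s) * b x powr s = 0" by eventually_elim simp
    then have "(\<integral>x. a x powr (1 - s) * b x powr s \<partial>M) = 0" by (rule integral_eq_zero_AE)
    then show ?thesis by simp
  qed
qed

text \<open>
  Test functions must be smooth, which \<open>\<bar>r - m\<bar>\<^sup>p\<close> is not for general \<open>p\<close>. With \<open>\<epsilon> > 0\<close> the base
  stays away from \<open>0\<close>, so its power is smooth, and letting \<open>\<epsilon>\<close> tend to \<open>0\<close> costs nothing.
\<close>

definition power_profile :: "real \<Rightarrow> real \<Rightarrow> real \<Rightarrow> real \<Rightarrow> real" where
  "power_profile p m \<epsilon> r = ((r - m)\<^sup>2 + \<epsilon>) powr (p / 2)"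

definition power_profile' :: "real \<Rightarrow> real \<Rightarrow> real \<Rightarrow> real \<Rightarrow> real" where
  "power_profile' p m \<epsilon> r = p * (r - m) * ((r - m)\<^sup>2 + \<epsilon>) powr (p / 2 - 1)"

definition power_profile'' :: "real \<Rightarrow> real \<Rightarrow> real \<Rightarrow> real \<Rightarrow> real" where
  "power_profile'' p m \<epsilon> r = p * ((r - m)\<^sup>2 + \<epsilon>) powr (p / 2 - 1)
     + p * (p - 2) * (r - m)\<^sup>2 * ((r - m)\<^sup>2 + \<epsilon>) powr (p / 2 - 2)"

context
  fixes p m \<epsilon> :: real
  assumes p: "p \<ge> 2" and \<epsilon>: "\<epsilon> > 0"
begin

lemma sq_plus_pos: "0 < (r - m)\<^sup>2 + \<epsilon>"
  using \<epsilon> by (simp add: add_nonneg_pos)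

lemma DERIV_sq_plus_powr:
  "((\<lambda>r. ((r - m)\<^sup>2 + \<epsilon>) powr q) has_real_derivative
     q * ((r - m)\<^sup>2 + \<epsilon>) powr (q - 1) * (2 * (r - m))) (at r)"
  by (rule DERIV_chain2[OF has_real_derivative_powr])
    (auto intro!: derivative_eq_intros simp: sq_plus_pos)

lemma DERIV_power_profile:
  "(power_profile p m \<epsilon> has_real_derivative power_profile' p m \<epsilon> r) (at r)"
  unfolding power_profile_def[abs_def] power_profile'_def
  by (rule DERIV_cong[OF DERIV_sq_plus_powr]) simp

lemma DERIV_power_profile':
  "(power_profile' p m \<epsilon> has_real_derivative power_profile'' p m \<epsilon> r) (at r)"
proof -
  have "((\<lambda>r. p * (r - m)) has_real_derivative p) (at r)" by (auto intro!: derivative_eq_intros)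
  note deriv = DERIV_mult[OF this DERIV_sq_plus_powr[of "p / 2 - 1" r]]
  have e: "p / 2 - 1 - 1 = p / 2 - 2" by simp
  have alg: "p * X + (p / 2 - 1) * Y * (2 * a) * (p * a) = p * X + p * (p - 2) * a\<^sup>2 * Y" for X Y a
    by (simp add: algebra_simps power2_eq_square)
  show ?thesis unfolding power_profile'_def[abs_def] power_profile''_def
    using deriv unfolding e alg .
qed

lemma continuous_power_profile'': "continuous_on UNIV (power_profile'' p m \<epsilon>)"
  unfolding power_profile''_def[abs_def]
  by (intro continuous_intros ballI) (use sq_plus_pos in \<open>simp_all add: less_imp_neq[symmetric]\<close>)

lemma smooth_power_profile:
  assumes f: "smooth d f"
  shows "smooth d (\<lambda>x. power_profile p m \<epsilon> (f x))"
  unfolding smooth_def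
proof
  fix k
  \<comment> \<open>The successive derivatives of \<open>s powr (p / 2)\<close>.\<close>
  define D where "D n s = (\<Prod>j<n. p / 2 - real j) * s powr (p / 2 - real n)" for n and s :: real
  have D: "(D n has_real_derivative D (Suc n) s) (at s)" if "s \<in> {0<..}" for n s
    unfolding D_def[abs_def] using that
    by (auto intro!: derivative_eq_intros simp: algebra_simps)
  have cf: "C_diff d k (\<lambda>x. f x + - m)"
    using f unfolding smooth_def by (intro C_diff_add C_diff_const) auto
  have "C_diff d k (\<lambda>x. D 0 ((f x + - m) * (f x + - m) + \<epsilon>))"
  proof (rule C_diff_compose[where D=D and n=0 and U="{0<..}", OF D])
    show "C_diff d k (\<lambda>x. (f x + - m) * (f x + - m) + \<epsilon>)"
      by (intro C_diff_add C_diff_mult C_diff_const cf)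
    show "(f x + - m) * (f x + - m) + \<epsilon> \<in> {0<..}" for x
      using sq_plus_pos[of "f x"] by (simp add: power2_eq_square)
  qed
  then show "C_diff d k (\<lambda>x. power_profile p m \<epsilon> (f x))"
    by (simp add: D_def power_profile_def power2_eq_square)
qed

lemma power_profile_pos: "0 < power_profile p m \<epsilon> r"
  unfolding power_profile_def using sq_plus_pos[of r] by simp

text \<open>
  The powers of the profile on the right-hand sides of this lemma and of the next one are those for
  which Hoelder's inequality returns a power of the integral of the profile.
\<close>

lemma power_profile'_bound: "\<bar>power_profile' p m \<epsilon> r\<bar> \<le> p * power_profile p m \<epsilon> r powr (1 - 1 / p)"
proof -
  let ?q = "(r - m)\<^sup>2 + \<epsilon>"
  have q: "0 < ?q" by (rule sq_plus_pos)
  have "\<bar>r - m\<bar> \<le> sqrt ?q" using \<epsilon> by (intro real_le_rsqrt) simp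
  then have "\<bar>power_profile' p m \<epsilon> r\<bar> \<le> p * (?q powr (1 / 2) * ?q powr (p / 2 - 1))"
    using p q unfolding power_profile'_def abs_mult
    by (simp add: powr_half_sqrt mult.assoc mult_right_mono)
  also have "?q powr (1 / 2) * ?q powr (p / 2 - 1) = power_profile p m \<epsilon> r powr (1 - 1 / p)"
  proof -
    have e: "1 / 2 + (p / 2 - 1) = p / 2 * (1 - 1 / p)" using p by (simp add: field_simps)
    show ?thesis unfolding power_profile_def powr_powr powr_add[symmetric] e ..
  qed
  finally show ?thesis .
qed

lemma power_profile''_bound:
  "\<bar>power_profile'' p m \<epsilon> r\<bar> \<le> p * (p - 1) * power_profile p m \<epsilon> r powr (1 - 2 / p)"
proof -
  let ?q = "(r - m)\<^sup>2 + \<epsilon>"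
  have q: "0 < ?q" by (rule sq_plus_pos)
  have eq: "?q * ?q powr (p / 2 - 2) = ?q powr (p / 2 - 1)"
    using powr_add[of ?q 1 "p / 2 - 2"] q by simp
  have "p * (p - 2) * (r - m)\<^sup>2 * ?q powr (p / 2 - 2) \<le> p * (p - 2) * ?q * ?q powr (p / 2 - 2)"
    using p \<epsilon> by (intro mult_right_mono mult_left_mono) auto
  then have "p * (p - 2) * (r - m)\<^sup>2 * ?q powr (p / 2 - 2) \<le> p * (p - 2) * ?q powr (p / 2 - 1)"
    by (simp add: eq mult.assoc)
  moreover have "0 \<le> p * (p - 2) * (r - m)\<^sup>2 * ?q powr (p / 2 - 2)" using p by simp
  moreover have "0 \<le> p * ?q powr (p / 2 - 1)" using p by simp
  ultimately have "\<bar>power_profile'' p m \<epsilon> r\<bar>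
      \<le> p * ?q powr (p / 2 - 1) + p * (p - 2) * ?q powr (p / 2 - 1)"
    unfolding power_profile''_def by linarith
  also have "\<dots> = p * (p - 1) * ?q powr (p / 2 - 1)" by (simp add: algebra_simps)
  also have "?q powr (p / 2 - 1) = power_profile p m \<epsilon> r powr (1 - 2 / p)"
  proof -
    have e: "p / 2 - 1 = p / 2 * (1 - 2 / p)" using p by (simp add: field_simps)
    show ?thesis unfolding power_profile_def powr_powr e ..
  qed
  finally show ?thesis .
qed

lemma power_profile_ge: "\<bar>r - m\<bar> powr p \<le> power_profile p m \<epsilon> r"
proof -
  have "\<bar>r - m\<bar> powr p = ((r - m)\<^sup>2) powr (p / 2)"
    using powr_powr[of "\<bar>r - m\<bar>" 2 "p / 2"] p by (cases "r = m") auto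
  also have "\<dots> \<le> power_profile p m \<epsilon> r"
    unfolding power_profile_def using p \<epsilon> by (intro powr_mono2) auto
  finally show ?thesis .
qed

end

lemma quadratic_inequality_bound:
  fixes y a b e :: real
  assumes "y\<^sup>2 \<le> e + 2 * a * y + b" "0 \<le> a" "0 \<le> b" "0 \<le> e"
  shows "y \<le> 2 * a + sqrt e + sqrt b"
proof -
  have "(y - a)\<^sup>2 \<le> e + b + a\<^sup>2" using assms by (simp add: power2_eq_square algebra_simps)
  also have "\<dots> \<le> (sqrt e + sqrt b + a)\<^sup>2"
    using assms by (simp add: power2_sum)
  finally have "y - a \<le> sqrt e + sqrt b + a"
    by (rule power2_le_imp_le) (use assms in simp)
  then show ?thesis by simp
qed

lemma mehler_half_pi: 
  assumes "continuous_on (Rd d) u"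
  shows "mehler d (pi / 2) u x = (\<integral>z. u z \<partial>gauss d)"
  unfolding mehler_eq
proof (intro Bochner_Integration.integral_cong refl)
  fix z assume "z \<in> space (gauss d)"
  then have "lincomb d (cos (pi / 2)) x (sin (pi / 2)) z = z"
    by (intro Rd_eqI[of _ d]) (auto simp: space_gauss)
  then show "u (lincomb d (cos (pi / 2)) x (sin (pi / 2)) z) = u z" by simp
qed

lemma mehler_0:
  assumes "x \<in> Rd d"
  shows "mehler d 0 u x = u x"
proof -
  interpret prob_space "gauss d" by (rule prob_space_gauss)
  have "lincomb d (cos 0) x (sin 0) z = x" for z
    using assms by (intro Rd_eqI[of _ d]) auto
  then show ?thesis by (simp add: mehler_eq prob_space)
qed

text \<open>
  Here \<open>g = \<Phi>\<^bsup>2/p\<^esup>\<close> satisfies \<open>\<bar>g'\<bar> \<le> 2 S\<^bsup>1/p\<^esup> cos \<theta> \<surd>g + 2 (p-1) T\<^bsup>2/p\<^esup> sin \<theta> cos \<theta>\<close>. If \<open>M\<close> is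
  the maximum of \<open>g\<close>, attained at \<open>t\<close>, then \<open>\<surd>g \<le> \<surd>M\<close> makes the right-hand side explicitly
  integrable, and \<open>g(\<pi>/2) = \<epsilon>\<close> leads to the quadratic inequality
  \<open>M \<le> \<epsilon> + 2 S\<^bsup>1/p\<^esup> \<surd>M + (p-1) T\<^bsup>2/p\<^esup>\<close> for \<open>\<surd>M\<close>. Working with the maximum instead of an explicit
  solution of the differential inequality costs only the factor \<open>2\<close> in front of \<open>S\<^bsup>1/p\<^esup>\<close>.
\<close>

lemma smooth_moment_bound_eps:
  assumes \<nu>: "prob_space \<nu>" "sets \<nu> = sets (borel_Rd d)" "centered d \<nu>" "stein_kernel d \<nu> \<tau>"
    and u: "C_b_infinity d u" "lipschitz1 d u" and p: "p \<ge> 2" and \<epsilon>: "\<epsilon> > 0"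
    and S: "integrable \<nu> (\<lambda>x. hs_norm d (\<lambda>i j. \<tau> x i j - id_mat i j) powr p)"
      "(\<integral>x. hs_norm d (\<lambda>i j. \<tau> x i j - id_mat i j) powr p \<partial>\<nu>) \<le> S"
    and T: "0 \<le> T" "(\<integral>\<^sup>+x. ennreal (op_norm d (\<tau> x) powr (p / 2)) \<partial>\<nu>) \<le> ennreal T"
  shows "(\<integral>x. \<bar>u x - (\<integral>z. u z \<partial>gauss d)\<bar> powr p \<partial>\<nu>)
           \<le> (2 * S powr (1 / p) + sqrt \<epsilon> + sqrt p * T powr (1 / p)) powr p"
proof -
  interpret prob_space \<nu> by fact
  have sp: "space \<nu> = Rd d" using sets_eq_imp_space_eq[OF \<nu>(2)] by (simp add: space_borel_Rd)
  define m where "m = (\<integral>z. u z \<partial>gauss d)"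
  have cu: "continuous_on (Rd d) u" by (intro smooth_continuous C_b_infinity_smooth u)
  have grad: "(\<Sum>i<d. (partial_deriv i u x)\<^sup>2) \<le> 1" if "x \<in> Rd d" for x
    using lipschitz1_gradient_bound[OF u(2) _ that] C_b_infinity_smooth[OF u(1)]
    unfolding smooth_def by blast
  let ?F = "power_profile p m \<epsilon>" and ?F' = "power_profile' p m \<epsilon>" and ?F'' = "power_profile'' p m \<epsilon>"
  define \<Phi> where "\<Phi> \<theta> = (\<integral>x. ?F (mehler d \<theta> u x) \<partial>\<nu>)" for \<theta>
  note flow = mehler_flow_derivative_bound[OF \<nu> u(1) grad DERIV_power_profile[OF p \<epsilon>, of m]
      DERIV_power_profile'[OF p \<epsilon>, of m] continuous_power_profile''[OF p \<epsilon>, of m]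
      smooth_power_profile[OF p \<epsilon>, of _ _ m], folded \<Phi>_def]
  have d\<Phi>: "(\<Phi> has_real_derivative deriv \<Phi> \<theta>) (at \<theta>)" for \<theta>
    using flow(1)[of \<theta>] by (simp add: DERIV_deriv_iff_real_differentiable \<Phi>_def[abs_def])
  obtain B where B: "0 \<le> B" "\<And>x. x \<in> Rd d \<Longrightarrow> \<bar>u x\<bar> \<le> B" using C_b_infinity_bound[OF u(1)] by blast
  have cont_F: "continuous_on UNIV ?F" using DERIV_power_profile[OF p \<epsilon>]
    by (auto intro!: DERIV_isCont continuous_at_imp_continuous_on)
  obtain C0 where C0: "0 \<le> C0" "\<And>r. \<bar>r\<bar> \<le> B \<Longrightarrow> \<bar>?F r\<bar> \<le> C0"
    using continuous_bounded_on_cball[OF cont_F] by blast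
  have cou: "continuous_on (Rd d) (mehler d \<theta> u)" for \<theta>
    by (intro smooth_continuous C_b_infinity_smooth C_b_infinity_mehler u)
  have mF: "(\<lambda>x. ?F (mehler d \<theta> u x)) \<in> borel_measurable \<nu>" for \<theta>
    by (intro continuous_on_Rd_measurable[OF _ \<nu>(2)] continuous_on_compose2[OF cont_F cou]) simp
  have iF: "integrable \<nu> (\<lambda>x. ?F (mehler d \<theta> u x))" for \<theta>
    by (rule bounded_integrable[OF finite_measure_axioms mF C0(2)[OF mehler_bound[OF cu B(2)]]])
  have \<Phi>_pos: "0 < \<Phi> \<theta>" for \<theta>
  proof -
    have "0 < (\<integral>x. \<epsilon> powr (p / 2) \<partial>\<nu>)" using \<epsilon> by (simp add: prob_space)
    also have "\<dots> \<le> \<Phi> \<theta>" unfolding \<Phi>_def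
      by (intro integral_mono iF) (use \<epsilon> p in \<open>auto simp: power_profile_def intro!: powr_mono2\<close>)
    finally show ?thesis .
  qed
  define Sg where "Sg = S powr (1 / p)"
  define Tt where "Tt = T powr (2 / p)"
  have nonneg: "0 \<le> Sg" "0 \<le> Tt" by (auto simp: Sg_def Tt_def)
  define hs where "hs x = hs_norm d (\<lambda>i j. \<tau> x i j - id_mat i j)" for x
  have hs0: "0 \<le> hs x" for x by (simp add: hs_def hs_norm_nonneg)
  have bound1: "(\<integral>x. \<bar>?F' (mehler d \<theta> u x)\<bar> * hs x \<partial>\<nu>) \<le> p * (\<Phi> \<theta> powr (1 - 1 / p) * Sg)" for \<theta>
  proof -
    note H = hoelder_interpolation[of "1 / p" \<nu> "\<lambda>x. ?F (mehler d \<theta> u x)" "\<lambda>x. hs x powr p" S]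
    have H1: "integrable \<nu> (\<lambda>x. ?F (mehler d \<theta> u x) powr (1 - 1 / p) * (hs x powr p) powr (1 / p))"
      and H2: "(\<integral>x. ?F (mehler d \<theta> u x) powr (1 - 1 / p) * (hs x powr p) powr (1 / p) \<partial>\<nu>)
        \<le> \<Phi> \<theta> powr (1 - 1 / p) * S powr (1 / p)"
      using H p iF[of \<theta>] power_profile_pos[OF p \<epsilon>] \<Phi>_pos[of \<theta>] S unfolding \<Phi>_def hs_def by auto
    have e: "(hs x powr p) powr (1 / p) = hs x" for x
      using p hs0[of x] by (simp add: powr_powr)
    have "(\<integral>x. \<bar>?F' (mehler d \<theta> u x)\<bar> * hs x \<partial>\<nu>)
        \<le> (\<integral>x. p * (?F (mehler d \<theta> u x) powr (1 - 1 / p) * (hs x powr p) powr (1 / p)) \<partial>\<nu>)"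
    proof (rule integral_mono')
      show "integrable \<nu> (\<lambda>x. p * (?F (mehler d \<theta> u x) powr (1 - 1 / p)
          * (hs x powr p) powr (1 / p)))"
        using H1 by simp
      show "\<bar>?F' (mehler d \<theta> u x)\<bar> * hs x
          \<le> p * (?F (mehler d \<theta> u x) powr (1 - 1 / p) * (hs x powr p) powr (1 / p))" for x
        using mult_right_mono[OF power_profile'_bound[OF p \<epsilon>, of m "mehler d \<theta> u x"] hs0[of x]]
        by (simp add: e mult.assoc)
    qed (use p hs0 in auto)
    also have "\<dots> \<le> p * (\<Phi> \<theta> powr (1 - 1 / p) * Sg)"
      using H2 p by (simp add: Sg_def)
    finally show ?thesis .
  qed
  define w where "w \<theta> x i = mehler d \<theta> (partial_deriv i u) x" for \<theta> x i
  \<comment> \<open>The operator norm is a supremum of uncountably many functions of \<open>x\<close>. It enters only as an upper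
    bound for the visibly measurable function \<open>Q\<close>, to which Hoelder's inequality is applied.\<close>
  define Q where "Q \<theta> x = \<bar>quadratic_form d (\<tau> x) (w \<theta> x)\<bar>" for \<theta> x
  have cpd: "continuous_on (Rd d) (partial_deriv i u)" if "i < d" for i
    by (intro smooth_continuous C_b_infinity_smooth C_b_infinity_partial_deriv u that)
  have Q_op: "Q \<theta> x \<le> op_norm d (\<tau> x)" for \<theta> x
    unfolding Q_def w_def by (intro quadratic_form_le_op_norm mehler_gradient_bound cpd grad)
  have mQ: "Q \<theta> \<in> borel_measurable \<nu>" for \<theta>
  proof -
    have "(\<lambda>x. w \<theta> x i) \<in> borel_measurable \<nu>" if "i < d" for i
      unfolding w_def
      by (intro continuous_on_Rd_measurable[OF _ \<nu>(2)] smooth_continuous C_b_infinity_smooth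
          C_b_infinity_mehler C_b_infinity_partial_deriv u that)
    moreover have "(\<lambda>x. \<tau> x i j) \<in> borel_measurable \<nu>" if "i < d" "j < d" for i j
      using \<nu>(4) that unfolding stein_kernel_def by (blast intro: borel_measurable_integrable)
    ultimately have "(\<lambda>x. quadratic_form d (\<tau> x) (w \<theta> x)) \<in> borel_measurable \<nu>"
      unfolding quadratic_form_def by (intro borel_measurable_sum borel_measurable_times) auto
    then show ?thesis unfolding Q_def[abs_def] by measurable
  qed
  have iQ: "integrable \<nu> (\<lambda>x. Q \<theta> x powr (p / 2))" "(\<integral>x. Q \<theta> x powr (p / 2) \<partial>\<nu>) \<le> T" for \<theta>
  proof -
    have m: "(\<lambda>x. Q \<theta> x powr (p / 2)) \<in> borel_measurable \<nu>" using mQ by measurable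
    have "(\<integral>\<^sup>+x. ennreal (Q \<theta> x powr (p / 2)) \<partial>\<nu>)
        \<le> (\<integral>\<^sup>+x. ennreal (op_norm d (\<tau> x) powr (p / 2)) \<partial>\<nu>)"
      using Q_op p by (intro nn_integral_mono ennreal_leI powr_mono2) (auto simp: Q_def)
    also note T(2)
    finally have le: "(\<integral>\<^sup>+x. ennreal (Q \<theta> x powr (p / 2)) \<partial>\<nu>) \<le> ennreal T" .
    then show i: "integrable \<nu> (\<lambda>x. Q \<theta> x powr (p / 2))"
      using m by (intro integrableI_bounded) (auto simp: le_less_trans)
    show "(\<integral>x. Q \<theta> x powr (p / 2) \<partial>\<nu>) \<le> T"
      using le nn_integral_eq_integral[OF i] T(1) by simp
  qed
  have bound2: "(\<integral>x. \<bar>?F'' (mehler d \<theta> u x)\<bar> * Q \<theta> x \<partial>\<nu>)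
      \<le> p * (p - 1) * (\<Phi> \<theta> powr (1 - 2 / p) * Tt)" for \<theta>
  proof -
    note H = hoelder_interpolation[of "2 / p" \<nu> "\<lambda>x. ?F (mehler d \<theta> u x)" "\<lambda>x. Q \<theta> x powr
        (p / 2)" T]
    have H1: "integrable \<nu> (\<lambda>x. ?F (mehler d \<theta> u x) powr (1 - 2 / p)
        * (Q \<theta> x powr (p / 2)) powr (2 / p))"
      and H2: "(\<integral>x. ?F (mehler d \<theta> u x) powr (1 - 2 / p) * (Q \<theta> x powr (p / 2)) powr (2 / p) \<partial>\<nu>)
        \<le> \<Phi> \<theta> powr (1 - 2 / p) * T powr (2 / p)"
      using H p iF[of \<theta>] power_profile_pos[OF p \<epsilon>] \<Phi>_pos[of \<theta>] iQ[of \<theta>] unfolding \<Phi>_def by auto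
    have Q0: "0 \<le> Q \<theta> x" for x by (simp add: Q_def)
    have e: "(Q \<theta> x powr (p / 2)) powr (2 / p) = Q \<theta> x" for x
      using p Q0[of x] by (simp add: powr_powr)
    have "(\<integral>x. \<bar>?F'' (mehler d \<theta> u x)\<bar> * Q \<theta> x \<partial>\<nu>)
        \<le> (\<integral>x. p * (p - 1) * (?F (mehler d \<theta> u x) powr (1 - 2 / p)
          * (Q \<theta> x powr (p / 2)) powr (2 / p)) \<partial>\<nu>)"
    proof (rule integral_mono')
      show "integrable \<nu> (\<lambda>x. p * (p - 1)
          * (?F (mehler d \<theta> u x) powr (1 - 2 / p) * (Q \<theta> x powr (p / 2)) powr (2 / p)))"
        using H1 by simp
      show "\<bar>?F'' (mehler d \<theta> u x)\<bar> * Q \<theta> x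
          \<le> p * (p - 1) * (?F (mehler d \<theta> u x) powr (1 - 2 / p)
          * (Q \<theta> x powr (p / 2)) powr (2 / p))" for x
        using mult_right_mono[OF power_profile''_bound[OF p \<epsilon>, of m "mehler d \<theta> u x"] Q0[of x]]
        by (simp add: e mult.assoc)
    qed (use p Q0 in auto)
    also have "\<dots> \<le> p * (p - 1) * (\<Phi> \<theta> powr (1 - 2 / p) * Tt)"
      using H2 p by (simp add: Tt_def mult_left_mono)
    finally show ?thesis .
  qed
  define g where "g \<theta> = \<Phi> \<theta> powr (2 / p)" for \<theta>
  have dg: "(g has_real_derivative (2 / p) * \<Phi> \<theta> powr (2 / p - 1) * deriv \<Phi> \<theta>) (at \<theta>)" for \<theta>
    unfolding g_def[abs_def]
    by (rule DERIV_chain2[OF has_real_derivative_powr[OF \<Phi>_pos] d\<Phi>])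
  have dg_bound: "\<bar>(2 / p) * \<Phi> \<theta> powr (2 / p - 1) * deriv \<Phi> \<theta>\<bar>
      \<le> 2 * cos \<theta> * sqrt (g \<theta>) * Sg + 2 * (p - 1) * Tt * sin \<theta> * cos \<theta>"
    if pos: "0 < sin \<theta>" "0 < cos \<theta>" for \<theta>
  proof -
    let ?P = "\<Phi> \<theta>"
    have "\<bar>deriv \<Phi> \<theta>\<bar> \<le> cos \<theta> * (\<integral>x. \<bar>?F' (mehler d \<theta> u x)\<bar> * hs x \<partial>\<nu>)
        + sin \<theta> * cos \<theta> * (\<integral>x. \<bar>?F'' (mehler d \<theta> u x)\<bar> * Q \<theta> x \<partial>\<nu>)"
      unfolding hs_def Q_def w_def[abs_def] by (rule flow(2)[OF _ _ pos])
    also have "\<dots> \<le> cos \<theta> * (p * (?P powr (1 - 1 / p) * Sg))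
        + sin \<theta> * cos \<theta> * (p * (p - 1) * (?P powr (1 - 2 / p) * Tt))"
      using pos by (intro add_mono mult_left_mono bound1 bound2) auto
    finally have "\<bar>deriv \<Phi> \<theta>\<bar> \<le> cos \<theta> * (p * (?P powr (1 - 1 / p) * Sg))
        + sin \<theta> * cos \<theta> * (p * (p - 1) * (?P powr (1 - 2 / p) * Tt))" .
    then have "(2 / p * ?P powr (2 / p - 1)) * \<bar>deriv \<Phi> \<theta>\<bar> \<le> (2 / p * ?P powr (2 / p - 1)) *
        (cos \<theta> * (p * (?P powr (1 - 1 / p) * Sg))
        + sin \<theta> * cos \<theta> * (p * (p - 1) * (?P powr (1 - 2 / p) * Tt)))"
      using p by (intro mult_left_mono) auto
    also have "\<dots> = 2 * cos \<theta> * (?P powr (2 / p - 1) * ?P powr (1 - 1 / p)) * Sg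
        + 2 * (p - 1) * Tt * sin \<theta> * cos \<theta> * (?P powr (2 / p - 1) * ?P powr (1 - 2 / p))"
      using p by (simp add: field_simps)
    also have "?P powr (2 / p - 1) * ?P powr (1 - 1 / p) = sqrt (g \<theta>)"
      using p \<Phi>_pos[of \<theta>] by (simp add: g_def powr_add[symmetric] powr_half_sqrt[symmetric]
        powr_powr diff_divide_distrib[symmetric])
    also have "?P powr (2 / p - 1) * ?P powr (1 - 2 / p) = 1"
      using \<Phi>_pos[of \<theta>] by (simp add: powr_add[symmetric])
    finally show ?thesis using p by (simp add: abs_mult)
  qed
  have cont_g: "continuous_on {0..pi/2} g"
    using dg by (meson DERIV_isCont continuous_at_imp_continuous_on)
  obtain t where t: "t \<in> {0..pi/2}" "\<And>\<theta>. \<theta> \<in> {0..pi/2} \<Longrightarrow> g \<theta> \<le> g t"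
    using continuous_attains_sup[OF compact_Icc _ cont_g] by auto
  define M where "M = g t"
  have M0: "0 \<le> M" by (simp add: M_def g_def)
  \<comment> \<open>The added terms are primitives of the bound for \<open>\<bar>g'\<bar>\<close>, so \<open>k\<close> is nondecreasing.\<close>
  define k where "k \<theta> = g \<theta> + 2 * sqrt M * Sg * sin \<theta> + (p - 1) * Tt * (sin \<theta>)\<^sup>2" for \<theta>
  have dk: "(k has_real_derivative (2 / p) * \<Phi> \<theta> powr (2 / p - 1) * deriv \<Phi> \<theta>
      + 2 * sqrt M * Sg * cos \<theta> + (p - 1) * Tt * (2 * sin \<theta> * cos \<theta>)) (at \<theta>)" for \<theta>
    unfolding k_def[abs_def] by (auto intro!: derivative_eq_intros dg)
  have "k t \<le> k (pi / 2)"
  proof (cases "t = pi / 2")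
    case False
    with t(1) have "t < pi / 2" by simp
    from MVT2[OF this dk] obtain \<theta> where \<theta>: "t < \<theta>" "\<theta> < pi / 2"
      "k (pi / 2) - k t = (pi / 2 - t) * ((2 / p) * \<Phi> \<theta> powr (2 / p - 1) * deriv \<Phi> \<theta>
        + 2 * sqrt M * Sg * cos \<theta> + (p - 1) * Tt * (2 * sin \<theta> * cos \<theta>))" by blast
    have pos: "0 < sin \<theta>" "0 < cos \<theta>" using t(1) \<theta> by (auto intro!: sin_gt_zero cos_gt_zero)
    have "2 * cos \<theta> * sqrt (g \<theta>) * Sg \<le> 2 * cos \<theta> * sqrt M * Sg"
      using t(2)[of \<theta>] t(1) \<theta> pos nonneg unfolding M_def
        by (intro mult_right_mono mult_left_mono) auto
    then have "0 \<le> (2 / p) * \<Phi> \<theta> powr (2 / p - 1) * deriv \<Phi> \<theta>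
        + 2 * sqrt M * Sg * cos \<theta> + (p - 1) * Tt * (2 * sin \<theta> * cos \<theta>)"
      using dg_bound[OF pos] unfolding abs_le_iff by (simp add: mult_ac)
    then show ?thesis using \<theta> by (smt (verit) mult_nonneg_nonneg)
  next
    case True
    show ?thesis unfolding True ..
  qed
  moreover have "g (pi / 2) = \<epsilon>"
    using p \<epsilon> by (simp add: g_def \<Phi>_def mehler_half_pi[OF cu] m_def[symmetric] power_profile_def
      prob_space powr_powr)
  moreover have "0 \<le> 2 * sqrt M * Sg * sin t + (p - 1) * Tt * (sin t)\<^sup>2"
    using t(1) p M0 nonneg by (intro add_nonneg_nonneg mult_nonneg_nonneg sin_ge_zero) auto
  ultimately have "(sqrt M)\<^sup>2 \<le> \<epsilon> + 2 * Sg * sqrt M + (p - 1) * Tt"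
    using M0 by (simp add: k_def M_def algebra_simps)
  then have "sqrt M \<le> 2 * Sg + sqrt \<epsilon> + sqrt ((p - 1) * Tt)"
    using nonneg p \<epsilon> by (intro quadratic_inequality_bound) auto
  also have "sqrt ((p - 1) * Tt) \<le> sqrt (p * Tt)"
    using nonneg p by (intro real_sqrt_le_mono mult_right_mono) auto
  also have "sqrt (p * Tt) = sqrt p * T powr (1 / p)"
    using T(1) p by (simp add: real_sqrt_mult Tt_def powr_half_sqrt[symmetric] powr_powr)
  finally have M_le: "sqrt M \<le> 2 * Sg + sqrt \<epsilon> + sqrt p * T powr (1 / p)" by simp
  have "(\<integral>x. \<bar>u x - m\<bar> powr p \<partial>\<nu>) \<le> \<Phi> 0"
    unfolding \<Phi>_def
  proof (rule integral_mono')
    show "\<bar>u x - m\<bar> powr p \<le> ?F (mehler d 0 u x)" if "x \<in> space \<nu>" for x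
      using power_profile_ge[OF p \<epsilon>] that by (simp add: sp mehler_0)
  qed (use iF power_profile_pos[OF p \<epsilon>, of m, THEN less_imp_le] in auto)
  also have "\<Phi> 0 = sqrt (g 0) powr p"
    using p \<Phi>_pos[of 0] by (simp add: g_def powr_half_sqrt[symmetric] powr_powr)
  also have "\<dots> \<le> (2 * Sg + sqrt \<epsilon> + sqrt p * T powr (1 / p)) powr p"
  proof (rule powr_mono2)
    have "sqrt (g 0) \<le> sqrt M" using t(2)[of 0] by (simp add: M_def)
    then show "sqrt (g 0) \<le> 2 * Sg + sqrt \<epsilon> + sqrt p * T powr (1 / p)" using M_le by linarith
  qed (use p in \<open>auto simp: g_def\<close>)
  finally show ?thesis by (simp add: m_def Sg_def)
qed

lemma smooth_moment_bound:
  assumes \<nu>: "prob_space \<nu>" "sets \<nu> = sets (borel_Rd d)" "centered d \<nu>" "stein_kernel d \<nu> \<tau>"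
    and u: "C_b_infinity d u" "lipschitz1 d u" and p: "p \<ge> 2"
    and S: "integrable \<nu> (\<lambda>x. hs_norm d (\<lambda>i j. \<tau> x i j - id_mat i j) powr p)"
      "(\<integral>x. hs_norm d (\<lambda>i j. \<tau> x i j - id_mat i j) powr p \<partial>\<nu>) \<le> S"
    and T: "0 \<le> T" "(\<integral>\<^sup>+x. ennreal (op_norm d (\<tau> x) powr (p / 2)) \<partial>\<nu>) \<le> ennreal T"
  shows "(\<integral>x. \<bar>u x - (\<integral>z. u z \<partial>gauss d)\<bar> powr p \<partial>\<nu>)
           \<le> (2 * S powr (1 / p) + sqrt p * T powr (1 / p)) powr p"
proof (rule tendsto_lowerbound)
  have "((\<lambda>e. 2 * S powr (1 / p) + sqrt e + sqrt p * T powr (1 / p)) \<longlongrightarrow> 2 * S powr (1 / p) + sqrt 0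
      + sqrt p * T powr (1 / p)) (at_right 0)"
    by (intro tendsto_intros)
  then show "((\<lambda>e. (2 * S powr (1 / p) + sqrt e + sqrt p * T powr (1 / p)) powr p)
      \<longlongrightarrow> (2 * S powr (1 / p) + sqrt p * T powr (1 / p)) powr p) (at_right 0)"
    using p by (intro tendsto_powr2) (auto simp: eventually_at_filter intro!: always_eventually)
  show "\<forall>\<^sub>F e in at_right 0. (\<integral>x. \<bar>u x - (\<integral>z. u z \<partial>gauss d)\<bar> powr p \<partial>\<nu>)
      \<le> (2 * S powr (1 / p) + sqrt e + sqrt p * T powr (1 / p)) powr p"
    using smooth_moment_bound_eps[OF \<nu> u p _ S T] by (auto simp: eventually_at_filter)
qed simp

section \<open>Mollification of Lipschitz functions\<close>

definition lebesgue_Rd :: "nat \<Rightarrow> (nat \<Rightarrow> real) measure" where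
  "lebesgue_Rd d = Pi\<^sub>M {..<d} (\<lambda>_. lborel)"

lemma sets_lebesgue_Rd: "sets (lebesgue_Rd d) = sets (borel_Rd d)"
  unfolding lebesgue_Rd_def borel_Rd_def by (intro sets_PiM_cong) auto

lemma space_lebesgue_Rd: "space (lebesgue_Rd d) = Rd d"
  using sets_eq_imp_space_eq[OF sets_lebesgue_Rd] by (simp add: space_borel_Rd)

lemma product_sigma_finite_lborel: "product_sigma_finite (\<lambda>_::nat. lborel :: real measure)"
  unfolding product_sigma_finite_def by (intro allI sigma_finite_lborel)

lemma emeasure_lebesgue_Rd_PiE:
  "(\<And>i. i < d \<Longrightarrow> A i \<in> sets borel) \<Longrightarrow> emeasure (lebesgue_Rd d) (PiE {..<d} A)
      = (\<Prod>i<d. emeasure lborel (A i))"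
  unfolding lebesgue_Rd_def
  by (subst product_sigma_finite.emeasure_PiM[OF product_sigma_finite_lborel]) auto

lemma lebesgue_Rd_box:
  fixes x :: "nat \<Rightarrow> real"
  assumes "0 \<le> r"
  shows "PiE {..<d} (\<lambda>i. {x i - r..x i + r}) \<in> sets (lebesgue_Rd d)"
    and "emeasure (lebesgue_Rd d) (PiE {..<d} (\<lambda>i. {x i - r..x i + r})) = ennreal ((2 * r) ^ d)"
proof -
  show "PiE {..<d} (\<lambda>i. {x i - r..x i + r}) \<in> sets (lebesgue_Rd d)"
    unfolding lebesgue_Rd_def by (rule sets_PiM_I_finite) auto
  show "emeasure (lebesgue_Rd d) (PiE {..<d} (\<lambda>i. {x i - r..x i + r})) = ennreal ((2 * r) ^ d)"
    using assms by (subst emeasure_lebesgue_Rd_PiE) (auto simp: ennreal_power)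
qed

lemma measurable_translate_lebesgue_Rd: "(\<lambda>z. lincomb d 1 x 1 z) \<in> measurable (lebesgue_Rd d)
    (lebesgue_Rd d)"
  unfolding lebesgue_Rd_def lincomb_def by measurable

text \<open>
  Translation invariance is checked on boxes, where it reduces to that of Lebesgue measure on the
  line.
\<close>

lemma distr_translate_lebesgue_Rd: "distr (lebesgue_Rd d) (lebesgue_Rd d) (\<lambda>z. lincomb d 1 x 1 z)
    = lebesgue_Rd d"
proof -
  have "distr (lebesgue_Rd d) (lebesgue_Rd d) (\<lambda>z. lincomb d 1 x 1 z) = Pi\<^sub>M {..<d} (\<lambda>_. lborel)"
  proof (rule product_sigma_finite.PiM_eqI[OF product_sigma_finite_lborel])
    show "sets (distr (lebesgue_Rd d) (lebesgue_Rd d) (\<lambda>z. lincomb d 1 x 1 z))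
        = sets (Pi\<^sub>M {..<d} (\<lambda>_. lborel))"
      by (simp add: lebesgue_Rd_def)
    fix A :: "nat \<Rightarrow> real set" assume A: "\<And>i. i \<in> {..<d} \<Longrightarrow> A i \<in> sets lborel"
    have PA: "PiE {..<d} A \<in> sets (lebesgue_Rd d)" unfolding lebesgue_Rd_def using A
      by (intro sets_PiM_I_finite) auto
    have vim: "(\<lambda>z. lincomb d 1 x 1 z) -` PiE {..<d} A \<inter> space (lebesgue_Rd d)
        = PiE {..<d} (\<lambda>i. (+) (x i) -` A i)"
      by (auto simp: space_lebesgue_Rd Rd_def lincomb_def PiE_def Pi_def extensional_def
        restrict_def)
    have Ai: "(+) (x i) -` A i \<in> sets borel" if "i < d" for i
      using measurable_sets[of "(+) (x i)" borel borel "A i"] A[of i] that by simp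
    have "emeasure (distr (lebesgue_Rd d) (lebesgue_Rd d) (\<lambda>z. lincomb d 1 x 1 z)) (PiE {..<d} A)
        = emeasure (lebesgue_Rd d) (PiE {..<d} (\<lambda>i. (+) (x i) -` A i))"
      by (simp add: emeasure_distr[OF measurable_translate_lebesgue_Rd PA] vim)
    also have "\<dots> = (\<Prod>i<d. emeasure lborel ((+) (x i) -` A i))"
      by (rule emeasure_lebesgue_Rd_PiE[OF Ai])
    also have "\<dots> = (\<Prod>i<d. emeasure lborel (A i))"
    proof (intro prod.cong refl)
      fix i assume "i \<in> {..<d}"
      then have "emeasure (distr lborel borel ((+) (x i))) (A i)
          = emeasure lborel ((+) (x i) -` A i)"
        using A by (subst emeasure_distr) auto
      then show "emeasure lborel ((+) (x i) -` A i) = emeasure lborel (A i)"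
        by (simp add: lborel_distr_plus)
    qed
    finally show "emeasure (distr (lebesgue_Rd d) (lebesgue_Rd d) (\<lambda>z. lincomb d 1 x 1 z))
        (PiE {..<d} A)
        = (\<Prod>i\<in>{..<d}. emeasure lborel (A i))" .
  qed simp
  then show ?thesis by (simp add: lebesgue_Rd_def)
qed

lemma integral_translate_lebesgue_Rd:
  fixes f :: "(nat \<Rightarrow> real) \<Rightarrow> real"
  assumes "f \<in> borel_measurable (lebesgue_Rd d)"
  shows "(\<integral>y. f y \<partial>lebesgue_Rd d) = (\<integral>z. f (lincomb d 1 x 1 z) \<partial>lebesgue_Rd d)"
proof -
  have "(\<integral>z. f (lincomb d 1 x 1 z) \<partial>lebesgue_Rd d)
      = (\<integral>y. f y \<partial>distr (lebesgue_Rd d) (lebesgue_Rd d) (\<lambda>z. lincomb d 1 x 1 z))"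
    by (rule integral_distr[symmetric, OF measurable_translate_lebesgue_Rd assms])
  then show ?thesis by (simp add: distr_translate_lebesgue_Rd)
qed

lemma box_supported_integrable:
  assumes h: "continuous_on (Rd d) h" "box_supported d r h" and r: "0 \<le> r"
  shows "integrable (lebesgue_Rd d) h"
proof -
  obtain B where B: "0 \<le> B" "\<And>x. x \<in> Rd d \<Longrightarrow> \<bar>h x\<bar> \<le> B"
    using box_supported_bounded[OF h] by blast
  let ?Q = "PiE {..<d} (\<lambda>i. {0 - r..0 + r::real})"
  show ?thesis
  proof (rule Bochner_Integration.integrable_bound)
    show "integrable (lebesgue_Rd d) (\<lambda>x. B * indicator ?Q x)"
      using lebesgue_Rd_box[OF r, of d "\<lambda>_. 0"]
        by (intro integrable_mult_right integrable_real_indicator) auto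
    show "h \<in> borel_measurable (lebesgue_Rd d)"
      by (rule continuous_on_Rd_measurable[OF h(1) sets_lebesgue_Rd])
    show "AE x in lebesgue_Rd d. norm (h x) \<le> norm (B * indicator ?Q x)"
    proof (rule AE_I2)
      fix x assume "x \<in> space (lebesgue_Rd d)"
      then have x: "x \<in> Rd d" by (simp add: space_lebesgue_Rd)
      show "norm (h x) \<le> norm (B * indicator ?Q x)"
      proof (cases "x \<in> ?Q")
        case True
        then show ?thesis using B(2)[OF x] B(1) by simp
      next
        case False
        then obtain i where "i < d" "\<bar>x i\<bar> > r"
          using x by (auto simp: Rd_def PiE_def Pi_def abs_le_iff not_le)
        then have "h x = 0" using h(2) x unfolding box_supported_def by blast
        then show ?thesis by simp
      qed
    qed
  qed
qed

lemma bump_nonneg: "0 \<le> bump d a x"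
  by (simp add: bump_def flat_def)

text \<open>
  The half-width \<open>r / (d + 1)\<close> of the small box is chosen such that the box lies well inside the
  ball of radius \<open>r\<close>; there the bump has a positive lower bound.
\<close>

lemma bump_integral_pos:
  assumes r: "0 < r"
  shows "0 < (\<integral>x. bump d (r\<^sup>2) x \<partial>lebesgue_Rd d)"
proof -
  define \<delta> where "\<delta> = r / (real d + 1)"
  define s where "s = r\<^sup>2 - real d * \<delta>\<^sup>2"
  have \<delta>: "0 < \<delta>" using r by (simp add: \<delta>_def)
  have "real d * \<delta>\<^sup>2 < (real d + 1)\<^sup>2 * \<delta>\<^sup>2"
    using \<delta> by (intro mult_strict_right_mono)
      (auto simp: power2_eq_square algebra_simps add_pos_nonneg)
  also have "(real d + 1)\<^sup>2 * \<delta>\<^sup>2 = r\<^sup>2"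
    by (simp add: \<delta>_def power_divide)
  finally have s: "0 < s" by (simp add: s_def)
  let ?Q = "PiE {..<d} (\<lambda>i. {0 - \<delta>..0 + \<delta>::real})"
  have "0 < exp (- (1 / s)) * (2 * \<delta>) ^ d" using \<delta> by simp
  also have "\<dots> = (\<integral>x. exp (- (1 / s)) * indicator ?Q x \<partial>lebesgue_Rd d)"
    using lebesgue_Rd_box[of \<delta> d "\<lambda>_. 0"] \<delta> by (simp add: measure_def)
  also have "\<dots> \<le> (\<integral>x. bump d (r\<^sup>2) x \<partial>lebesgue_Rd d)"
  proof (rule integral_mono')
    show "integrable (lebesgue_Rd d) (bump d (r\<^sup>2))"
      using r by (intro box_supported_integrable[of d _ r] smooth_continuous smooth_bump
        box_supported_bump) auto
    show "exp (- (1 / s)) * indicator ?Q x \<le> bump d (r\<^sup>2) x" for x :: "nat \<Rightarrow> real"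
    proof (cases "x \<in> ?Q")
      case True
      have "(x i)\<^sup>2 \<le> \<delta>\<^sup>2" if "i < d" for i
      proof -
        have "\<bar>x i\<bar> \<le> \<bar>\<delta>\<bar>" using True that \<delta> by (force simp: PiE_def Pi_def abs_le_iff)
        then show ?thesis by (rule abs_le_square_iff[THEN iffD1])
      qed
      then have "(\<Sum>i<d. (x i)\<^sup>2) \<le> (\<Sum>i<d. \<delta>\<^sup>2)" by (intro sum_mono) auto
      then have s': "s \<le> r\<^sup>2 - (\<Sum>i<d. (x i)\<^sup>2)" by (simp add: s_def)
      then have "1 / (r\<^sup>2 - (\<Sum>i<d. (x i)\<^sup>2)) \<le> 1 / s" using s by (intro divide_left_mono) auto
      then show ?thesis using True s s' by (simp add: bump_def flat_def)
    qed (simp add: bump_nonneg)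
  qed (simp add: bump_nonneg)
  finally show ?thesis .
qed

lemma lipschitz1_continuous:
  assumes "lipschitz1 d u"
  shows "continuous_on (Rd d) u"
  unfolding continuous_on_def
proof
  fix x assume x: "x \<in> Rd d"
  show "(u \<longlongrightarrow> u x) (at x within Rd d)"
  proof (rule LIM_zero_cancel, rule Lim_null_comparison)
    show "\<forall>\<^sub>F y in at x within Rd d. norm (u y - u x) \<le> (\<Sum>i<d. \<bar>y i - x i\<bar>)"
      unfolding eventually_at_filter
    proof (intro always_eventually allI impI)
      fix y assume "y \<in> Rd d"
      then have "\<bar>u y - u x\<bar> \<le> enorm d (\<lambda>i. y i - x i)"
        using assms x unfolding lipschitz1_def by blast
      also have "\<dots> \<le> (\<Sum>i<d. \<bar>y i - x i\<bar>)" unfolding enorm_def by (rule L2_set_le_sum_abs)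
      finally show "norm (u y - u x) \<le> (\<Sum>i<d. \<bar>y i - x i\<bar>)" by simp
    qed
    have "((\<lambda>y. y i) \<longlongrightarrow> x i) (at x within Rd d)" for i
      using continuous_on_coord[of "Rd d" i] x by (simp add: continuous_on_def)
    then have "((\<lambda>y. \<Sum>i<d. \<bar>y i - x i\<bar>) \<longlongrightarrow> (\<Sum>i<d. \<bar>x i - x i\<bar>)) (at x within Rd d)"
      by (intro tendsto_intros)
    then show "((\<lambda>y. \<Sum>i<d. \<bar>y i - x i\<bar>) \<longlongrightarrow> 0) (at x within Rd d)" by simp
  qed
qed

text \<open>
  The mollified function is \<open>v(x) = (1/c) \<integral>u(y) K(y - x) dy = (1/c) \<integral>u(x + z) K(z) dz\<close> with a bump
  \<open>K\<close> of total mass \<open>c\<close>. In the first form the derivatives fall on \<open>K\<close>, which makes \<open>v\<close> smooth; in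
  the second \<open>v\<close> is an average of translates of \<open>u\<close>, hence 1-Lipschitz and close to \<open>u\<close>.
\<close>

lemma lipschitz1_mollify:
  assumes u: "lipschitz1 d u" and N: "\<And>x. x \<in> Rd d \<Longrightarrow> \<bar>u x\<bar> \<le> N" and e: "0 < e"
  obtains v where "C_b_infinity d v" "lipschitz1 d v" "\<And>x. x \<in> Rd d \<Longrightarrow> \<bar>v x - u x\<bar> \<le> e"
proof -
  define r where "r = e / (real d + 1)"
  have r: "0 < r" using e by (simp add: r_def)
  let ?K = "bump d (r\<^sup>2)"
  define c where "c = (\<integral>x. ?K x \<partial>lebesgue_Rd d)"
  have c: "0 < c" unfolding c_def by (rule bump_integral_pos[OF r])
  have bK: "box_supported d r ?K" using r by (intro box_supported_bump) simp
  have cK: "continuous_on (Rd d) ?K" by (intro smooth_continuous smooth_bump)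
  have iK: "integrable (lebesgue_Rd d) ?K" using r
    by (intro box_supported_integrable[OF cK bK]) simp
  have cu: "continuous_on (Rd d) u" by (rule lipschitz1_continuous[OF u])
  have mu: "u \<in> borel_measurable (lebesgue_Rd d)"
    by (rule continuous_on_Rd_measurable[OF cu sets_lebesgue_Rd])
  define w where "w y = u y / c" for y
  have mw: "w \<in> borel_measurable (lebesgue_Rd d)" unfolding w_def[abs_def] using mu by measurable
  have wN: "\<bar>w y\<bar> \<le> N / c" if "y \<in> Rd d" for y
    using N[OF that] c by (simp add: w_def divide_right_mono)
  define v where "v = smear d (lebesgue_Rd d) w (- 1) 1 ?K"
  have lincomb_cancel: "lincomb d (- 1) x 1 (lincomb d 1 x 1 z) = z" if "z \<in> Rd d" for x z
    by (rule Rd_eqI[of _ d]) (use that in auto)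
  have smear_eq: "smear d (lebesgue_Rd d) w (- 1) 1 h x
      = (\<integral>z. w (lincomb d 1 x 1 z) * h z \<partial>lebesgue_Rd d)"
    if h: "continuous_on (Rd d) h" for h x
  proof -
    have "(\<lambda>y. w y * h (lincomb d (- 1) x 1 y)) \<in> borel_measurable (lebesgue_Rd d)"
      using mw measurable_lincomb_compose[OF h sets_lebesgue_Rd] by (rule borel_measurable_times)
    from integral_translate_lebesgue_Rd[OF this, of x]
    have "smear d (lebesgue_Rd d) w (- 1) 1 h x
        = (\<integral>z. w (lincomb d 1 x 1 z) * h (lincomb d (- 1) x 1 (lincomb d 1 x 1 z)) \<partial>lebesgue_Rd d)"
      by (simp add: smear_def)
    also have "\<dots> = (\<integral>z. w (lincomb d 1 x 1 z) * h z \<partial>lebesgue_Rd d)"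
      by (intro Bochner_Integration.integral_cong refl) (simp add: space_lebesgue_Rd lincomb_cancel)
    finally show ?thesis .
  qed
  have int_smear: "integrable (lebesgue_Rd d) (\<lambda>z. g (lincomb d 1 x 1 z) * h z)"
    if h: "integrable (lebesgue_Rd d) h" and g: "continuous_on (Rd d) g" "\<And>y. y \<in> Rd d
        \<Longrightarrow> \<bar>g y\<bar> \<le> L" for g h :: "(nat \<Rightarrow> real) \<Rightarrow> real" and x L
    using measurable_lincomb_compose[OF g(1) sets_lebesgue_Rd] g(2)
    by (intro integrable_bounded_mult[OF h, of _ L]) auto
  have cw: "continuous_on (Rd d) w" unfolding w_def[abs_def] using cu c
    by (intro continuous_intros) auto
  let ?S = "{h. smooth d h \<and> box_supported d r h}"
  have "C_b_infinity d v"
    unfolding v_def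
  proof (rule smear_C_b_infinity(1)[OF sets_lebesgue_Rd mw, where S = ?S])
    show "?K \<in> ?S" using smooth_bump bK by simp
    show "smooth d h" if "h \<in> ?S" for h using that by simp
    show "partial_deriv i h \<in> ?S" if "h \<in> ?S" "i < d" for h i
      using that smooth_partial_deriv box_supported_partial_deriv by simp
    show "bounded (smear d (lebesgue_Rd d) w (- 1) 1 h ` Rd d)" if "h \<in> ?S" for h
    proof -
      have h: "continuous_on (Rd d) h" "box_supported d r h" using that
        by (auto intro: smooth_continuous)
      have ih: "integrable (lebesgue_Rd d) h" using r by (intro box_supported_integrable[OF h]) simp
      have "\<bar>smear d (lebesgue_Rd d) w (- 1) 1 h x\<bar> \<le> (\<integral>z. (N / c) * \<bar>h z\<bar> \<partial>lebesgue_Rd d)" for x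
        unfolding smear_eq[OF h(1)]
      proof (rule order.trans[OF integral_abs_bound], rule integral_mono)
        show "integrable (lebesgue_Rd d) (\<lambda>z. \<bar>w (lincomb d 1 x 1 z) * h z\<bar>)"
          by (intro integrable_abs int_smear[OF ih cw wN])
        show "integrable (lebesgue_Rd d) (\<lambda>z. (N / c) * \<bar>h z\<bar>)" using ih
          by (intro integrable_mult_right integrable_abs)
        show "\<bar>w (lincomb d 1 x 1 z) * h z\<bar> \<le> N / c * \<bar>h z\<bar>" for z
          unfolding abs_mult by (intro mult_right_mono wN) auto
      qed
      then show ?thesis unfolding bounded_iff by auto
    qed
    show "dominated d (lebesgue_Rd d) w (- 1) 1 h" if "h \<in> ?S" for h
      unfolding dominated_def
    proof
      fix x0 assume x0: "x0 \<in> Rd d"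
      have h: "continuous_on (Rd d) h" "box_supported d r h" using that
        by (auto intro: smooth_continuous)
      obtain B where B: "0 \<le> B" "\<And>x. x \<in> Rd d \<Longrightarrow> \<bar>h x\<bar> \<le> B"
        using box_supported_bounded[OF h] by blast
      let ?Q = "PiE {..<d} (\<lambda>i. {x0 i - (r + 1)..x0 i + (r + 1)})"
      show "\<exists>g. integrable (lebesgue_Rd d) g \<and> (\<forall>x\<in>Rd d. (\<forall>i<d. \<bar>x i - x0 i\<bar> < 1) \<longrightarrow>
          (\<forall>z\<in>space (lebesgue_Rd d). \<bar>w z * h (lincomb d (- 1) x 1 z)\<bar> \<le> g z))"
      proof (intro exI[of _ "\<lambda>z. (N / c * B) * indicator ?Q z"] conjI ballI impI)
        show "integrable (lebesgue_Rd d) (\<lambda>z. (N / c * B) * indicator ?Q z)"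
          using lebesgue_Rd_box[of "r + 1" d x0] r
            by (intro integrable_mult_right integrable_real_indicator) auto
        fix x z assume x: "x \<in> Rd d" "\<forall>i<d. \<bar>x i - x0 i\<bar> < 1" and "z \<in> space (lebesgue_Rd d)"
        then have z: "z \<in> Rd d" by (simp add: space_lebesgue_Rd)
        have N0: "0 \<le> N / c" using wN[OF z] by linarith
        show "\<bar>w z * h (lincomb d (- 1) x 1 z)\<bar> \<le> (N / c * B) * indicator ?Q z"
        proof (cases "z \<in> ?Q")
          case True
          have "\<bar>w z * h (lincomb d (- 1) x 1 z)\<bar> \<le> N / c * B"
            unfolding abs_mult using wN[OF z] B N0 by (intro mult_mono) auto
          then show ?thesis using True by simp
        next
          case False
          then obtain i where i: "i < d" "\<bar>z i - x0 i\<bar> > r + 1"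
            using z by (auto simp: Rd_def PiE_def Pi_def abs_le_iff not_le)
          have "\<bar>lincomb d (- 1) x 1 z i\<bar> > r" using i spec[OF x(2), of i] by simp
          then have "h (lincomb d (- 1) x 1 z) = 0" using h(2) i(1) lincomb_in_Rd
            unfolding box_supported_def by blast
          then show ?thesis using mult_nonneg_nonneg[OF mult_nonneg_nonneg[OF N0 B(1)]
            indicator_pos_le] by simp
        qed
      qed
    qed
  qed
  moreover have v_eq: "v x = (\<integral>z. u (lincomb d 1 x 1 z) * ?K z \<partial>lebesgue_Rd d) / c" for x
    unfolding v_def smear_eq[OF cK] w_def by simp
  have iuK: "integrable (lebesgue_Rd d) (\<lambda>z. u (lincomb d 1 x 1 z) * ?K z)" for x
    by (rule int_smear[OF iK cu N])
  have avg: "\<bar>(\<integral>z. (u (lincomb d 1 x 1 z) - b z) * ?K z \<partial>lebesgue_Rd d) / c\<bar> \<le> L"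
    if i: "integrable (lebesgue_Rd d) (\<lambda>z. b z * ?K z)"
      and bd: "\<And>z. z \<in> Rd d \<Longrightarrow> ?K z \<noteq> 0 \<Longrightarrow> \<bar>u (lincomb d 1 x 1 z) - b z\<bar> \<le> L" for b x L
  proof -
    have "\<bar>\<integral>z. (u (lincomb d 1 x 1 z) - b z) * ?K z \<partial>lebesgue_Rd d\<bar> \<le> (\<integral>z. L * ?K z \<partial>lebesgue_Rd d)"
    proof (rule order.trans[OF integral_abs_bound], rule integral_mono)
      show "integrable (lebesgue_Rd d) (\<lambda>z. \<bar>(u (lincomb d 1 x 1 z) - b z) * ?K z\<bar>)"
        using iuK[of x] i by (intro integrable_abs) (simp add: left_diff_distrib)
      show "integrable (lebesgue_Rd d) (\<lambda>z. L * ?K z)" using iK by simp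
      show "\<bar>(u (lincomb d 1 x 1 z) - b z) * ?K z\<bar> \<le> L * ?K z" if "z \<in> space (lebesgue_Rd d)" for z
        using bd[of z] that bump_nonneg[of d "r\<^sup>2" z]
        by (cases "?K z = 0") (auto simp: space_lebesgue_Rd abs_mult intro!: mult_right_mono)
    qed
    also have "\<dots> = L * c" by (simp add: c_def)
    finally show ?thesis using c by (simp add: abs_divide divide_le_eq)
  qed
  moreover have "lipschitz1 d v"
    unfolding lipschitz1_def
  proof (intro ballI)
    fix x y assume "x \<in> Rd d" "y \<in> Rd d"
    have "v x - v y = (\<integral>z. (u (lincomb d 1 x 1 z) - u (lincomb d 1 y 1 z)) * ?K z \<partial>lebesgue_Rd d) /
        c"
      unfolding v_eq left_diff_distrib
      by (simp add: diff_divide_distrib Bochner_Integration.integral_diff[OF iuK iuK])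
    moreover have "\<bar>u (lincomb d 1 x 1 z) - u (lincomb d 1 y 1 z)\<bar> \<le> enorm d (\<lambda>i. x i - y i)" for z
    proof -
      have "\<bar>u (lincomb d 1 x 1 z) - u (lincomb d 1 y 1 z)\<bar>
          \<le> enorm d (\<lambda>i. lincomb d 1 x 1 z i - lincomb d 1 y 1 z i)"
        using u unfolding lipschitz1_def by simp
      also have "\<dots> = enorm d (\<lambda>i. x i - y i)" unfolding enorm_def by (rule L2_set_cong) auto
      finally show ?thesis .
    qed
    ultimately show "\<bar>v x - v y\<bar> \<le> enorm d (\<lambda>i. x i - y i)"
      using avg[OF iuK[of y], of x] by simp
  qed
  moreover have "\<bar>v x - u x\<bar> \<le> e" if x: "x \<in> Rd d" for x
  proof -
    have i: "integrable (lebesgue_Rd d) (\<lambda>z. u x * ?K z)" using iK by simp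
    have "(\<integral>z. (u (lincomb d 1 x 1 z) - u x) * ?K z \<partial>lebesgue_Rd d) / c = v x - u x"
      unfolding v_eq left_diff_distrib using c
      by (simp add: Bochner_Integration.integral_diff[OF iuK i] diff_divide_distrib
        c_def[symmetric])
    moreover have "\<bar>u (lincomb d 1 x 1 z) - u x\<bar> \<le> e" if z: "z \<in> Rd d" "?K z \<noteq> 0" for z
    proof -
      have zr: "\<bar>z i\<bar> \<le> r" if "i < d" for i
        using bK z that unfolding box_supported_def by (meson not_le)
      have "\<bar>u (lincomb d 1 x 1 z) - u x\<bar> \<le> enorm d (\<lambda>i. lincomb d 1 x 1 z i - x i)"
        using u x unfolding lipschitz1_def by simp
      also have "\<dots> \<le> (\<Sum>i<d. \<bar>lincomb d 1 x 1 z i - x i\<bar>)" unfolding enorm_def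
        by (rule L2_set_le_sum_abs)
      also have "\<dots> \<le> (\<Sum>i<d. r)" using zr by (intro sum_mono) auto
      also have "\<dots> \<le> e" using e by (simp add: r_def field_simps)
      finally show ?thesis .
    qed
    ultimately show ?thesis using avg[OF i, of x e] by simp
  qed
  ultimately show ?thesis using that[of v] by blast
qed

section \<open>The moment bound for Lipschitz functions\<close>

lemma lipschitz1_clamp:
  assumes "lipschitz1 d u"
  shows "lipschitz1 d (\<lambda>x. max (- a) (min a (u x)))"
  unfolding lipschitz1_def
proof (intro ballI)
  fix x y assume "x \<in> Rd d" "y \<in> Rd d"
  then have "\<bar>u x - u y\<bar> \<le> enorm d (\<lambda>i. x i - y i)" using assms unfolding lipschitz1_def by blast
  moreover have "\<bar>max (- a) (min a (u x)) - max (- a) (min a (u y))\<bar> \<le> \<bar>u x - u y\<bar>" by linarith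
  ultimately show "\<bar>max (- a) (min a (u x)) - max (- a) (min a (u y))\<bar> \<le> enorm d (\<lambda>i. x i - y i)"
    by linarith
qed

text \<open>
  The inequality between the norms of \<open>L\<^sup>1\<close> and \<open>L\<^sup>p\<close> on a probability space.
\<close>

lemma abs_integral_powr_le:
  fixes f :: "'w \<Rightarrow> real"
  assumes M: "prob_space M" and p: "p \<ge> 1" and f: "integrable M (\<lambda>x. \<bar>f x\<bar> powr p)"
    and le: "(\<integral>x. \<bar>f x\<bar> powr p \<partial>M) \<le> Q powr p" and Q: "0 \<le> Q"
  shows "\<bar>\<integral>x. f x \<partial>M\<bar> \<le> Q"
proof -
  interpret prob_space M by fact
  have "\<bar>\<integral>x. f x \<partial>M\<bar> \<le> (\<integral>x. \<bar>f x\<bar> \<partial>M)" by (rule integral_abs_bound)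
  also have "\<dots> = (\<integral>x. 1 powr (1 - 1 / p) * (\<bar>f x\<bar> powr p) powr (1 / p) \<partial>M)"
    using p by (simp add: powr_powr)
  also have "\<dots> \<le> (\<integral>x. 1 \<partial>M) powr (1 - 1 / p) * (Q powr p) powr (1 / p)"
    using p f le by (intro hoelder_interpolation(2)) (auto simp: prob_space)
  also have "\<dots> = Q" using p Q by (simp add: prob_space powr_powr)
  finally show ?thesis .
qed

lemma powr_add_le:
  fixes a b p :: real
  assumes "0 \<le> a" "0 \<le> b" "0 \<le> p"
  shows "(a + b) powr p \<le> 2 powr p * (a powr p + b powr p)"
proof -
  have "(a + b) powr p \<le> (2 * max a b) powr p" using assms by (intro powr_mono2) auto
  also have "\<dots> = 2 powr p * max a b powr p" using assms by (simp add: powr_mult)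
  also have "max a b powr p \<le> a powr p + b powr p" by (simp add: max_def)
  finally show ?thesis by simp
qed

text \<open>
  Let \<open>v\<^sub>n\<close> be smooth approximations of \<open>u\<close>, with Gaussian means \<open>m\<^sub>n\<close> and \<open>\<nu>\<close>-means \<open>a\<^sub>n\<close>. The smooth
  case bounds \<open>v\<^sub>n - m\<^sub>n\<close> in \<open>L\<^sup>p\<close> by \<open>Q\<close>, hence also \<open>\<bar>a\<^sub>n - m\<^sub>n\<bar> \<le> Q\<close>. As \<open>a\<^sub>n\<close> tends to
  \<open>\<integral>u d\<nu> = 0\<close>, both \<open>v\<^sub>n - m\<^sub>n\<close> and the constants \<open>m\<^sub>n\<close> contribute \<open>Q\<close> in the limit; the crude
  inequality \<open>(a + b)\<^sup>p \<le> 2\<^sup>p (a\<^sup>p + b\<^sup>p)\<close> accounts for the factor \<open>4\<close>.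
\<close>

lemma lipschitz1_moment_bound:
  assumes \<nu>: "prob_space \<nu>" "sets \<nu> = sets (borel_Rd d)" "centered d \<nu>" "stein_kernel d \<nu> \<tau>"
    and u: "lipschitz1 d u" "has_bochner_integral \<nu> u 0" and p: "p \<ge> 2"
    and S: "integrable \<nu> (\<lambda>x. hs_norm d (\<lambda>i j. \<tau> x i j - id_mat i j) powr p)"
      "(\<integral>x. hs_norm d (\<lambda>i j. \<tau> x i j - id_mat i j) powr p \<partial>\<nu>) \<le> S"
    and T: "0 \<le> T" "(\<integral>\<^sup>+x. ennreal (op_norm d (\<tau> x) powr (p / 2)) \<partial>\<nu>) \<le> ennreal T"
  shows "(\<integral>\<^sup>+x. ennreal (\<bar>u x\<bar> powr p) \<partial>\<nu>)
      \<le> ennreal ((4 * (2 * S powr (1 / p) + sqrt p * T powr (1 / p))) powr p)"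
proof -
  interpret prob_space \<nu> by fact
  have sp: "space \<nu> = Rd d" using sets_eq_imp_space_eq[OF \<nu>(2)] by (simp add: space_borel_Rd)
  define Q where "Q = 2 * S powr (1 / p) + sqrt p * T powr (1 / p)"
  have Q: "0 \<le> Q" using p by (simp add: Q_def)
  \<comment> \<open>Clamping makes \<open>u\<close> bounded and keeps it 1-Lipschitz, so that it can be mollified.\<close>
  define un where "un n x = max (- real n) (min (real n) (u x))" for n x
  have "\<exists>v. C_b_infinity d v \<and> lipschitz1 d v \<and> (\<forall>x\<in>Rd d. \<bar>v x - un n x\<bar> \<le> 1 / real (Suc n))" for n
  proof -
    have "lipschitz1 d (un n)" unfolding un_def[abs_def] by (rule lipschitz1_clamp[OF u(1)])
    moreover have "\<bar>un n x\<bar> \<le> real n" for x unfolding un_def by linarith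
    ultimately show ?thesis using lipschitz1_mollify[of d "un n" "real n" "1 / real (Suc n)"]
      by (metis of_nat_0_less_iff zero_less_Suc zero_less_divide_1_iff)
  qed
  then obtain v where v: "\<And>n. C_b_infinity d (v n)" "\<And>n. lipschitz1 d (v n)"
    and v_un: "\<And>n x. x \<in> Rd d \<Longrightarrow> \<bar>v n x - un n x\<bar> \<le> 1 / real (Suc n)" by metis
  have cv: "continuous_on (Rd d) (v n)" for n by (rule lipschitz1_continuous[OF v(2)])
  have mv [measurable]: "v n \<in> borel_measurable \<nu>" for n
    by (rule continuous_on_Rd_measurable[OF cv \<nu>(2)])
  have iu: "integrable \<nu> u" "(\<integral>x. u x \<partial>\<nu>) = 0" using u(2) by (auto simp: has_bochner_integral_iff)
  have [measurable]: "u \<in> borel_measurable \<nu>" using iu by auto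
  have lim: "(\<lambda>n. v n x) \<longlonglongrightarrow> u x" if x: "x \<in> Rd d" for x
  proof (rule LIM_zero_cancel, rule Lim_null_comparison)
    obtain n0 where n0: "\<bar>u x\<bar> \<le> real n0" using real_arch_simple by blast
    show "\<forall>\<^sub>F n in sequentially. norm (v n x - u x) \<le> 1 / real (Suc n)"
      using eventually_ge_at_top[of n0]
    proof eventually_elim
      case (elim n)
      then have "un n x = u x" using n0 unfolding un_def by linarith
      then show ?case using v_un[OF x, of n] by simp
    qed
    show "(\<lambda>n. 1 / real (Suc n)) \<longlonglongrightarrow> 0" using LIMSEQ_Suc[OF lim_1_over_n] by simp
  qed
  have v_le: "\<bar>v n x\<bar> \<le> \<bar>u x\<bar> + 1" if x: "x \<in> Rd d" for n x
  proof -
    have "\<bar>un n x\<bar> \<le> \<bar>u x\<bar>" unfolding un_def by linarith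
    moreover have "1 / real (Suc n) \<le> 1" by simp
    ultimately show ?thesis using v_un[OF x, of n] by linarith
  qed
  define m where "m n = (\<integral>z. v n z \<partial>gauss d)" for n
  define a where "a n = (\<integral>x. v n x \<partial>\<nu>)" for n
  have a_lim: "a \<longlonglongrightarrow> 0"
  proof -
    have "(\<lambda>n. \<integral>x. v n x \<partial>\<nu>) \<longlonglongrightarrow> (\<integral>x. u x \<partial>\<nu>)"
      by (rule integral_dominated_convergence[where w="\<lambda>x. \<bar>u x\<bar> + 1"])
        (use iu lim v_le in \<open>auto simp: sp\<close>)
    then show ?thesis by (simp add: a_def[abs_def] iu(2))
  qed
  define b where "b n = real n + 1" for n
  have b: "\<bar>v n x\<bar> \<le> b n" if "x \<in> Rd d" for n x
  proof -
    have "\<bar>un n x\<bar> \<le> real n" unfolding un_def by linarith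
    moreover have "1 / real (Suc n) \<le> 1" by simp
    ultimately show ?thesis using v_un[OF that, of n] unfolding b_def by linarith
  qed
  have i_v: "integrable \<nu> (v n)" for n
    by (rule bounded_integrable[OF finite_measure_axioms mv b]) (simp add: sp)
  have i_vm: "integrable \<nu> (\<lambda>x. \<bar>v n x - m n\<bar> powr p)" for n
  proof (rule bounded_integrable[OF finite_measure_axioms])
    show "(\<lambda>x. \<bar>v n x - m n\<bar> powr p) \<in> borel_measurable \<nu>" by measurable
    show "\<bar>\<bar>v n x - m n\<bar> powr p\<bar> \<le> (b n + \<bar>m n\<bar>) powr p" if "x \<in> space \<nu>" for x
      using b[of x n] that p by (auto simp: sp intro!: powr_mono2)
  qed
  have vm: "(\<integral>x. \<bar>v n x - m n\<bar> powr p \<partial>\<nu>) \<le> Q powr p" for n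
    unfolding m_def Q_def by (rule smooth_moment_bound[OF \<nu> v p S T])
  have am: "\<bar>a n - m n\<bar> \<le> Q" for n
  proof -
    have "\<bar>\<integral>x. v n x - m n \<partial>\<nu>\<bar> \<le> Q"
      using p by (intro abs_integral_powr_le[OF \<nu>(1) _ i_vm vm Q]) simp
    then show ?thesis using i_v[of n] by (simp add: a_def prob_space)
  qed
  have bound_n: "(\<integral>\<^sup>+x. ennreal (\<bar>v n x\<bar> powr p) \<partial>\<nu>)
      \<le> ennreal (2 powr p * (Q powr p + (Q + \<bar>a n\<bar>) powr p))" for n
  proof -
    have i: "integrable \<nu> (\<lambda>x. 2 powr p * (\<bar>v n x - m n\<bar> powr p + (Q + \<bar>a n\<bar>) powr p))"
      using i_vm by simp
    have "\<bar>v n x\<bar> powr p \<le> 2 powr p * (\<bar>v n x - m n\<bar> powr p + (Q + \<bar>a n\<bar>) powr p)" for x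
    proof -
      have "\<bar>v n x\<bar> powr p \<le> (\<bar>v n x - m n\<bar> + (Q + \<bar>a n\<bar>)) powr p"
        using am[of n] p by (intro powr_mono2) auto
      also have "\<dots> \<le> 2 powr p * (\<bar>v n x - m n\<bar> powr p + (Q + \<bar>a n\<bar>) powr p)"
        using Q p by (intro powr_add_le) auto
      finally show ?thesis .
    qed
    then have "(\<integral>\<^sup>+x. ennreal (\<bar>v n x\<bar> powr p) \<partial>\<nu>)
        \<le> (\<integral>\<^sup>+x. ennreal (2 powr p * (\<bar>v n x - m n\<bar> powr p + (Q + \<bar>a n\<bar>) powr p)) \<partial>\<nu>)"
      by (intro nn_integral_mono ennreal_leI)
    also have "\<dots> = ennreal (\<integral>x. 2 powr p * (\<bar>v n x - m n\<bar> powr p + (Q + \<bar>a n\<bar>) powr p) \<partial>\<nu>)"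
      by (rule nn_integral_eq_integral[OF i]) simp
    also have "(\<integral>x. 2 powr p * (\<bar>v n x - m n\<bar> powr p + (Q + \<bar>a n\<bar>) powr p) \<partial>\<nu>)
        = 2 powr p * ((\<integral>x. \<bar>v n x - m n\<bar> powr p \<partial>\<nu>) + (Q + \<bar>a n\<bar>) powr p)"
      using i_vm by (simp add: prob_space)
    also have "\<dots> \<le> 2 powr p * (Q powr p + (Q + \<bar>a n\<bar>) powr p)"
      using vm[of n] by (intro mult_left_mono add_right_mono) auto
    finally show ?thesis by (simp add: ennreal_leI)
  qed
  have "(\<integral>\<^sup>+x. ennreal (\<bar>u x\<bar> powr p) \<partial>\<nu>) = (\<integral>\<^sup>+x. liminf (\<lambda>n. ennreal (\<bar>v n x\<bar> powr p)) \<partial>\<nu>)"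
  proof (rule nn_integral_cong)
    fix x assume "x \<in> space \<nu>"
    then have "(\<lambda>n. \<bar>v n x\<bar>) \<longlonglongrightarrow> \<bar>u x\<bar>" by (intro tendsto_rabs lim) (simp add: sp)
    then have "(\<lambda>n. \<bar>v n x\<bar> powr p) \<longlonglongrightarrow> \<bar>u x\<bar> powr p"
      using p by (intro tendsto_powr2) auto
    then have "(\<lambda>n. ennreal (\<bar>v n x\<bar> powr p)) \<longlonglongrightarrow> ennreal (\<bar>u x\<bar> powr p)" by simp
    then show "ennreal (\<bar>u x\<bar> powr p) = liminf (\<lambda>n. ennreal (\<bar>v n x\<bar> powr p))"
      by (intro lim_imp_Liminf[symmetric]) simp_all
  qed
  also have "\<dots> \<le> liminf (\<lambda>n. \<integral>\<^sup>+x. ennreal (\<bar>v n x\<bar> powr p) \<partial>\<nu>)"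
    by (rule nn_integral_liminf) measurable
  also have "\<dots> \<le> liminf (\<lambda>n. ennreal (2 powr p * (Q powr p + (Q + \<bar>a n\<bar>) powr p)))"
    by (intro Liminf_mono always_eventually allI bound_n)
  also have "\<dots> = ennreal (2 powr p * (Q powr p + (Q + \<bar>0\<bar>) powr p))"
  proof (rule lim_imp_Liminf)
    have "(\<lambda>n. (Q + \<bar>a n\<bar>) powr p) \<longlonglongrightarrow> (Q + \<bar>0\<bar>) powr p"
      using p Q a_lim by (intro tendsto_powr2 tendsto_intros) auto
    then show "(\<lambda>n. ennreal (2 powr p * (Q powr p + (Q + \<bar>a n\<bar>) powr p)))
        \<longlonglongrightarrow> ennreal (2 powr p * (Q powr p + (Q + \<bar>0\<bar>) powr p))"
      by (intro tendsto_ennrealI tendsto_mult tendsto_add tendsto_const)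
  qed simp
  also have "\<dots> \<le> ennreal ((4 * Q) powr p)"
  proof (rule ennreal_leI)
    have "(2::real) powr 1 \<le> 2 powr p" using p by (intro powr_mono) auto
    then have "2 * Q powr p \<le> 2 powr p * Q powr p" by (intro mult_right_mono) auto
    then have "2 powr p * (2 * Q powr p) \<le> 2 powr p * (2 powr p * Q powr p)"
      by (intro mult_left_mono) auto
    also have "\<dots> = (4 * Q) powr p"
      using powr_mult[of 2 2 p] Q by (simp add: powr_mult)
    finally show "2 powr p * (Q powr p + (Q + \<bar>0\<bar>) powr p) \<le> (4 * Q) powr p" by simp
  qed
  finally show ?thesis by (simp add: Q_def)
qed

lemma ennpowr_top [simp]: "ennpowr \<infinity> a = \<infinity>" "ennpowr top a = top"
  by (simp_all add: ennpowr_def)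

lemma ennpowr_ennreal: "0 \<le> r \<Longrightarrow> ennpowr (ennreal r) a = ennreal (r powr a)"
  by (simp add: ennpowr_def)

text \<open>
  If one of the integrals on the right-hand side is infinite there is nothing to prove. Otherwise
  the constant is \<open>8 = 4 * 2\<close>, where \<open>2\<close> is the coefficient of the discrepancy in the bound for
  smooth functions.
\<close>

theorem theorem2p8:
  shows "\<exists>C::real. C > 0 \<and>
    (\<forall>(d::nat) (\<nu>::(nat \<Rightarrow> real) measure) (\<tau>::(nat \<Rightarrow> real) \<Rightarrow> nat \<Rightarrow> nat \<Rightarrow> real).
       d \<ge> 1 \<longrightarrow> prob_space \<nu> \<longrightarrow> sets \<nu> = sets (borel_Rd d) \<longrightarrow>
       centered d \<nu> \<longrightarrow> stein_kernel d \<nu> \<tau> \<longrightarrow>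
       (\<forall>(u::(nat \<Rightarrow> real) \<Rightarrow> real) (p::real).
          lipschitz1 d u \<longrightarrow> has_bochner_integral \<nu> u 0 \<longrightarrow> p \<ge> 2 \<longrightarrow>
          ennpowr (\<integral>\<^sup>+x. ennreal (\<bar>u x\<bar> powr p) \<partial>\<nu>) (1 / p)
            \<le> ennreal C *
               (stein_discrepancy d p \<nu> \<tau>
                + ennreal (sqrt p) *
                  ennpowr (\<integral>\<^sup>+x. ennreal (op_norm d (\<tau> x) powr (p / 2)) \<partial>\<nu>) (1 / p))))"
proof (intro exI[of _ 8] conjI allI impI)
  fix d :: nat and \<nu> :: "(nat \<Rightarrow> real) measure" and \<tau> :: "(nat \<Rightarrow> real) \<Rightarrow> nat \<Rightarrow> nat \<Rightarrow> real"
    and u :: "(nat \<Rightarrow> real) \<Rightarrow> real" and p :: real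
  assume \<nu>: "prob_space \<nu>" "sets \<nu> = sets (borel_Rd d)" "centered d \<nu>" "stein_kernel d \<nu> \<tau>"
    and u: "lipschitz1 d u" "has_bochner_integral \<nu> u 0" and p: "2 \<le> p"
  define hs where "hs x = hs_norm d (\<lambda>i j. \<tau> x i j - id_mat i j)" for x
  define X where "X = (\<integral>\<^sup>+x. ennreal (hs x powr p) \<partial>\<nu>)"
  define Y where "Y = (\<integral>\<^sup>+x. ennreal (op_norm d (\<tau> x) powr (p / 2)) \<partial>\<nu>)"
  let ?I = "\<integral>\<^sup>+x. ennreal (\<bar>u x\<bar> powr p) \<partial>\<nu>"
  have goal: "ennpowr ?I (1 / p) \<le> ennreal 8
      * (ennpowr X (1 / p) + ennreal (sqrt p) * ennpowr Y (1 / p))"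
  proof (cases "X = \<infinity> \<or> Y = \<infinity>")
    case True
    then have "ennreal 8 * (ennpowr X (1 / p) + ennreal (sqrt p) * ennpowr Y (1 / p)) = \<infinity>"
      using p by (auto simp: ennreal_mult_top ennreal_mult_eq_top_iff)
    then show ?thesis unfolding infinity_ennreal_def by (simp only: top_greatest)
  next
    case False
    then obtain S T where S: "X = ennreal S" "0 \<le> S" and T: "Y = ennreal T" "0 \<le> T"
      by (cases X; cases Y) auto
    have "(\<lambda>x. \<tau> x i j - id_mat i j) \<in> borel_measurable \<nu>" if "i < d" "j < d" for i j
      using \<nu>(4) that unfolding stein_kernel_def by (intro borel_measurable_diff) auto
    then have "(\<lambda>x. hs_inner d (\<lambda>i j. \<tau> x i j - id_mat i j) (\<lambda>i j. \<tau> x i j - id_mat i j)) \<in>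
        borel_measurable \<nu>"
      unfolding hs_inner_def by (intro borel_measurable_sum borel_measurable_times) auto
    then have [measurable]: "hs \<in> borel_measurable \<nu>" unfolding hs_def[abs_def] hs_norm_def
      by measurable
    have int: "integrable \<nu> (\<lambda>x. hs x powr p)"
      using S by (intro integrableI_bounded) (auto simp: X_def)
    have le: "(\<integral>x. hs x powr p \<partial>\<nu>) \<le> S"
      using nn_integral_eq_integral[OF int] S by (simp add: X_def)
    define R where "R = 4 * (2 * S powr (1 / p) + sqrt p * T powr (1 / p))"
    have R: "0 \<le> R" using p by (simp add: R_def)
    have I_le: "?I \<le> ennreal (R powr p)"
      unfolding R_def using T
      by (intro lipschitz1_moment_bound[OF \<nu> u p int[unfolded hs_def] le[unfolded hs_def]])
        (auto simp: Y_def)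
    then have "?I \<noteq> \<infinity>" by (auto simp: top_unique)
    then obtain r where r: "?I = ennreal r" "0 \<le> r" by (cases ?I) auto
    then have "r \<le> R powr p" using I_le by simp
    have "r powr (1 / p) \<le> (R powr p) powr (1 / p)" using r \<open>r \<le> R powr p\<close> p
      by (intro powr_mono2) auto
    also have "\<dots> = R" using R p by (simp add: powr_powr)
    also have "R \<le> 8 * (S powr (1 / p) + sqrt p * T powr (1 / p))" using p by (simp add: R_def)
    finally have "ennreal (r powr (1 / p))
        \<le> ennreal (8 * (S powr (1 / p) + sqrt p * T powr (1 / p)))"
      by (rule ennreal_leI)
    then show ?thesis
      using r S T p by (simp add: ennpowr_ennreal ennreal_mult ennreal_plus)
  qed
  then show "ennpowr ?I (1 / p) \<le> ennreal 8 * (stein_discrepancy d p \<nu> \<tau>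
      + ennreal (sqrt p) * ennpowr (\<integral>\<^sup>+x. ennreal (op_norm d (\<tau> x) powr (p / 2)) \<partial>\<nu>) (1 / p))"
    unfolding stein_discrepancy_def X_def Y_def hs_def .
qed simp

end
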